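(* Let $n\ge2$, $1\le d\le n$, $\epsilon\in\{+,-\}$ with $(d,\epsilon)\ne(n,-)$, $\delta\in\{0,1\}$, $X=\mathrm{Sp}_{2n}(2)$, let $\Gamma=\Gamma(n,d,\epsilon,\delta)$ in $J(\mathcal{Q}^\epsilon,k)$ with $k=2^{n-1}(2^{n-d}+\epsilon)$ if $\delta=0$ and $k=2^{2n-d-1}(2^d-1)$ if $\delta=1$, and let $A=\mathrm{Aut}(\Gamma)$. Then: (a) for each codeword $\Delta^\delta(U)$, with $U$ a totally isotropic $d$-dimensional subspace, $X_U=X_{\Delta^\delta(U)}$; (b) $\Gamma$ is $X$-strongly incidence-transitive and is not self-complementary; (c) $3\le k\le|\mathcal{Q}^\epsilon|-3$ unless $(n,d,\epsilon)=(2,1,-)$; (d) $A=X$.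
   Context: Let $V=\mathbb{F}_2^{2n}$ with a symplectic form $B$, and $X=\mathrm{Sp}_{2n}(2)$ its isometry group (acting on the right). $\mathcal{Q}^\epsilon$ is the set of quadratic forms $\phi:V\to\mathbb{F}_2$ of type $\epsilon$ with $\phi(x+y)+\phi(x)+\phi(y)=B(x,y)$; signs are $\pm1$ in arithmetic, $|\mathcal{Q}^\epsilon|=2^{n-1}(2^n+\epsilon)$. $X$ acts on $\mathcal{Q}^\epsilon$ by $\phi^g(x)=\phi(xg^{-1})$, so $X$ is viewed as a subgroup of $\mathrm{Sym}(\mathcal{Q}^\epsilon)$. $U$ totally isotropic means $B(U,U)=0$; $X_U$, $X_\Delta$ are setwise stabilisers; $\mathrm{Sing}(\phi)=\{x:\phi(x)=0\}$. $J(\mathcal V,k)$: vertices the $k$-subsets of $\mathcal V$, adjacent iff they meet in $k-1$ points. A code is a nonempty vertex set; $\mathrm{Aut}(\Gamma)$ is the group of graph automorphisms preserving $\Gamma$. $\Gamma$ is $G$-strongly incidence-transitive if $G$ is transitive on $\Gamma$ and each $G_\Delta$ is transitive on $\Delta\times(\mathcal V\setminus\Delta)$; self-complementary means $\{\mathcal V\setminus\Delta:\Delta\in\Gamma\}=\Gamma$. $\Gamma(n,d,\epsilon,\delta)$ is the code in $J(\mathcal{Q}^\epsilon,k)$ consisting of $\Delta^\delta(U)=\{\phi\in\mathcal{Q}^\epsilon:\dim(\mathrm{Sing}(\phi)\cap U)=d-\delta\}$ for all totally isotropic $d$-dimensional subspaces $U$. *)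

theory Defs
  imports
    "HOL-Analysis.Analysis"
    "HOL-Library.Z2"
    "HOL-Algebra.Bij"
begin

section \<open>Symplectic and quadratic forms over the field with two elements\<close>

definition symplectic_form :: "(bit ^ 'm \<Rightarrow> bit ^ 'm \<Rightarrow> bit) \<Rightarrow> bool" where
  "symplectic_form B \<longleftrightarrow>
     (\<forall>x. Vector_Spaces.linear (*s) (*) (\<lambda>y. B x y)) \<and>
     (\<forall>y. Vector_Spaces.linear (*s) (*) (\<lambda>x. B x y)) \<and>
     (\<forall>x. B x x = 0) \<and>
     (\<forall>x. (\<forall>y. B x y = 0) \<longrightarrow> x = 0)"

text \<open>Elements act on the right: \<open>x g\<close> is written \<open>g x\<close> below.\<close>

definition Sp :: "(bit ^ 'm \<Rightarrow> bit ^ 'm \<Rightarrow> bit) \<Rightarrow> (bit ^ 'm \<Rightarrow> bit ^ 'm) set" where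
  "Sp B = {g. Vector_Spaces.linear (*s) (*s) g \<and> bij g \<and> (\<forall>x y. B (g x) (g y) = B x y)}"

definition totally_isotropic :: "(bit ^ 'm \<Rightarrow> bit ^ 'm \<Rightarrow> bit) \<Rightarrow> (bit ^ 'm) set \<Rightarrow> bool" where
  "totally_isotropic B U \<longleftrightarrow> (\<forall>x\<in>U. \<forall>y\<in>U. B x y = 0)"

definition quadratic_form_of ::
  "(bit ^ 'm \<Rightarrow> bit ^ 'm \<Rightarrow> bit) \<Rightarrow> (bit ^ 'm \<Rightarrow> bit) \<Rightarrow> bool" where
  "quadratic_form_of B \<phi> \<longleftrightarrow>
     (\<forall>c x. \<phi> (c *s x) = c\<^sup>2 * \<phi> x) \<and>
     (\<forall>x y. \<phi> (x + y) + \<phi> x + \<phi> y = B x y)"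

definition Sing :: "(bit ^ 'm \<Rightarrow> bit) \<Rightarrow> (bit ^ 'm) set" where
  "Sing \<phi> = {x. \<phi> x = 0}"

definition witt_index :: "(bit ^ 'm \<Rightarrow> bit) \<Rightarrow> nat" where
  "witt_index \<phi> = Max {vec.dim W | W. vec.subspace W \<and> W \<subseteq> Sing \<phi>}"

text \<open>
  On a space of dimension \<open>2 * n\<close>, a nondegenerate quadratic form has type \<open>+\<close> (hyperbolic) if its
  Witt index is \<open>n\<close> and type \<open>-\<close> (elliptic) if its Witt index is \<open>n - 1\<close>.
  The sign is the integer \<open>1\<close> or \<open>-1\<close>.
\<close>

definition quadratic_forms ::
  "(bit ^ 'm \<Rightarrow> bit ^ 'm \<Rightarrow> bit) \<Rightarrow> nat \<Rightarrow> int \<Rightarrow> (bit ^ 'm \<Rightarrow> bit) set" where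
  "quadratic_forms B n \<epsilon> =
     {\<phi>. quadratic_form_of B \<phi> \<and> witt_index \<phi> = (if \<epsilon> = 1 then n else n - 1)}"

definition form_action :: "(bit ^ 'm \<Rightarrow> bit ^ 'm) \<Rightarrow> (bit ^ 'm \<Rightarrow> bit) \<Rightarrow> (bit ^ 'm \<Rightarrow> bit)" where
  "form_action g \<phi> = (\<lambda>x. \<phi> (inv_into UNIV g x))"

text \<open>The image of the isometry group in the symmetric group on the forms of a given type.\<close>

definition Sp_on_forms ::
  "(bit ^ 'm \<Rightarrow> bit ^ 'm \<Rightarrow> bit) \<Rightarrow> nat \<Rightarrow> int
     \<Rightarrow> ((bit ^ 'm \<Rightarrow> bit) \<Rightarrow> (bit ^ 'm \<Rightarrow> bit)) set" where
  "Sp_on_forms B n \<epsilon> = (\<lambda>g. restrict (form_action g) (quadratic_forms B n \<epsilon>)) ` Sp B"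

definition setwise_stabiliser :: "'g set \<Rightarrow> ('g \<Rightarrow> 'a \<Rightarrow> 'a) \<Rightarrow> 'a set \<Rightarrow> 'g set" where
  "setwise_stabiliser G act S = {g \<in> G. act g ` S = S}"


section \<open>Codes in Johnson graphs\<close>

definition johnson_vertices :: "'a set \<Rightarrow> nat \<Rightarrow> 'a set set" where
  "johnson_vertices \<V> k = {S. S \<subseteq> \<V> \<and> finite S \<and> card S = k}"

definition johnson_adj :: "nat \<Rightarrow> 'a set \<Rightarrow> 'a set \<Rightarrow> bool" where
  "johnson_adj k S T \<longleftrightarrow> int (card (S \<inter> T)) = int k - 1"

definition johnson_code :: "'a set \<Rightarrow> nat \<Rightarrow> 'a set set \<Rightarrow> bool" where
  "johnson_code \<V> k \<Gamma> \<longleftrightarrow> \<Gamma> \<noteq> {} \<and> \<Gamma> \<subseteq> johnson_vertices \<V> k"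

definition johnson_aut :: "'a set \<Rightarrow> nat \<Rightarrow> ('a set \<Rightarrow> 'a set) set" where
  "johnson_aut \<V> k =
     {f \<in> Bij (johnson_vertices \<V> k).
        \<forall>S \<in> johnson_vertices \<V> k. \<forall>T \<in> johnson_vertices \<V> k.
          johnson_adj k (f S) (f T) \<longleftrightarrow> johnson_adj k S T}"

definition code_aut :: "'a set \<Rightarrow> nat \<Rightarrow> 'a set set \<Rightarrow> ('a set \<Rightarrow> 'a set) set" where
  "code_aut \<V> k \<Gamma> = {f \<in> johnson_aut \<V> k. f ` \<Gamma> = \<Gamma>}"

definition on_subsets :: "'a set \<Rightarrow> nat \<Rightarrow> ('a \<Rightarrow> 'a) \<Rightarrow> ('a set \<Rightarrow> 'a set)" where
  "on_subsets \<V> k g = restrict (\<lambda>S. g ` S) (johnson_vertices \<V> k)"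

definition strongly_incidence_transitive ::
  "'a set \<Rightarrow> ('a \<Rightarrow> 'a) set \<Rightarrow> 'a set set \<Rightarrow> bool" where
  "strongly_incidence_transitive \<V> G \<Gamma> \<longleftrightarrow>
     subgroup G (BijGroup \<V>) \<and>
     (\<forall>g\<in>G. \<forall>\<Delta>\<in>\<Gamma>. g ` \<Delta> \<in> \<Gamma>) \<and>
     (\<forall>\<Delta>\<in>\<Gamma>. \<forall>\<Delta>'\<in>\<Gamma>. \<exists>g\<in>G. g ` \<Delta> = \<Delta>') \<and>
     (\<forall>\<Delta>\<in>\<Gamma>. \<forall>(a, b) \<in> \<Delta> \<times> (\<V> - \<Delta>). \<forall>(a', b') \<in> \<Delta> \<times> (\<V> - \<Delta>).
        \<exists>g \<in> setwise_stabiliser G (\<lambda>g. g) \<Delta>. g a = a' \<and> g b = b')"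

definition self_complementary :: "'a set \<Rightarrow> 'a set set \<Rightarrow> bool" where
  "self_complementary \<V> \<Gamma> \<longleftrightarrow> (\<lambda>\<Delta>. \<V> - \<Delta>) ` \<Gamma> = \<Gamma>"


section \<open>The codes\<close>

definition codeword ::
  "(bit ^ 'm \<Rightarrow> bit ^ 'm \<Rightarrow> bit) \<Rightarrow> nat \<Rightarrow> nat \<Rightarrow> int \<Rightarrow> nat \<Rightarrow> (bit ^ 'm) set
     \<Rightarrow> (bit ^ 'm \<Rightarrow> bit) set" where
  "codeword B n d \<epsilon> \<delta> U = {\<phi> \<in> quadratic_forms B n \<epsilon>. vec.dim (Sing \<phi> \<inter> U) = d - \<delta>}"

definition code ::
  "(bit ^ 'm \<Rightarrow> bit ^ 'm \<Rightarrow> bit) \<Rightarrow> nat \<Rightarrow> nat \<Rightarrow> int \<Rightarrow> nat \<Rightarrow> (bit ^ 'm \<Rightarrow> bit) set set" where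
  "code B n d \<epsilon> \<delta> =
     {codeword B n d \<epsilon> \<delta> U | U. vec.subspace U \<and> totally_isotropic B U \<and> vec.dim U = d}"

end

theory Submission
  imports Defs
begin

text \<open>
  The sign of a quadratic form \<open>\<phi>\<close> polarising to \<open>B\<close> is the sign of its Gauss sum
  \<open>\<Sum>x. (-1)^(\<phi> x) = \<plusminus> 2^n\<close>, and a translate \<open>\<phi> + B(a, _)\<close> has the same sign iff \<open>\<phi> a = 0\<close>. Hence
  the forms of a given sign are the translates of \<open>\<phi>\<close> by its singular vectors, \<open>\<Delta>\<^sup>0(U)\<close> consists of
  those vanishing on \<open>U\<close>, and \<open>\<Delta>\<^sup>1(U)\<close> is its complement. Character sums over \<open>U\<close> give the sizes, and
  products of transvections give the transitivity statements.

  For the automorphism group, an automorphism of the Johnson graph is induced by a permutation \<open>\<sigma>\<close>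
  of the forms, because \<open>|\<Q>| \<noteq> 2 k\<close> by parity. Four distinct forms have sum zero iff some codeword
  \<open>\<Delta>\<^sup>0(U)\<close> contains them all and no such codeword contains exactly three of them, so \<open>\<sigma>\<close> preserves zero-sum
  quadruples. Based at a form \<open>\<phi>\<close>, these encode orthogonality of singular vectors of \<open>\<phi>\<close>. So \<open>\<sigma>\<close>
  induces a map of singular vectors that preserves \<open>B\<close>; as the singular vectors span, it extends to an isometry.
\<close>

section \<open>Vector spaces over the field with two elements\<close>

text \<open>Witt's theorem is avoided. A transvection with vector \<open>v\<close> sends
  \<open>\<phi>\<close> to its translate by \<open>v\<close> when \<open>\<phi> v = 0\<close> and
  fixes \<open>\<phi>\<close> otherwise, so explicit products of transvections move forms and keep
  control of \<open>U\<close>. Totally singular subspaces are enlarged by an exchange argument that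
  counts perpendiculars. The zero-sum criterion holds because the forms are points of an affine
  space over \<open>V\<close> in which each condition \<open>\<phi> u = 0\<close> is affine: three
  members of a zero-sum quadruple in a codeword force the fourth. Conversely, splitting a quadruple
  with nonzero sum takes a singular vector outside the plane of directions of three of its forms.
  For small \<open>d\<close> the given \<open>U\<close> may offer none for a particular triple; the
  choice of the triple out of the four forms provides the necessary freedom. The exclusion of
  \<open>(n, -1)\<close> for \<open>(d, \<epsilon>)\<close> says that \<open>d\<close> is at most
  the Witt index, so that codewords are nonempty. The case \<open>\<delta> = 1\<close> is reduced to
  \<open>\<delta> = 0\<close> by complementation throughout.\<close>

instance bit :: finite
proof
  have "(UNIV :: bit set) = {0, 1}"
    by auto
  then show "finite (UNIV :: bit set)"
    by (metis finite.emptyI finite.insertI)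
qed

lemma CARD_bit: "CARD(bit) = 2"
proof -
  have "(UNIV :: bit set) = {0, 1}"
    by auto
  then show ?thesis
    by (metis card_2_iff zero_neq_one)
qed

text \<open>The default simp rules rewrite addition of bits to exclusive or, which blocks ring reasoning.\<close>

declare add_bit_eq_xor [simp del] mult_bit_eq_and [simp del]

lemma bit_add_self [simp]: "b + b = (0 :: bit)"
  by (cases b) auto

lemma bit_add_self_left [simp]: "a + (a + b) = (b :: bit)"
  by (cases a; cases b) auto

lemma bit_add_eq_0_iff: "a + b = 0 \<longleftrightarrow> a = (b :: bit)"
  by (cases a; cases b) auto

lemma vec_add_self [simp]: "x + x = (0 :: bit ^ 'm)"
  by (simp add: vec_eq_iff)

lemma vec_add_self_left [simp]: "x + (x + y) = (y :: bit ^ 'm)"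
  by (simp add: vec_eq_iff)

lemma vec_two_mult_bit [simp]: "2 * x = (0 :: bit ^ 'm)" "x * 2 = (0 :: bit ^ 'm)"
  by (simp_all add: mult_2 mult_2_right)

lemma vec_minus_bit [simp]: "x - y = x + (y :: bit ^ 'm)"
  by (simp add: vec_eq_iff)

lemma vec_add_eq_0_iff: "x + y = 0 \<longleftrightarrow> x = (y :: bit ^ 'm)"
  by (metis vec_add_self_left vec_add_self add_0_right)

lemma vec_scale_bit: "c *s x = (if c = 0 then 0 else (x :: bit ^ 'm))"
  by (cases c) auto

lemma subspace_bit_iff:
  "vec.subspace (S :: (bit ^ 'm) set) \<longleftrightarrow> 0 \<in> S \<and> (\<forall>x\<in>S. \<forall>y\<in>S. x + y \<in> S)"
  by (auto simp: vec.subspace_def vec_scale_bit)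

lemma linear_scalar_bit_iff:
  "Vector_Spaces.linear (*s) (*) (f :: bit ^ 'm \<Rightarrow> bit) \<longleftrightarrow> (\<forall>x y. f (x + y) = f x + f y)"
proof
  assume f: "\<forall>x y. f (x + y) = f x + f y"
  then have "f (0 + 0) = f 0 + f 0"
    by blast
  then have "f 0 = 0"
    by simp
  with f show "Vector_Spaces.linear (*s) (*) f"
    by unfold_locales (auto simp: vec_scale_bit algebra_simps)
qed (simp add: Vector_Spaces.linear_iff)

lemma linear_vec_bit_iff:
  "Vector_Spaces.linear (*s) (*s) (f :: bit ^ 'm \<Rightarrow> bit ^ 'm) \<longleftrightarrow> (\<forall>x y. f (x + y) = f x + f y)"
proof
  assume f: "\<forall>x y. f (x + y) = f x + f y"
  then have "f (0 + 0) = f 0 + f 0"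
    by blast
  then have "f 0 = 0"
    by simp
  with f show "Vector_Spaces.linear (*s) (*s) f"
    by unfold_locales (auto simp: vec_scale_bit vec.scale_right_distrib vec.scale_left_distrib)
qed (simp add: Vector_Spaces.linear_iff)

lemma card_span_bit:
  assumes "finite S" "vec.independent (S :: (bit ^ 'm) set)"
  shows "card (vec.span S) = 2 ^ card S"
  using assms
proof (induction S rule: finite_induct)
  case empty
  then show ?case by simp
next
  case (insert b S)
  then have ind: "vec.independent S" and b: "b \<notin> vec.span S"
    by (auto simp: vec.independent_insert)
  have eq: "vec.span (insert b S) = vec.span S \<union> (+) b ` vec.span S"
  proof (intro equalityI subsetI)
    fix x assume "x \<in> vec.span (insert b S)"
    then obtain k where "x - k *s b \<in> vec.span S"
      by (auto simp: vec.span_insert)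
    then show "x \<in> vec.span S \<union> (+) b ` vec.span S"
      by (cases k) (force simp: image_iff add.commute)+
  next
    fix x assume "x \<in> vec.span S \<union> (+) b ` vec.span S"
    then show "x \<in> vec.span (insert b S)"
      using vec.span_mono[of S "insert b S"]
      by (auto intro!: vec.span_add[OF vec.span_base])
  qed
  have "vec.span S \<inter> (+) b ` vec.span S = {}"
  proof -
    have False if "b + x \<in> vec.span S" "x \<in> vec.span S" for x
    proof -
      have "(b + x) + x \<in> vec.span S"
        by (rule vec.span_add[OF that])
      with b show False by (simp add: add.assoc)
    qed
    then show ?thesis by auto
  qed
  then have "card (vec.span (insert b S)) = card (vec.span S) + card ((+) b ` vec.span S)"
    unfolding eq by (intro card_Un_disjoint) auto
  also have "card ((+) b ` vec.span S) = card (vec.span S)"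
    by (intro card_image) auto
  finally show ?case
    using insert.IH[OF ind] insert.hyps by simp
qed

lemma card_subspace_bit:
  assumes "vec.subspace (S :: (bit ^ 'm) set)"
  shows "card S = 2 ^ vec.dim S"
proof -
  obtain C where "C \<subseteq> S" "vec.independent C" "S \<subseteq> vec.span C" "card C = vec.dim S"
    using vec.basis_exists by blast
  moreover from this have "vec.span C = S"
    using assms by (metis vec.span_minimal subset_antisym)
  ultimately show ?thesis
    using card_span_bit[of C] by auto
qed

lemma dim_eq_iff_card_bit:
  assumes "vec.subspace (S :: (bit ^ 'm) set)"
  shows "vec.dim S = d \<longleftrightarrow> card S = 2 ^ d"
  using card_subspace_bit[OF assms] by simp

text \<open>The nontrivial additive character of the field, with integer values, so that counting
  becomes summation.\<close>

definition chi :: "bit \<Rightarrow> int" where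
  "chi b = (if b = 0 then 1 else -1)"

lemma chi_simps [simp]: "chi 0 = 1" "chi 1 = -1"
  by (auto simp: chi_def)

lemma chi_add: "chi (a + b) = chi a * chi b"
  by (cases a; cases b) auto

text \<open>Orthogonality of characters: if \<open>f s = 1\<close> for some \<open>s\<close> in
  \<open>S\<close>, the shift by \<open>s\<close> permutes \<open>S\<close> and negates every
  term.\<close>

lemma sum_chi_additive:
  assumes S: "vec.subspace (S :: (bit ^ 'm) set)"
    and f: "\<And>x y. x \<in> S \<Longrightarrow> y \<in> S \<Longrightarrow> f (x + y) = f x + f y"
  shows "(\<Sum>x\<in>S. chi (f x)) = (if \<forall>x\<in>S. f x = 0 then int (card S) else 0)"
proof (cases "\<forall>x\<in>S. f x = 0")
  case False
  then obtain s where s: "s \<in> S" "f s = 1" by auto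
  have "(\<Sum>x\<in>S. chi (f x)) = (\<Sum>x\<in>S. chi (f (s + x)))"
    by (rule sum.reindex_bij_witness[of _ "\<lambda>x. s + x" "\<lambda>x. s + x"])
      (use S s in \<open>auto simp: subspace_bit_iff\<close>)
  also have "\<dots> = (\<Sum>x\<in>S. - chi (f x))"
    by (intro sum.cong) (use s f in \<open>auto simp: chi_add\<close>)
  finally show ?thesis
    using False by (auto simp: sum_negf)
qed simp

text \<open>A group is not the union of two proper subgroups, here the kernels of \<open>f\<close>
  and \<open>g\<close> on \<open>S\<close>: if neither \<open>x\<close> nor \<open>y\<close> works,
  then \<open>x + y\<close> does.\<close>

lemma exists_outside_two_subgroups:
  assumes S: "vec.subspace (S :: (bit ^ 'm) set)"
    and f: "\<And>x y. f (x + y) = f x + (f y :: bit)" and g: "\<And>x y. g (x + y) = g x + (g y :: bit)"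
    and x: "x \<in> S" "f x = 1" and y: "y \<in> S" "g y = 1"
  shows "\<exists>z\<in>S. f z = 1 \<and> g z = 1"
proof -
  have "x + y \<in> S"
    using S x y by (auto simp: subspace_bit_iff)
  then show ?thesis
    using x y f[of x y] g[of x y] by (cases "f y"; cases "g x") auto
qed

lemma subspace_insert_bit:
  assumes T: "vec.subspace (T :: (bit ^ 'm) set)"
  shows "vec.subspace (T \<union> (+) m ` T)"
    and "m \<notin> T \<Longrightarrow> card (T \<union> (+) m ` T) = 2 * card T"
proof -
  have add: "x + y \<in> T" if "x \<in> T" "y \<in> T" for x y
    using T that by (auto simp: subspace_bit_iff)
  show "vec.subspace (T \<union> (+) m ` T)"
    using T unfolding subspace_bit_iff
  proof (intro conjI ballI)
    fix x y assume "x \<in> T \<union> (+) m ` T" "y \<in> T \<union> (+) m ` T"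
    then consider "x \<in> T" "y \<in> T" | t where "x \<in> T" "y = m + t" "t \<in> T"
      | t where "x = m + t" "t \<in> T" "y \<in> T" | t s where "x = m + t" "t \<in> T" "y = m + s" "s \<in> T"
      by auto
    then show "x + y \<in> T \<union> (+) m ` T"
    proof cases
      case 4
      then have "x + y = t + s" by (simp add: algebra_simps)
      with 4 show ?thesis by (simp add: add)
    next
      case (2 t)
      then have "x + y = m + (x + t)" by (simp add: algebra_simps)
      with 2 show ?thesis by (simp add: add)
    next
      case (3 t)
      then have "x + y = m + (t + y)" by (simp add: algebra_simps)
      with 3 show ?thesis by (simp add: add)
    qed (simp add: add)
  qed auto
  show "card (T \<union> (+) m ` T) = 2 * card T" if "m \<notin> T"
  proof -
    have "T \<inter> (+) m ` T = {}"
    proof -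
      have False if "m + x \<in> T" "x \<in> T" for x
        using add[OF that] \<open>m \<notin> T\<close> by (simp add: add.assoc)
      then show ?thesis by auto
    qed
    then have "card (T \<union> (+) m ` T) = card T + card ((+) m ` T)"
      by (intro card_Un_disjoint) auto
    also have "card ((+) m ` T) = card T"
      by (intro card_image) auto
    finally show ?thesis by simp
  qed
qed

section \<open>Automorphisms of Johnson graphs\<close>

text \<open>Cliques lie either in the star of a \<open>(k-1)\<close>-set or among the
  \<open>k\<close>-subsets of a \<open>(k+1)\<close>-set. The second kind has at most
  \<open>k + 1\<close> members and is excluded by size. The centre of the star is the intersection
  of two members.\<close>

lemma johnson_clique_in_star:
  assumes k: "1 \<le> k" and C: "C \<subseteq> johnson_vertices \<V> k" and big: "k + 1 < card C"
    and adj: "\<And>S T. S \<in> C \<Longrightarrow> T \<in> C \<Longrightarrow> S \<noteq> T \<Longrightarrow> johnson_adj k S T"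
  shows "\<exists>T \<in> johnson_vertices \<V> (k - 1). \<forall>S\<in>C. T \<subseteq> S"
proof -
  have fin: "finite S" and cd: "card S = k" and sub: "S \<subseteq> \<V>" if "S \<in> C" for S
    using C that by (auto simp: johnson_vertices_def)
  have int: "card (S \<inter> T) = k - 1" if "S \<in> C" "T \<in> C" "S \<noteq> T" for S T
    using adj[OF that] k by (auto simp: johnson_adj_def)
  have "\<not> card C \<le> Suc 0"
    using big by simp
  then obtain A B where AB: "A \<in> C" "B \<in> C" "A \<noteq> B"
    by (metis big card_le_Suc0_iff_eq card.infinite not_less_zero)
  have cT: "card (A \<inter> B) = k - 1"
    using int AB by blast
  have "\<forall>S\<in>C. A \<inter> B \<subseteq> S"
  proof (rule ccontr)
    assume "\<not> (\<forall>S\<in>C. A \<inter> B \<subseteq> S)"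
    then obtain D x where D: "D \<in> C" and x: "x \<in> A" "x \<in> B" "x \<notin> D"
      by blast
    have ne: "D \<noteq> A" "D \<noteq> B"
      using x by auto
    have k2: "k \<ge> 2"
      using cT x fin[OF AB(1)] by (cases "k \<ge> 2") (auto simp: card_eq_0_iff)
    have DA: "D \<inter> A = A - {x}"
      by (rule card_subset_eq) (use fin AB x int[OF D AB(1) ne(1)] cd in auto)
    have DB: "D \<inter> B = B - {x}"
      by (rule card_subset_eq) (use fin AB x int[OF D AB(2) ne(2)] cd in auto)
    have cU: "card (A \<union> B) = k + 1"
      using card_Un_Int[OF fin[OF AB(1)] fin[OF AB(2)]] cd AB cT k by simp
    have Deq: "A \<union> B - {x} = D"
      by (rule card_subset_eq) (use fin AB D DA DB x cU cd in auto)
    \<comment> \<open>A point \<open>z\<close> of \<open>E\<close> outside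
      \<open>A \<union> B\<close> is also outside \<open>D\<close>, so \<open>E - {z}\<close> lies
      in \<open>A\<close>, \<open>B\<close> and \<open>D\<close>, hence in
      \<open>A \<inter> B - {x}\<close>, which has only \<open>k - 2\<close> points.\<close>
    have "E \<subseteq> A \<union> B" if E: "E \<in> C" for E
    proof (rule ccontr)
      assume "\<not> E \<subseteq> A \<union> B"
      then obtain z where z: "z \<in> E" "z \<notin> A" "z \<notin> B" by auto
      have zD: "z \<notin> D" using z Deq by auto
      have neE: "E \<noteq> A" "E \<noteq> B" "E \<noteq> D" using z zD by auto
      have eqE: "E \<inter> S = E - {z}" if "S \<in> C" "z \<notin> S" "E \<noteq> S" for S
        by (rule card_subset_eq) (use fin that E z cd int[of E S] in auto)
      have "E \<inter> A = E - {z}" "E \<inter> B = E - {z}" "E \<inter> D = E - {z}"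
        using eqE AB D z zD neE by auto
      then have "E - {z} \<subseteq> A \<inter> B - {x}"
        using x by blast
      then have "card (E - {z}) \<le> card (A \<inter> B - {x})"
        using fin AB by (intro card_mono) auto
      then show False
        using x cT z cd[OF E] fin[OF E] fin[OF AB(1)] k2 by simp
    qed
    then have "C \<subseteq> {S. S \<subseteq> A \<union> B \<and> card S = k}"
      using cd by auto
    then have "card C \<le> card {S. S \<subseteq> A \<union> B \<and> card S = k}"
      using fin AB by (intro card_mono) auto
    also have "\<dots> = k + 1"
      using n_subsets[of "A \<union> B" k] fin AB cU by (simp add: choose_one binomial_symmetric[of k "k+1"])
    finally show False
      using big by simp
  qed
  then show ?thesis
    using cT fin AB sub by (intro bexI[of _ "A \<inter> B"]) (auto simp: johnson_vertices_def)
qed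

lemma johnson_vertices_star:
  assumes V: "finite \<V>" and T: "T \<in> johnson_vertices \<V> k"
  shows "{S \<in> johnson_vertices \<V> (Suc k). T \<subseteq> S} = (\<lambda>x. insert x T) ` (\<V> - T)"
    and "card {S \<in> johnson_vertices \<V> (Suc k). T \<subseteq> S} = card \<V> - k"
proof -
  have T': "T \<subseteq> \<V>" "finite T" "card T = k"
    using T by (auto simp: johnson_vertices_def)
  show eq: "{S \<in> johnson_vertices \<V> (Suc k). T \<subseteq> S} = (\<lambda>x. insert x T) ` (\<V> - T)"
  proof (intro equalityI subsetI)
    fix S assume "S \<in> {S \<in> johnson_vertices \<V> (Suc k). T \<subseteq> S}"
    then have S: "S \<subseteq> \<V>" "finite S" "card S = Suc k" "T \<subseteq> S"
      by (auto simp: johnson_vertices_def)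
    then have "card (S - T) = 1"
      using T' by (simp add: card_Diff_subset)
    then obtain x where "S - T = {x}"
      by (auto simp: card_1_singleton_iff)
    then show "S \<in> (\<lambda>x. insert x T) ` (\<V> - T)"
      using S by (intro image_eqI[of _ _ x]) auto
  next
    fix S assume "S \<in> (\<lambda>x. insert x T) ` (\<V> - T)"
    then show "S \<in> {S \<in> johnson_vertices \<V> (Suc k). T \<subseteq> S}"
      using T' by (auto simp: johnson_vertices_def)
  qed
  have "inj_on (\<lambda>x. insert x T) (\<V> - T)"
    by (auto simp: inj_on_def)
  then show "card {S \<in> johnson_vertices \<V> (Suc k). T \<subseteq> S} = card \<V> - k"
    unfolding eq using T' V by (simp add: card_image card_Diff_subset)
qed

lemma finite_johnson_vertices: "finite \<V> \<Longrightarrow> finite (johnson_vertices \<V> k)"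
  by (rule finite_subset[of _ "Pow \<V>"]) (auto simp: johnson_vertices_def)

text \<open>The size bound leaves room to enlarge \<open>T\<close> by a point other than a given
  \<open>x\<close>; for \<open>x\<close> in \<open>T'\<close> but not in \<open>T\<close> this
  separates the stars.\<close>

lemma johnson_star_inject:
  assumes V: "finite \<V>" and k: "Suc k < card \<V>"
    and T: "T \<in> johnson_vertices \<V> k" "T' \<in> johnson_vertices \<V> k"
    and eq: "{S \<in> johnson_vertices \<V> (Suc k). T \<subseteq> S} = {S \<in> johnson_vertices \<V> (Suc k). T' \<subseteq> S}"
  shows "T = T'"
proof (rule ccontr)
  assume "T \<noteq> T'"
  have T1: "T \<subseteq> \<V>" "finite T" "card T = k" "T' \<subseteq> \<V>" "finite T'" "card T' = k"
    using T by (auto simp: johnson_vertices_def)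
  then have "\<not> T' \<subseteq> T"
    using \<open>T \<noteq> T'\<close> card_subset_eq[of T T'] by auto
  then obtain x where x: "x \<in> T'" "x \<notin> T" by auto
  have "card (insert x T) < card \<V>"
    using T1 x k by simp
  then have "\<not> \<V> \<subseteq> insert x T"
    using T1 by (meson card_mono finite.insertI leD)
  then obtain y where y: "y \<in> \<V>" "y \<noteq> x" "y \<notin> T" by auto
  then have "insert y T \<in> {S \<in> johnson_vertices \<V> (Suc k). T \<subseteq> S}"
    using T1 by (auto simp: johnson_vertices_def)
  then show False
    unfolding eq using x y by auto
qed

text \<open>Rephrases adjacency as two stars having a common member, a property that a map of stars
  carries over. Equal sets are excluded because a vertex is not adjacent to itself.\<close>

lemma johnson_adj_iff_common_superset:
  assumes V: "finite \<V>" and T: "T \<in> johnson_vertices \<V> k" "T' \<in> johnson_vertices \<V> k" "T \<noteq> T'"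
  shows "johnson_adj k T T' \<longleftrightarrow> (\<exists>S \<in> johnson_vertices \<V> (Suc k). T \<subseteq> S \<and> T' \<subseteq> S)"
proof -
  have T1: "T \<subseteq> \<V>" "finite T" "card T = k" "T' \<subseteq> \<V>" "finite T'" "card T' = k"
    using T by (auto simp: johnson_vertices_def)
  have ci: "card (T \<union> T') + card (T \<inter> T') = 2 * k"
    using card_Un_Int[of T T'] T1 by simp
  have lt: "card (T \<inter> T') < k"
  proof (rule ccontr)
    assume "\<not> ?thesis"
    then have "T \<inter> T' = T" "T \<inter> T' = T'"
      using T1 by (auto intro!: card_subset_eq simp: card_seteq)
    with T(3) show False by simp
  qed
  show ?thesis
  proof
    assume "johnson_adj k T T'"
    then have "card (T \<union> T') = Suc k"
      using ci by (simp add: johnson_adj_def)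
    then show "\<exists>S \<in> johnson_vertices \<V> (Suc k). T \<subseteq> S \<and> T' \<subseteq> S"
      using T1 by (intro bexI[of _ "T \<union> T'"]) (auto simp: johnson_vertices_def)
  next
    assume "\<exists>S \<in> johnson_vertices \<V> (Suc k). T \<subseteq> S \<and> T' \<subseteq> S"
    then obtain S where S: "finite S" "card S = Suc k" "T \<union> T' \<subseteq> S"
      by (auto simp: johnson_vertices_def)
    then have "card (T \<union> T') \<le> Suc k"
      by (metis card_mono)
    then show "johnson_adj k T T'"
      using ci lt by (simp add: johnson_adj_def)
  qed
qed

text \<open>For \<open>2 k < |\<V>|\<close> the cliques of maximal size are the stars of the \<open>(k-1)\<close>-subsets, so an
  automorphism of the graph on \<open>k\<close>-subsets induces one on \<open>(k-1)\<close>-subsets.\<close>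

lemma johnson_aut_induced_small:
  assumes V: "finite \<V>" and "1 \<le> k" and "2 * k < card \<V>" and "f \<in> johnson_aut \<V> k"
  shows "\<exists>\<sigma>. bij_betw \<sigma> \<V> \<V> \<and> (\<forall>S \<in> johnson_vertices \<V> k. f S = \<sigma> ` S)"
  using assms(2-4)
proof (induction k arbitrary: f rule: nat_induct_at_least)
  case base
  have v1: "johnson_vertices \<V> 1 = (\<lambda>x. {x}) ` \<V>"
    using V by (auto simp: johnson_vertices_def card_1_singleton_iff)
  have bij: "bij_betw f (johnson_vertices \<V> 1) (johnson_vertices \<V> 1)"
    using base by (auto simp: johnson_aut_def Bij_def)
  define \<sigma> where "\<sigma> x = the_elem (f {x})" for x
  have \<sigma>: "f {x} = {\<sigma> x}" "\<sigma> x \<in> \<V>" if "x \<in> \<V>" for x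
  proof -
    have "f {x} \<in> (\<lambda>x. {x}) ` \<V>"
      using bij that unfolding v1 by (auto simp: bij_betw_def)
    then obtain y where "y \<in> \<V>" "f {x} = {y}" by blast
    then show "f {x} = {\<sigma> x}" "\<sigma> x \<in> \<V>"
      by (auto simp: \<sigma>_def)
  qed
  have "inj_on \<sigma> \<V>"
  proof
    fix x y assume xy: "x \<in> \<V>" "y \<in> \<V>" "\<sigma> x = \<sigma> y"
    then have "f {x} = f {y}" using \<sigma> by simp
    then have "{x} = {y}"
      using bij xy unfolding v1 bij_betw_def inj_on_def by blast
    then show "x = y" by simp
  qed
  then have "bij_betw \<sigma> \<V> \<V>"
    using \<sigma> V by (simp add: bij_betw_def endo_inj_surj image_subsetI)
  moreover have "\<forall>S \<in> johnson_vertices \<V> 1. f S = \<sigma> ` S"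
    unfolding v1 using \<sigma> by auto
  ultimately show ?case by blast
next
  case (Suc k)
  let ?J = "johnson_vertices \<V>"
  define star where "star T = {S \<in> ?J (Suc k). T \<subseteq> S}" for T
  have bij: "bij_betw f (?J (Suc k)) (?J (Suc k))"
    and adj: "\<And>S T. S \<in> ?J (Suc k) \<Longrightarrow> T \<in> ?J (Suc k) \<Longrightarrow>
      johnson_adj (Suc k) (f S) (f T) \<longleftrightarrow> johnson_adj (Suc k) S T"
    using Suc.prems by (auto simp: johnson_aut_def Bij_def)
  have inj: "inj_on f (?J (Suc k))"
    using bij by (simp add: bij_betw_def)
  have fJ: "f S \<in> ?J (Suc k)" if "S \<in> ?J (Suc k)" for S
    using bij that by (auto simp: bij_betw_def)
  have star_sub: "star T \<subseteq> ?J (Suc k)" for T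
    by (auto simp: star_def)
  have fin_star: "finite (star T)" for T
    using star_sub finite_johnson_vertices[OF V] by (rule finite_subset)
  have card_star: "card (star T) = card \<V> - k" if "T \<in> ?J k" for T
    using johnson_vertices_star(2)[OF V that] by (simp add: star_def)
  have star_inj: "T = T'" if "T \<in> ?J k" "T' \<in> ?J k" "star T = star T'" for T T'
    using johnson_star_inject[OF V _ that(1,2)] that(3) Suc.prems by (simp add: star_def)
  have star_adj: "johnson_adj (Suc k) S S'" if "S \<in> star T" "S' \<in> star T" "S \<noteq> S'" "T \<in> ?J k" for S S' T
  proof -
    have *: "S \<in> ?J (Suc k)" "S' \<in> ?J (Suc k)" "T \<subseteq> S \<inter> S'"
      using that by (auto simp: star_def)
    then have f: "finite S" "finite S'" "card S = Suc k" "card S' = Suc k"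
      by (auto simp: johnson_vertices_def)
    have "card T = k"
      using that by (simp add: johnson_vertices_def)
    then have "k \<le> card (S \<inter> S')"
      using * f by (metis card_mono finite_Int)
    moreover have "card (S \<inter> S') < Suc k"
    proof (rule ccontr)
      assume "\<not> ?thesis"
      then have "S \<inter> S' = S" "S \<inter> S' = S'"
        using f by (auto intro!: card_subset_eq simp: card_seteq)
      with that(3) show False by simp
    qed
    ultimately show ?thesis by (simp add: johnson_adj_def)
  qed
  have "\<exists>T'\<in>?J k. f ` star T = star T'" if T: "T \<in> ?J k" for T
  proof -
    have c: "card (f ` star T) = card \<V> - k"
      using card_star[OF T] inj star_sub by (metis card_image inj_on_subset)
    have "\<exists>T'\<in>?J (Suc k - 1). \<forall>S\<in>f ` star T. T' \<subseteq> S"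
    proof (rule johnson_clique_in_star)
      show "f ` star T \<subseteq> ?J (Suc k)"
        using fJ star_sub by blast
      \<comment> \<open>The star has \<open>card \<V> - k\<close> members, so this is
        \<open>2 * Suc k < card \<V>\<close> rearranged.\<close>
      show "Suc k + 1 < card (f ` star T)"
        using c Suc.prems by simp
      fix S S' assume "S \<in> f ` star T" "S' \<in> f ` star T" "S \<noteq> S'"
      then obtain R R' where R: "R \<in> star T" "R' \<in> star T" "S = f R" "S' = f R'" "R \<noteq> R'"
        by blast
      then show "johnson_adj (Suc k) S S'"
        using adj[of R R'] star_adj[OF R(1,2,5) T] star_sub by blast
    qed simp
    then obtain T' where T': "T' \<in> ?J k" "\<forall>S\<in>f ` star T. T' \<subseteq> S" by auto
    then have "f ` star T \<subseteq> star T'"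
      using fJ star_sub by (auto simp: star_def)
    then have "f ` star T = star T'"
      using c card_star[OF T'(1)] fin_star by (simp add: card_subset_eq)
    with T' show ?thesis by blast
  qed
  then obtain h where h: "\<And>T. T \<in> ?J k \<Longrightarrow> h T \<in> ?J k \<and> f ` star T = star (h T)"
    by metis
  have inj_h: "inj_on h (?J k)"
  proof
    fix T T' assume T: "T \<in> ?J k" "T' \<in> ?J k" "h T = h T'"
    then have "f ` star T = f ` star T'" using h by simp
    then have "star T = star T'"
      using inj star_sub by (simp add: inj_on_image_eq_iff)
    then show "T = T'" using star_inj T by blast
  qed
  then have bij_h: "bij_betw h (?J k) (?J k)"
    using h finite_johnson_vertices[OF V] by (simp add: bij_betw_def endo_inj_surj image_subsetI)
  have "restrict h (?J k) \<in> johnson_aut \<V> k"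
    unfolding johnson_aut_def
  proof (intro CollectI conjI ballI)
    show "restrict h (?J k) \<in> Bij (?J k)"
      using bij_h by (auto simp: Bij_def cong: bij_betw_cong)
    fix T T' assume T: "T \<in> ?J k" "T' \<in> ?J k"
    show "johnson_adj k (restrict h (?J k) T) (restrict h (?J k) T') \<longleftrightarrow> johnson_adj k T T'"
    proof (cases "T = T'")
      case True
      have "card T = k" "card (h T) = k"
        using T h by (auto simp: johnson_vertices_def)
      with True T show ?thesis by (simp add: johnson_adj_def)
    next
      case False
      have ne: "h T \<noteq> h T'"
        using False T inj_h by (auto dest: inj_onD)
      have "star T \<inter> star T' \<noteq> {} \<longleftrightarrow> f ` (star T \<inter> star T') \<noteq> {}" by simp
      also have "f ` (star T \<inter> star T') = f ` star T \<inter> f ` star T'"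
        using inj star_sub by (simp add: inj_on_image_Int)
      also have "\<dots> = star (h T) \<inter> star (h T')"
        using h T by simp
      finally show ?thesis
        using johnson_adj_iff_common_superset[OF V T False] h T
          johnson_adj_iff_common_superset[OF V _ _ ne] by (auto simp: star_def)
    qed
  qed
  then obtain \<sigma> where \<sigma>: "bij_betw \<sigma> \<V> \<V>" "\<forall>T\<in>?J k. restrict h (?J k) T = \<sigma> ` T"
    using Suc.IH[of "restrict h (?J k)"] \<open>2 * Suc k < card \<V>\<close> by (meson Suc_leD less_le_trans mult_le_mono2 lessI order.strict_implies_order le_less_trans)
  have "f S = \<sigma> ` S" if S: "S \<in> ?J (Suc k)" for S
  proof -
    have S1: "S \<subseteq> \<V>" "finite S" "card S = Suc k"
      using S by (auto simp: johnson_vertices_def)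
    \<comment> \<open>Since \<open>S\<close> has a second point \<open>y\<close>, \<open>x\<close>
      lies in \<open>T = S - {y}\<close>, and \<open>f S\<close> contains \<open>h T\<close>, which
      is the image of \<open>T\<close> under \<open>\<sigma>\<close>. Equality of \<open>f S\<close>
      with the image of \<open>S\<close> then follows by size.\<close>
    have "\<sigma> x \<in> f S" if x: "x \<in> S" for x
    proof -
      have "card (S - {x}) \<noteq> 0"
        using S1 x Suc.hyps by simp
      then have "S - {x} \<noteq> {}"
        by (metis card.empty)
      then obtain y where y: "y \<in> S" "y \<noteq> x"
        by auto
      define T where "T = S - {y}"
      have T: "T \<in> ?J k" "S \<in> star T" "x \<in> T"
        using S S1 y x by (auto simp: T_def johnson_vertices_def star_def)
      then have "f S \<in> star (h T)"
        using h by blast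
      then show "\<sigma> x \<in> f S"
        using \<sigma>(2) T by (auto simp: star_def)
    qed
    moreover have "card (\<sigma> ` S) = Suc k"
      using \<sigma>(1) S1 by (metis bij_betw_def card_image inj_on_subset)
    moreover have "finite (f S)" "card (f S) = Suc k"
      using fJ[OF S] by (auto simp: johnson_vertices_def)
    ultimately show ?thesis
      by (metis card_subset_eq image_subsetI)
  qed
  with \<sigma>(1) show ?case by blast
qed

text \<open>Complementation carries the graph on \<open>k\<close>-subsets to the one on
  \<open>(card \<V> - k)\<close>-subsets and so reduces to the small case. When
  \<open>2 * k = card \<V>\<close>, complementation is itself an automorphism, and for
  \<open>k \<ge> 2\<close> no permutation of points induces it.\<close>

lemma johnson_aut_induced:
  assumes V: "finite \<V>" and k: "1 \<le> k" "k < card \<V>" "2 * k \<noteq> card \<V>"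
    and f: "f \<in> johnson_aut \<V> k"
  shows "\<exists>\<sigma>. bij_betw \<sigma> \<V> \<V> \<and> (\<forall>S \<in> johnson_vertices \<V> k. f S = \<sigma> ` S)"
proof (cases "2 * k < card \<V>")
  case True
  then show ?thesis using johnson_aut_induced_small assms by blast
next
  case False
  let ?J = "johnson_vertices \<V>"
  define l where "l = card \<V> - k"
  have l: "1 \<le> l" "2 * l < card \<V>" "k = card \<V> - l"
    using k False by (auto simp: l_def)
  have compl: "\<V> - S \<in> ?J l" "\<V> - (\<V> - S) = S" if "S \<in> ?J k" for S
    using that V k by (auto simp: johnson_vertices_def l_def card_Diff_subset)
  have compl': "\<V> - S \<in> ?J k" "\<V> - (\<V> - S) = S" if "S \<in> ?J l" for S
    using that V l by (auto simp: johnson_vertices_def card_Diff_subset)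
  have bij: "bij_betw f (?J k) (?J k)"
    and adj: "\<And>S T. S \<in> ?J k \<Longrightarrow> T \<in> ?J k \<Longrightarrow> johnson_adj k (f S) (f T) \<longleftrightarrow> johnson_adj k S T"
    using f by (auto simp: johnson_aut_def Bij_def)
  have fJ: "f S \<in> ?J k" if "S \<in> ?J k" for S
    using bij that by (auto simp: bij_betw_def)
  have adjc: "johnson_adj l (\<V> - S) (\<V> - T) \<longleftrightarrow> johnson_adj k S T" if "S \<in> ?J k" "T \<in> ?J k" for S T
  proof -
    have *: "S \<subseteq> \<V>" "T \<subseteq> \<V>" "finite S" "finite T" "card S = k" "card T = k"
      using that by (auto simp: johnson_vertices_def)
    have "card (S \<union> T) + card (S \<inter> T) = 2 * k"
      using * card_Un_Int[of S T] by simp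
    moreover have "(\<V> - S) \<inter> (\<V> - T) = \<V> - (S \<union> T)" by auto
    moreover have "card (\<V> - (S \<union> T)) = card \<V> - card (S \<union> T)" "card (S \<union> T) \<le> card \<V>"
      using * V by (auto intro!: card_Diff_subset card_mono)
    ultimately show ?thesis
      using k by (simp add: johnson_adj_def l_def) linarith
  qed
  define f' where "f' = (\<lambda>S\<in>?J l. \<V> - f (\<V> - S))"
  have f'J: "f' S \<in> ?J l" if "S \<in> ?J l" for S
    using that compl compl' fJ by (auto simp: f'_def)
  have "inj_on f' (?J l)"
  proof
    fix S T assume ST: "S \<in> ?J l" "T \<in> ?J l" "f' S = f' T"
    then have "f (\<V> - S) = f (\<V> - T)"
      using compl(2)[OF fJ[OF compl'(1)]] by (metis f'_def restrict_apply')
    then have "\<V> - S = \<V> - T"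
      using bij compl' ST by (metis bij_betw_def inj_onD)
    then show "S = T" using compl' ST by metis
  qed
  then have "bij_betw f' (?J l) (?J l)"
    using f'J finite_johnson_vertices[OF V] by (simp add: bij_betw_def endo_inj_surj image_subsetI)
  moreover have "johnson_adj l (f' S) (f' T) \<longleftrightarrow> johnson_adj l S T"
    if "S \<in> ?J l" "T \<in> ?J l" for S T
  proof -
    have "johnson_adj l (f' S) (f' T) \<longleftrightarrow> johnson_adj k (f (\<V> - S)) (f (\<V> - T))"
      using that adjc fJ compl' by (simp add: f'_def)
    also have "\<dots> \<longleftrightarrow> johnson_adj k (\<V> - S) (\<V> - T)"
      using adj compl' that by blast
    also have "\<dots> \<longleftrightarrow> johnson_adj l S T"
      using adjc[of "\<V> - S" "\<V> - T"] compl' that by simp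
    finally show ?thesis .
  qed
  ultimately have "f' \<in> johnson_aut \<V> l"
    by (auto simp: johnson_aut_def Bij_def f'_def)
  then obtain \<sigma> where \<sigma>: "bij_betw \<sigma> \<V> \<V>" "\<forall>S\<in>?J l. f' S = \<sigma> ` S"
    using johnson_aut_induced_small[OF V l(1,2)] by blast
  have "f S = \<sigma> ` S" if S: "S \<in> ?J k" for S
  proof -
    have "\<V> - f S = \<sigma> ` (\<V> - S)"
      using \<sigma>(2) compl[OF S] by (metis f'_def restrict_apply')
    also have "\<dots> = \<V> - \<sigma> ` S"
      using \<sigma>(1) S by (simp add: bij_betw_def inj_on_image_set_diff[of \<sigma> \<V>] johnson_vertices_def)
    finally have "\<V> - (\<V> - f S) = \<V> - (\<V> - \<sigma> ` S)" by simp
    moreover have "\<sigma> ` S \<subseteq> \<V>"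
      using \<sigma>(1) S by (auto simp: bij_betw_def johnson_vertices_def)
    ultimately show ?thesis
      using compl(2)[OF fJ[OF S]] by (simp add: double_diff)
  qed
  with \<sigma>(1) show ?thesis by blast
qed

section \<open>Symplectic spaces and Gauss sums\<close>

locale sp_space =
  fixes B :: "bit ^ 'm \<Rightarrow> bit ^ 'm \<Rightarrow> bit" and n :: nat
  assumes card_m: "CARD('m) = 2 * n" and symplectic: "symplectic_form B"
begin

lemma B_add_left: "B (x + y) z = B x z + B y z"
  and B_add_right: "B z (x + y) = B z x + B z y"
  and B_self [simp]: "B x x = 0"
  and nondegenerate: "(\<And>y. B x y = 0) \<Longrightarrow> x = 0"
  using symplectic by (auto simp: symplectic_form_def linear_scalar_bit_iff)

lemma B_commute: "B x y = B y x"
proof -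
  have "B x y + B y x = 0"
    using B_self[of "x + y"] B_self[of x] B_self[of y] unfolding B_add_left B_add_right
    by (metis add_0_left add_0_right add.commute)
  then show ?thesis
    by (simp only: bit_add_eq_0_iff)
qed

lemma B_0 [simp]: "B 0 x = 0" "B x 0 = 0"
  using B_add_left[of 0 0 x] B_add_right[of x 0 0] by simp_all

lemma card_space: "card (UNIV :: (bit ^ 'm) set) = 2 ^ (2 * n)"
  using card_m by (simp add: CARD_bit)

section \<open>Orthogonal complements\<close>

definition perp :: "(bit ^ 'm) set \<Rightarrow> (bit ^ 'm) set" where
  "perp T = {y. \<forall>t\<in>T. B t y = 0}"

lemma perpD: "y \<in> perp T \<Longrightarrow> t \<in> T \<Longrightarrow> B t y = 0" "y \<in> perp T \<Longrightarrow> t \<in> T \<Longrightarrow> B y t = 0"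
  using B_commute[of y t] by (auto simp: perp_def)

lemma subspace_perp: "vec.subspace (perp T)"
  by (auto simp: perp_def subspace_bit_iff B_add_right)

lemma sum_chi_B:
  assumes "vec.subspace T"
  shows "(\<Sum>t\<in>T. chi (B t m)) = (if m \<in> perp T then int (card T) else 0)"
  using sum_chi_additive[OF assms, of "\<lambda>t. B t m"] by (simp add: B_add_left perp_def)

text \<open>Both sides evaluate the double sum of \<open>chi (B t m)\<close> over \<open>T\<close>
  and \<open>M\<close>, summing over \<open>T\<close> first or over \<open>M\<close> first. The case
  \<open>M = UNIV\<close> gives the size of \<open>perp T\<close>.\<close>

lemma card_Int_perp:
  assumes "vec.subspace T" "vec.subspace M"
  shows "card T * card (M \<inter> perp T) = card M * card (T \<inter> perp M)"
proof -
  have "(\<Sum>m\<in>M. \<Sum>t\<in>T. chi (B t m)) = int (card T * card (M \<inter> perp T))"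
    if "vec.subspace T" for T M
  proof -
    have "(\<Sum>m\<in>M. \<Sum>t\<in>T. chi (B t m)) = (\<Sum>m\<in>M. if m \<in> perp T then int (card T) else 0)"
      using sum_chi_B[OF that] by simp
    also have "\<dots> = (\<Sum>m\<in>M \<inter> perp T. int (card T))"
      by (rule sum.inter_restrict[symmetric]) simp
    finally show ?thesis by simp
  qed
  from this[OF assms(1), of M] this[OF assms(2), of T]
  have "int (card T * card (M \<inter> perp T)) = int (card M * card (T \<inter> perp M))"
    using sum.swap[of "\<lambda>m t. chi (B t m)" T M] by (simp add: B_commute)
  then show ?thesis
    by (simp only: of_nat_eq_iff)
qed

lemma perp_UNIV: "perp UNIV = {0}"
proof -
  have "y = 0" if "\<And>t. B t y = 0" for y
    using that by (intro nondegenerate) (metis B_commute)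
  then show ?thesis
    by (auto simp: perp_def)
qed

lemma card_perp:
  assumes "vec.subspace T"
  shows "card T * card (perp T) = 2 ^ (2 * n)"
proof -
  have "T \<inter> {0} = {0}"
    using assms by (auto simp: subspace_bit_iff)
  then show ?thesis
    using card_Int_perp[OF assms vec.subspace_UNIV] card_space by (simp add: perp_UNIV)
qed

lemma perp_perp:
  assumes T: "vec.subspace T"
  shows "perp (perp T) = T"
proof -
  have "T \<subseteq> perp (perp T)"
    by (auto simp: perp_def B_commute)
  moreover have "card (perp T) * card (perp (perp T)) = card (perp T) * card T"
    using card_perp[OF T] card_perp[OF subspace_perp[of T]] by (simp add: mult.commute)
  then have "card (perp (perp T)) = card T"
    using subspace_perp[of T] by (auto simp: subspace_bit_iff card_eq_0_iff)
  ultimately show ?thesis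
    by (metis card_subset_eq finite)
qed

lemma exists_perp:
  assumes "vec.subspace T" "c \<notin> T"
  shows "\<exists>y\<in>perp T. B c y = 1"
proof (rule ccontr)
  assume "\<not> ?thesis"
  then have "B y c = 0" if "y \<in> perp T" for y
    using that by (metis B_commute bit_not_one_iff)
  then have "c \<in> perp (perp T)"
    by (simp add: perp_def[of "perp T"])
  then show False
    using assms by (simp add: perp_perp)
qed

lemma exists_perp2:
  assumes "vec.subspace T" "c \<notin> T" "w \<notin> T"
  shows "\<exists>y\<in>perp T. B c y = 1 \<and> B w y = 1"
proof -
  obtain x y where "x \<in> perp T" "B c x = 1" "y \<in> perp T" "B w y = 1"
    using exists_perp assms by meson
  then show ?thesis
    using exists_outside_two_subgroups[OF subspace_perp, of "B c" "B w"] by (auto simp: B_add_right)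
qed

text \<open>The kernel of \<open>f\<close> has index at most two in \<open>S\<close>. A vector
  orthogonal to the kernel but not to a chosen \<open>s\<close> outside it agrees with
  \<open>f\<close> on both, hence on \<open>S\<close>.\<close>

lemma functional_represented:
  assumes S: "vec.subspace S" and f: "\<And>x y. x \<in> S \<Longrightarrow> y \<in> S \<Longrightarrow> f (x + y) = f x + (f y :: bit)"
  shows "\<exists>a. \<forall>x\<in>S. f x = B a x"
proof (cases "\<forall>x\<in>S. f x = 0")
  case True
  then show ?thesis by (intro exI[of _ 0]) simp
next
  case False
  then obtain s where s: "s \<in> S" "f s = 1" by auto
  define K where "K = {x\<in>S. f x = 0}"
  have K: "vec.subspace K" "s \<notin> K"
    using S s f f[of 0 0] by (auto simp: K_def subspace_bit_iff)
  then obtain a where a: "a \<in> perp K" "B s a = 1"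
    using exists_perp by blast
  have "f x = B a x" if x: "x \<in> S" for x
  proof (cases "f x = 0")
    case True
    then show ?thesis using x a perpD(2)[OF a(1)] by (simp add: K_def)
  next
    case False
    then have "x + s \<in> K"
      using x s f S by (auto simp: K_def subspace_bit_iff)
    then have "B a (x + s) = 0"
      using perpD(2)[OF a(1)] by blast
    then show ?thesis
      using False a(2) by (simp add: B_add_right B_commute[of a s] bit_add_eq_0_iff)
  qed
  then show ?thesis by blast
qed

section \<open>Quadratic forms and their Gauss sums\<close>

definition gauss_sum :: "(bit ^ 'm \<Rightarrow> bit) \<Rightarrow> int" where
  "gauss_sum \<phi> = (\<Sum>x\<in>UNIV. chi (\<phi> x))"

abbreviation qf :: "(bit ^ 'm \<Rightarrow> bit) \<Rightarrow> bool" where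
  "qf \<equiv> quadratic_form_of B"

definition translate :: "(bit ^ 'm \<Rightarrow> bit) \<Rightarrow> bit ^ 'm \<Rightarrow> (bit ^ 'm \<Rightarrow> bit)" where
  "translate \<phi> a = (\<lambda>x. \<phi> x + B a x)"

lemma qf_iff: "qf \<phi> \<longleftrightarrow> (\<forall>x y. \<phi> (x + y) = \<phi> x + \<phi> y + B x y)"
proof
  assume \<phi>: "\<forall>x y. \<phi> (x + y) = \<phi> x + \<phi> y + B x y"
  then have "\<phi> (0 + 0) = \<phi> 0 + \<phi> 0 + B 0 0" by blast
  then have "\<phi> 0 = 0" by simp
  moreover have "\<phi> (x + y) + \<phi> x + \<phi> y = B x y" for x y
    using \<phi> by (simp add: algebra_simps)
  ultimately show "qf \<phi>"
    by (auto simp: quadratic_form_of_def vec_scale_bit)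
next
  assume "qf \<phi>"
  then have *: "\<phi> (x + y) + \<phi> x + \<phi> y = B x y" for x y
    by (simp add: quadratic_form_of_def)
  have "\<phi> (x + y) = \<phi> x + \<phi> y + B x y" for x y
    unfolding *[symmetric] by (simp add: algebra_simps)
  then show "\<forall>x y. \<phi> (x + y) = \<phi> x + \<phi> y + B x y" by blast
qed

lemma qf_add: "qf \<phi> \<Longrightarrow> \<phi> (x + y) = \<phi> x + \<phi> y + B x y"
  by (simp add: qf_iff)

lemma qf_0: "qf \<phi> \<Longrightarrow> \<phi> 0 = 0"
  using qf_add[of \<phi> 0 0] by simp

lemma qf_translate: "qf \<phi> \<Longrightarrow> qf (translate \<phi> a)"
  by (simp add: qf_iff translate_def B_add_right algebra_simps)

text \<open>Two forms with the same polarisation differ by an additive function, which nondegeneracy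
  represents as \<open>B a\<close>.\<close>

lemma qf_eq_translate:
  assumes "qf \<phi>" "qf \<psi>"
  shows "\<exists>a. \<psi> = translate \<phi> a"
proof -
  have "\<exists>a. \<forall>x\<in>UNIV. \<phi> x + \<psi> x = B a x"
    using assms by (intro functional_represented) (auto simp: qf_add algebra_simps)
  then obtain a where "\<phi> x + \<psi> x = B a x" for x by blast
  then have "\<psi> x = \<phi> x + B a x" for x
    by (metis bit_add_self_left)
  then show ?thesis by (auto simp: translate_def)
qed

lemma translate_inject: "translate \<phi> a = translate \<phi> b \<longleftrightarrow> a = b"
proof
  assume eq: "translate \<phi> a = translate \<phi> b"
  have "B (a + b) x = 0" for x
    using fun_cong[OF eq, of x] by (simp add: translate_def B_add_left bit_add_eq_0_iff)
  then have "a + b = 0" by (rule nondegenerate)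
  then show "a = b" by (simp add: vec_add_eq_0_iff)
qed simp

lemma translate_translate: "translate (translate \<phi> a) b = translate \<phi> (a + b)"
  by (simp add: translate_def B_add_left algebra_simps)

lemma translate_0 [simp]: "translate \<phi> 0 = \<phi>"
  by (simp add: translate_def)

text \<open>Instead of fixing a basis, take a largest subspace that carries a quadratic refinement
  of \<open>B\<close>; if it were proper, the refinement would extend to one more vector.\<close>

lemma exists_qf: "\<exists>\<phi>. qf \<phi>"
proof -
  define P where "P S \<longleftrightarrow> vec.subspace S \<and>
    (\<exists>\<phi>. \<forall>x\<in>S. \<forall>y\<in>S. \<phi> (x + y) = \<phi> x + \<phi> y + B x y)" for S
  have "P {0}"
    by (auto simp: P_def subspace_bit_iff intro: exI[of _ "\<lambda>_. 0"])
  then obtain S where S: "P S" and max: "\<And>T. P T \<Longrightarrow> card T \<le> card S"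
    using ex_has_greatest_nat[of P "{0}" card "Suc (card (UNIV :: (bit ^ 'm) set))"]
    by (auto simp: less_Suc_eq_le card_mono simp del: CARD_vec)
  then obtain \<phi> where sub: "vec.subspace S"
    and \<phi>: "\<And>x y. x \<in> S \<Longrightarrow> y \<in> S \<Longrightarrow> \<phi> (x + y) = \<phi> x + \<phi> y + B x y"
    by (auto simp: P_def)
  have add: "x + y \<in> S" if "x \<in> S" "y \<in> S" for x y
    using sub that by (auto simp: subspace_bit_iff)
  have "S = UNIV"
  proof (rule ccontr)
    assume "S \<noteq> UNIV"
    then obtain m where m: "m \<notin> S" by auto
    define T where "T = S \<union> (+) m ` S"
    have notin: "m + s \<notin> S" if "s \<in> S" for s
      using add[of "m + s" s] that m by (auto simp: add.assoc)
    \<comment> \<open>For \<open>x = m + s\<close> the second branch is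
      \<open>\<phi> s + B m s\<close>: the extension that takes the value 0 at
      \<open>m\<close>.\<close>
    define \<psi> where "\<psi> x = (if x \<in> S then \<phi> x else \<phi> (m + x) + B m x)" for x
    have \<psi>: "\<psi> s = \<phi> s" "\<psi> (m + s) = \<phi> s + B m s" if "s \<in> S" for s
      using that notin by (auto simp: \<psi>_def B_add_right)
    have "\<psi> (x + y) = \<psi> x + \<psi> y + B x y" if xy: "x \<in> T" "y \<in> T" for x y
    proof -
      consider "x \<in> S" "y \<in> S" | t where "x \<in> S" "y = m + t" "t \<in> S"
        | t where "x = m + t" "t \<in> S" "y \<in> S" | t s where "x = m + t" "t \<in> S" "y = m + s" "s \<in> S"
        using xy by (auto simp: T_def)
      then show ?thesis
      proof cases
        case 1
        then show ?thesis by (simp add: \<psi> add \<phi>)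
      next
        case (2 t)
        then have "x + y = m + (x + t)" by (simp add: algebra_simps)
        then show ?thesis
          using 2 by (simp add: \<psi> add \<phi> B_add_right B_commute[of x m] B_commute[of t x] algebra_simps)
      next
        case (3 t)
        then have "x + y = m + (t + y)" by (simp add: algebra_simps)
        then show ?thesis
          using 3 by (simp add: \<psi> add \<phi> B_add_right B_add_left algebra_simps)
      next
        case (4 t s)
        then have "x + y = t + s" by (simp add: algebra_simps)
        then show ?thesis
          using 4 by (simp add: \<psi> add \<phi> B_add_right B_add_left B_commute[of t m] B_commute[of s t] algebra_simps)
      qed
    qed
    then have "P T"
      using subspace_insert_bit(1)[OF sub, of m] unfolding P_def T_def by blast
    then have "2 * card S \<le> card S"
      using max[of T] subspace_insert_bit(2)[OF sub m] by (simp only: T_def)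
    then show False
      using sub by (auto simp: subspace_bit_iff card_eq_0_iff)
  qed
  then show ?thesis
    using \<phi> by (auto simp: qf_iff)
qed

lemma isotropic_if_singular:
  assumes "qf \<phi>" "vec.subspace W" "\<forall>x\<in>W. \<phi> x = 0"
  shows "W \<subseteq> perp W"
proof -
  have "B x y = 0" if "x \<in> W" "y \<in> W" for x y
    using that assms qf_add[of \<phi> x y] by (auto simp: subspace_bit_iff)
  then show ?thesis by (auto simp: perp_def)
qed

text \<open>Averaging over shifts by \<open>u\<close> in \<open>U\<close> multiplies the term at
  \<open>x\<close> by the mean of \<open>chi (B u x)\<close>, which kills every \<open>x\<close>
  outside \<open>perp U\<close>.\<close>

lemma gauss_sum_perp:
  assumes \<phi>: "qf \<phi>" and U: "vec.subspace U" "\<forall>u\<in>U. \<phi> u = 0"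
  shows "gauss_sum \<phi> = (\<Sum>x\<in>perp U. chi (\<phi> x))"
proof -
  have "int (card U) * gauss_sum \<phi> = (\<Sum>u\<in>U. \<Sum>x\<in>UNIV. chi (\<phi> x))"
    by (simp add: gauss_sum_def)
  also have "\<dots> = (\<Sum>u\<in>U. \<Sum>x\<in>UNIV. chi (\<phi> (u + x)))"
  proof (rule sum.cong[OF refl])
    fix u
    show "(\<Sum>x\<in>UNIV. chi (\<phi> x)) = (\<Sum>x\<in>UNIV. chi (\<phi> (u + x)))"
      by (rule sum.reindex_bij_witness[of _ "\<lambda>x. u + x" "\<lambda>x. u + x"]) auto
  qed
  also have "\<dots> = (\<Sum>u\<in>U. \<Sum>x\<in>UNIV. chi (\<phi> x) * chi (B u x))"
    using U by (simp add: qf_add[OF \<phi>] chi_add)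
  also have "\<dots> = (\<Sum>x\<in>UNIV. chi (\<phi> x) * (\<Sum>u\<in>U. chi (B u x)))"
    by (subst sum.swap) (simp add: sum_distrib_left)
  also have "\<dots> = (\<Sum>x\<in>UNIV. if x \<in> perp U then int (card U) * chi (\<phi> x) else 0)"
    by (intro sum.cong) (auto simp: sum_chi_B[OF U(1)])
  also have "\<dots> = int (card U) * (\<Sum>x\<in>perp U. chi (\<phi> x))"
    by (simp add: sum.If_cases sum_distrib_left)
  finally show ?thesis
    using U by (auto simp: subspace_bit_iff)
qed

text \<open>Completing the square:
  \<open>\<phi> x + B a x = \<phi> (a + x) + \<phi> a\<close>.\<close>

lemma gauss_sum_translate:
  assumes "qf \<phi>"
  shows "gauss_sum (translate \<phi> a) = chi (\<phi> a) * gauss_sum \<phi>"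
proof -
  have "gauss_sum (translate \<phi> a) = (\<Sum>x\<in>UNIV. chi (\<phi> a) * chi (\<phi> (a + x)))"
    unfolding gauss_sum_def translate_def
    by (intro sum.cong) (auto simp: qf_add[OF assms] add.assoc simp flip: chi_add)
  also have "\<dots> = chi (\<phi> a) * (\<Sum>x\<in>UNIV. chi (\<phi> (a + x)))"
    by (simp add: sum_distrib_left)
  also have "(\<Sum>x\<in>UNIV. chi (\<phi> (a + x))) = gauss_sum \<phi>"
    unfolding gauss_sum_def
    by (rule sum.reindex_bij_witness[of _ "\<lambda>x. a + x" "\<lambda>x. a + x"]) auto
  finally show ?thesis .
qed

text \<open>One factor is expanded and absorbed into the other as Gauss sums of translates. After
  swapping the sums, the sum of \<open>chi (B a x)\<close> over \<open>a\<close> leaves only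
  \<open>x = 0\<close>.\<close>

lemma gauss_sum_square:
  assumes "qf \<phi>"
  shows "gauss_sum \<phi> * gauss_sum \<phi> = 2 ^ (2 * n)"
proof -
  have "gauss_sum \<phi> * gauss_sum \<phi> = (\<Sum>a\<in>UNIV. chi (\<phi> a) * gauss_sum \<phi>)"
    by (simp add: gauss_sum_def sum_distrib_right)
  also have "\<dots> = (\<Sum>a\<in>UNIV. \<Sum>x\<in>UNIV. chi (\<phi> x) * chi (B a x))"
    by (simp add: gauss_sum_translate[OF assms, symmetric])
      (simp add: gauss_sum_def translate_def chi_add)
  also have "\<dots> = (\<Sum>x\<in>UNIV. chi (\<phi> x) * (\<Sum>a\<in>UNIV. chi (B a x)))"
    by (subst sum.swap) (simp add: sum_distrib_left)
  also have "\<dots> = (\<Sum>x\<in>(UNIV :: (bit ^ 'm) set). if x = 0 then chi (\<phi> 0) * 2 ^ (2 * n) else 0)"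
    using card_space by (intro sum.cong) (auto simp: sum_chi_B[OF vec.subspace_UNIV] perp_UNIV)
  finally show ?thesis
    by (simp add: qf_0[OF assms])
qed

lemma gauss_sum_cases:
  assumes "qf \<phi>"
  shows "gauss_sum \<phi> = 2 ^ n \<or> gauss_sum \<phi> = - (2 ^ n)"
proof -
  have "(gauss_sum \<phi>)\<^sup>2 = (2 ^ n)\<^sup>2"
    using gauss_sum_square[OF assms] by (simp add: power2_eq_square power_add mult_2)
  then show ?thesis
    by (simp add: power2_eq_iff)
qed

section \<open>The Witt index and the sign of the Gauss sum\<close>

lemma witt_index_attained:
  assumes \<phi>: "qf \<phi>"
  shows "\<exists>W. vec.subspace W \<and> W \<subseteq> Sing \<phi> \<and> vec.dim W = witt_index \<phi>"
    and "vec.subspace W \<Longrightarrow> W \<subseteq> Sing \<phi> \<Longrightarrow> vec.dim W \<le> witt_index \<phi>"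
proof -
  let ?D = "{vec.dim W | W. vec.subspace W \<and> W \<subseteq> Sing \<phi>}"
  have "0 \<in> ?D"
    using qf_0[OF \<phi>] by (auto simp: Sing_def intro!: exI[of _ "{0}"])
  moreover have "finite ?D"
    by (rule finite_subset[of _ "vec.dim ` (UNIV :: (bit ^ 'm) set set)"]) auto
  ultimately have "witt_index \<phi> \<in> ?D" and max: "\<And>e. e \<in> ?D \<Longrightarrow> e \<le> witt_index \<phi>"
    unfolding witt_index_def using Max_in[of ?D] Max_ge[of ?D] by blast+
  then show "\<exists>W. vec.subspace W \<and> W \<subseteq> Sing \<phi> \<and> vec.dim W = witt_index \<phi>"
    by force
  show "vec.dim W \<le> witt_index \<phi>" if "vec.subspace W" "W \<subseteq> Sing \<phi>"
    using max that by blast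
qed

text \<open>For a totally singular \<open>W\<close> of maximal dimension, \<open>\<phi>\<close> is
  constantly 1 on \<open>perp W - W\<close>, since a singular vector there could be adjoined to
  \<open>W\<close>. The Gauss sum, confined to \<open>perp W\<close>, is then the size of
  \<open>W\<close> minus that of \<open>perp W - W\<close>.\<close>

lemma gauss_sum_witt_index:
  assumes \<phi>: "qf \<phi>"
  shows "gauss_sum \<phi> = 2 * 2 ^ witt_index \<phi> - 2 ^ (2 * n - witt_index \<phi>)" "witt_index \<phi> \<le> n"
proof -
  obtain W where W: "vec.subspace W" "W \<subseteq> Sing \<phi>" and wW: "vec.dim W = witt_index \<phi>"
    using witt_index_attained(1)[OF \<phi>] by blast
  define w where "w = witt_index \<phi>"
  have cW: "card W = 2 ^ w"
    using card_subspace_bit[OF W(1)] by (simp add: w_def wW)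
  have sing: "\<forall>x\<in>W. \<phi> x = 0"
    using W by (auto simp: Sing_def)
  have Wp: "W \<subseteq> perp W"
    using isotropic_if_singular \<phi> W sing by blast
  then have "card W \<le> card (perp W)"
    by (simp add: card_mono)
  then have "card W * card W \<le> 2 ^ (2 * n)"
    using card_perp[OF W(1)] by (metis mult_le_mono2)
  then have "w + w \<le> 2 * n"
    unfolding cW by (simp flip: power_add)
  then have wn: "w \<le> n" by simp
  then show "witt_index \<phi> \<le> n" by (simp add: w_def)
  have cp: "card (perp W) = 2 ^ (2 * n - w)"
  proof -
    have "(2::nat) ^ (2 * n) = 2 ^ w * 2 ^ (2 * n - w)"
      using wn by (simp flip: power_add)
    then show ?thesis
      using card_perp[OF W(1)] cW by simp
  qed
  have out: "\<phi> x = 1" if x: "x \<in> perp W" "x \<notin> W" for x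
  proof (rule ccontr)
    assume "\<phi> x \<noteq> 1"
    then have x0: "\<phi> x = 0" by simp
    let ?T = "W \<union> (+) x ` W"
    have sT: "vec.subspace ?T" and cT: "card ?T = 2 * card W"
      using subspace_insert_bit[OF W(1)] x by auto
    have "?T \<subseteq> Sing \<phi>"
      using sing x0 perpD(2)[OF x(1)] by (auto simp: Sing_def qf_add[OF \<phi>])
    then have "vec.dim ?T \<le> w"
      using witt_index_attained(2)[OF \<phi> sT] unfolding w_def by blast
    moreover have "2 ^ vec.dim ?T = (2::nat) ^ Suc w"
      using card_subspace_bit[OF sT] cT cW by simp
    ultimately show False
      by (metis Suc_n_not_le_n power_inject_exp one_less_numeral_iff semiring_norm(76))
  qed
  have "gauss_sum \<phi> = (\<Sum>x\<in>perp W. chi (\<phi> x))"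
    using gauss_sum_perp \<phi> W sing by blast
  also have "\<dots> = (\<Sum>x\<in>W. chi (\<phi> x)) + (\<Sum>x\<in>perp W - W. chi (\<phi> x))"
    using Wp by (simp add: sum.subset_diff add.commute)
  also have "\<dots> = int (card W) - int (card (perp W - W))"
    using sing out by simp
  also have "\<dots> = 2 * int (card W) - int (card (perp W))"
    using Wp by (simp add: card_Diff_subset of_nat_diff card_mono)
  finally show "gauss_sum \<phi> = 2 * 2 ^ witt_index \<phi> - 2 ^ (2 * n - witt_index \<phi>)"
    unfolding cW cp w_def by simp
qed

text \<open>Trades the Witt index, which is hard to follow under translation, for the Gauss sum. The
  preceding formula can equal \<open>2 ^ n\<close> or its negative only for Witt index
  \<open>n\<close> or \<open>n - 1\<close>. The hypothesis \<open>1 \<le> n\<close> keeps these two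
  distinct.\<close>

lemma mem_quadratic_forms_iff:
  assumes n: "1 \<le> n" and \<epsilon>: "\<epsilon> \<in> {1, -1}"
  shows "\<phi> \<in> quadratic_forms B n \<epsilon> \<longleftrightarrow> qf \<phi> \<and> gauss_sum \<phi> = \<epsilon> * 2 ^ n"
proof (cases "qf \<phi>")
  case True
  define w where "w = witt_index \<phi>"
  have G: "gauss_sum \<phi> = 2 * 2 ^ w - 2 ^ (2 * n - w)" and wn: "w \<le> n"
    using gauss_sum_witt_index[OF True] by (auto simp: w_def)
  have "w = n \<and> gauss_sum \<phi> = 2 ^ n \<or> w = n - 1 \<and> gauss_sum \<phi> = - (2 ^ n)"
  proof -
    consider "w = n" | "w = n - 1" | "w + 2 \<le> n"
      using wn n by linarith
    then show ?thesis
    proof cases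
      case 2
      have e: "2 * n - w = Suc n" and "n = Suc w" using 2 n by auto
      then have "2 * (2::int) ^ w = 2 ^ n"
        by (metis power_Suc)
      then have "gauss_sum \<phi> = - (2 ^ n)"
        unfolding G e by simp
      with 2 show ?thesis by blast
    next
      case 3
      have "4 * (2::int) ^ n \<le> 2 ^ (2 * n - w)"
        using 3 power_increasing[of "n + 2" "2 * n - w" "2::int"] by simp
      moreover have "2 * (2::int) ^ w < 2 ^ n"
        using 3 power_strict_increasing[of "Suc w" n "2::int"] by simp
      ultimately have "gauss_sum \<phi> < - (2 ^ n)"
        unfolding G using zero_less_power[of "2::int" n] by linarith
      then show ?thesis
        using gauss_sum_cases[OF True] zero_less_power[of "2::int" n] by linarith
    next
      case 1
      have e: "2 * n - n = n" by simp
      have "gauss_sum \<phi> = 2 ^ n"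
        using G unfolding 1 e by linarith
      with 1 show ?thesis by blast
    qed
  qed
  moreover have "(2::int) ^ n \<noteq> - (2 ^ n)"
    using zero_less_power[of "2::int" n] by linarith
  ultimately show ?thesis
    using \<epsilon> n True by (auto simp: quadratic_forms_def w_def)
qed (simp add: quadratic_forms_def)

text \<open>If \<open>w\<close> itself fails, take \<open>y\<close> in \<open>perp T\<close>
  orthogonal to neither \<open>c\<close> nor \<open>w\<close>. Then
  \<open>\<phi> (y + w) = \<phi> y + 1\<close>, so one of \<open>y\<close> and \<open>y + w\<close>
  is singular, and both pair to 1 with \<open>c\<close>.\<close>

lemma exists_singular_in_perp:
  assumes \<phi>: "qf \<phi>" and T: "vec.subspace T" "c \<notin> T" and w: "w \<notin> T" "w \<in> perp T" "\<phi> w = 0"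
  shows "\<exists>y\<in>perp T. \<phi> y = 0 \<and> B c y = 1"
proof (cases "B c w = 1")
  case True
  with w show ?thesis by blast
next
  case False
  obtain y where y: "y \<in> perp T" "B c y = 1" "B w y = 1"
    using exists_perp2 T w by blast
  show ?thesis
  proof (cases "\<phi> y = 0")
    case nz: False
    have "y + w \<in> perp T"
      using subspace_perp y w by (auto simp: subspace_bit_iff)
    moreover have "\<phi> (y + w) = 0" "B c (y + w) = 1"
      using nz False y w by (auto simp: qf_add[OF \<phi>] B_add_right B_commute[of y w])
    ultimately show ?thesis by blast
  qed (use y in blast)
qed

text \<open>An exchange argument in the role of Witt's theorem. If every vector of \<open>M\<close>
  orthogonal to \<open>T\<close> lay in \<open>T\<close>, then \<open>M \<inter> perp T\<close>
  would be contained in \<open>T \<inter> perp M\<close>, and \<open>card_Int_perp\<close> would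
  give \<open>card M \<le> card T\<close>. So a new vector of \<open>M\<close> can be adjoined;
  sizes are powers of two, hence doubling does not overshoot. The ambient \<open>S\<close> serves to
  keep extensions orthogonal to given vectors.\<close>

lemma extend_singular_subspace:
  assumes \<phi>: "qf \<phi>" and S: "vec.subspace S" and M: "vec.subspace M" "M \<subseteq> S" "\<forall>x\<in>M. \<phi> x = 0"
    and T: "vec.subspace T" "T \<subseteq> S" "\<forall>x\<in>T. \<phi> x = 0" "card T \<le> card M"
  shows "\<exists>T'. vec.subspace T' \<and> T \<subseteq> T' \<and> T' \<subseteq> S \<and> (\<forall>x\<in>T'. \<phi> x = 0) \<and> card T' = card M"
  using T
proof (induction "card M - card T" arbitrary: T rule: less_induct)
  case less
  show ?case
  proof (cases "card T = card M")
    case True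
    then show ?thesis using less.prems by blast
  next
    case False
    then have lt: "card T < card M" using less.prems by simp
    have T: "vec.subspace T" "T \<subseteq> S" "\<forall>x\<in>T. \<phi> x = 0"
      using less.prems by auto
    have pos: "0 < card T"
      using T by (auto simp: subspace_bit_iff card_gt_0_iff)
    have "\<not> M \<inter> perp T \<subseteq> T"
    proof
      assume "M \<inter> perp T \<subseteq> T"
      then have "M \<inter> perp T \<subseteq> T \<inter> perp M"
        using isotropic_if_singular[OF \<phi> M(1,3)] by blast
      then have "card (M \<inter> perp T) \<le> card (T \<inter> perp M)"
        by (simp add: card_mono)
      then have "card T * card (M \<inter> perp T) \<le> card T * card (T \<inter> perp M)"
        by simp
      also have "\<dots> < card M * card (T \<inter> perp M)"
      proof -
        have "0 \<in> T \<inter> perp M"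
          using T subspace_perp by (auto simp: subspace_bit_iff)
        then have "0 < card (T \<inter> perp M)"
          by (auto simp: card_gt_0_iff)
        with lt show ?thesis by simp
      qed
      finally show False
        using card_Int_perp[OF T(1) M(1)] by simp
    qed
    then obtain m where m: "m \<in> M" "m \<in> perp T" "m \<notin> T" by blast
    define T2 where "T2 = T \<union> (+) m ` T"
    have T2: "vec.subspace T2" "card T2 = 2 * card T"
      using subspace_insert_bit[OF T(1)] m by (auto simp: T2_def)
    have "T2 \<subseteq> S"
    proof -
      have "m + t \<in> S" if "t \<in> T" for t
        using S T(2) m(1) M(2) that unfolding subspace_bit_iff by blast
      then show ?thesis
        using T(2) by (auto simp: T2_def)
    qed
    moreover have "\<forall>x\<in>T2. \<phi> x = 0"
      using T m M perpD(2)[OF m(2)] by (auto simp: T2_def qf_add[OF \<phi>])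
    moreover have "card T2 \<le> card M"
    proof -
      have "vec.dim T < vec.dim M"
        using lt card_subspace_bit[OF T(1)] card_subspace_bit[OF M(1)] by simp
      then have "(2::nat) ^ Suc (vec.dim T) \<le> 2 ^ vec.dim M"
        by (intro power_increasing) auto
      then show ?thesis
        using card_subspace_bit[OF T(1)] card_subspace_bit[OF M(1)] T2 by simp
    qed
    moreover have "card M - card T2 < card M - card T"
      using T2 pos lt by simp
    ultimately obtain T' where "vec.subspace T'" "T2 \<subseteq> T'" "T' \<subseteq> S" "\<forall>x\<in>T'. \<phi> x = 0" "card T' = card M"
      using less.hyps[of T2] T2 by blast
    moreover have "T \<subseteq> T2" by (auto simp: T2_def)
    ultimately show ?thesis by blast
  qed
qed

lemma totally_isotropic_iff_perp: "totally_isotropic B U \<longleftrightarrow> U \<subseteq> perp U"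
  by (auto simp: totally_isotropic_def perp_def)

text \<open>Any form is additive on an isotropic \<open>U\<close>, so some translate cancels it
  there. Its sign is not controlled.\<close>

lemma exists_qf_vanishing:
  assumes "vec.subspace U" "totally_isotropic B U"
  shows "\<exists>\<phi>. qf \<phi> \<and> (\<forall>u\<in>U. \<phi> u = 0)"
proof -
  obtain \<phi> where \<phi>: "qf \<phi>" using exists_qf by blast
  have "\<exists>a. \<forall>x\<in>U. \<phi> x = B a x"
    using assms by (intro functional_represented) (auto simp: qf_add[OF \<phi>] totally_isotropic_def)
  then obtain a where "\<forall>x\<in>U. \<phi> x = B a x" by blast
  then show ?thesis
    using qf_translate[OF \<phi>, of a] by (intro exI[of _ "translate \<phi> a"]) (auto simp: translate_def)
qed

end

section \<open>Forms of a fixed sign\<close>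

locale sp_type = sp_space B n for B :: "bit ^ 'm \<Rightarrow> bit ^ 'm \<Rightarrow> bit" and n :: nat +
  fixes \<epsilon> :: int
  assumes n2: "2 \<le> n" and sign: "\<epsilon> \<in> {1, -1}"
begin

abbreviation Q :: "(bit ^ 'm \<Rightarrow> bit) set" where
  "Q \<equiv> quadratic_forms B n \<epsilon>"

definition vanishing :: "(bit ^ 'm) set \<Rightarrow> (bit ^ 'm \<Rightarrow> bit) set" where
  "vanishing U = {\<phi>\<in>Q. \<forall>u\<in>U. \<phi> u = 0}"

lemma mem_Q_iff: "\<phi> \<in> Q \<longleftrightarrow> qf \<phi> \<and> gauss_sum \<phi> = \<epsilon> * 2 ^ n"
  using n2 sign by (intro mem_quadratic_forms_iff) auto

lemma qf_Q: "\<phi> \<in> Q \<Longrightarrow> qf \<phi>"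
  by (simp add: mem_Q_iff)

lemma translate_mem_Q_iff: "\<phi> \<in> Q \<Longrightarrow> translate \<phi> a \<in> Q \<longleftrightarrow> \<phi> a = 0"
proof -
  assume \<phi>: "\<phi> \<in> Q"
  then have "gauss_sum (translate \<phi> a) = chi (\<phi> a) * (\<epsilon> * 2 ^ n)"
    using gauss_sum_translate[of \<phi> a] by (simp add: mem_Q_iff)
  moreover have "\<epsilon> \<noteq> 0" using sign by auto
  ultimately show ?thesis
    using \<phi> qf_translate[of \<phi> a] unfolding mem_Q_iff by (simp add: chi_def)
qed

lemma Q_eq_translate:
  assumes "\<phi> \<in> Q" "\<psi> \<in> Q"
  obtains a where "\<psi> = translate \<phi> a" "\<phi> a = 0"
proof -
  obtain a where a: "\<psi> = translate \<phi> a"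
    using qf_eq_translate[OF qf_Q[OF assms(1)] qf_Q[OF assms(2)]] by blast
  moreover have "\<phi> a = 0"
    using assms translate_mem_Q_iff[OF assms(1), of a] by (simp add: a)
  ultimately show thesis by (rule that)
qed

lemma finite_Q: "finite Q"
  by simp

text \<open>The reference form \<open>\<phi>\<close> has a sign \<open>\<eta>\<close> of its own.
  Its translates that vanish on \<open>U\<close> come from \<open>a\<close> in
  \<open>perp U\<close>, and those of sign \<open>\<epsilon>\<close> are the ones with
  \<open>chi (\<phi> a) = \<epsilon> * \<eta>\<close>. The Gauss sum over \<open>perp U\<close> is,
  up to the factor \<open>\<epsilon> * \<eta>\<close>, the number of such \<open>a\<close> minus the
  number of the others.\<close>

lemma card_vanishing:
  assumes U: "vec.subspace U" "totally_isotropic B U"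
  shows "2 * int (card (vanishing U)) = int (card (perp U)) + \<epsilon> * 2 ^ n"
proof -
  obtain \<phi> where \<phi>: "qf \<phi>" "\<forall>u\<in>U. \<phi> u = 0"
    using exists_qf_vanishing U by blast
  obtain \<eta> where \<eta>: "gauss_sum \<phi> = \<eta> * 2 ^ n" "\<eta> = 1 \<or> \<eta> = -1"
    using gauss_sum_cases[OF \<phi>(1)] by (metis mult_1 mult_minus_left)
  define N where "N = {a \<in> perp U. chi (\<phi> a) = \<epsilon> * \<eta>}"
  have "vanishing U = translate \<phi> ` N"
  proof (intro equalityI subsetI)
    fix \<psi> assume "\<psi> \<in> vanishing U"
    then have \<psi>: "\<psi> \<in> Q" "\<forall>u\<in>U. \<psi> u = 0"
      by (auto simp: vanishing_def)
    then obtain a where a: "\<psi> = translate \<phi> a"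
      using qf_eq_translate[OF \<phi>(1) qf_Q] by blast
    have "a \<in> perp U"
      using \<phi>(2) \<psi>(2) B_commute unfolding a by (auto simp: perp_def translate_def)
    moreover have "chi (\<phi> a) = \<epsilon> * \<eta>"
      using \<psi>(1) \<eta> sign gauss_sum_translate[OF \<phi>(1), of a] by (auto simp: mem_Q_iff a)
    ultimately show "\<psi> \<in> translate \<phi> ` N"
      using a by (auto simp: N_def)
  next
    fix \<psi> assume "\<psi> \<in> translate \<phi> ` N"
    then obtain a where a: "\<psi> = translate \<phi> a" "a \<in> perp U" "chi (\<phi> a) = \<epsilon> * \<eta>"
      by (auto simp: N_def)
    have "gauss_sum \<psi> = \<epsilon> * 2 ^ n"
      using a \<eta> gauss_sum_translate[OF \<phi>(1), of a] by auto
    moreover have "\<forall>u\<in>U. \<psi> u = 0"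
      using \<phi>(2) perpD(2)[OF a(2)] by (auto simp: a translate_def)
    ultimately show "\<psi> \<in> vanishing U"
      using a qf_translate[OF \<phi>(1)] by (auto simp: vanishing_def mem_Q_iff)
  qed
  then have cN: "card (vanishing U) = card N"
    by (simp add: card_image inj_on_def translate_inject)
  have "\<epsilon> * \<eta> * chi (\<phi> a) = (if a \<in> N then 1 else -1)" if "a \<in> perp U" for a
    using that sign \<eta>(2) by (cases "\<phi> a") (auto simp: N_def)
  then have "\<epsilon> * \<eta> * gauss_sum \<phi> = (\<Sum>a\<in>perp U. if a \<in> N then 1 else -1)"
    using gauss_sum_perp[OF \<phi>(1) U(1) \<phi>(2)] by (simp add: sum_distrib_left)
  also have "\<dots> = int (card (perp U \<inter> N)) - int (card (perp U - N))"
    by (simp add: sum.If_cases Diff_eq)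
  also have "perp U \<inter> N = N"
    by (auto simp: N_def)
  also have "int (card (perp U - N)) = int (card (perp U)) - int (card N)"
    by (subst card_Diff_subset) (auto simp: N_def of_nat_diff card_mono)
  also have "\<epsilon> * \<eta> * gauss_sum \<phi> = \<epsilon> * 2 ^ n"
    using \<eta> by auto
  finally show ?thesis
    using cN by simp
qed

lemma card_perp_dim:
  assumes "vec.subspace U" "totally_isotropic B U" "vec.dim U = d" "d \<le> n"
  shows "card (perp U) = 2 ^ (2 * n - d)"
proof -
  have "2 ^ d * card (perp U) = 2 ^ d * 2 ^ (2 * n - d)"
    using card_perp[OF assms(1)] card_subspace_bit[OF assms(1)] assms by (simp flip: power_add)
  then show ?thesis by simp
qed

lemma card_vanishing_dim:
  assumes "vec.subspace U" "totally_isotropic B U" "vec.dim U = d" "d \<le> n"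
  shows "int (card (vanishing U)) = 2 ^ (n - 1) * (2 ^ (n - d) + \<epsilon>)"
proof -
  have "2 * int (card (vanishing U)) = 2 ^ (2 * n - d) + \<epsilon> * 2 ^ n"
    using card_vanishing[OF assms(1,2)] card_perp_dim[OF assms] by simp
  also have "2 * n - d = Suc (n - 1 + (n - d))"
    using assms n2 by simp
  also have "(2::int) ^ n = 2 * 2 ^ (n - 1)"
    using n2 by (metis Suc_diff_1 power_Suc pos2 less_le_trans)
  finally show ?thesis
    by (simp add: power_add algebra_simps)
qed

lemma card_Q: "int (card Q) = 2 ^ (n - 1) * (2 ^ n + \<epsilon>)"
proof -
  have "vanishing {0} = Q"
    using qf_0 qf_Q by (auto simp: vanishing_def)
  then show ?thesis
    using card_vanishing_dim[of "{0}" 0] by (simp add: totally_isotropic_def)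
qed

lemma subspace_Sing_Int:
  assumes "qf \<phi>" "vec.subspace U" "totally_isotropic B U"
  shows "vec.subspace (Sing \<phi> \<inter> U)"
proof -
  have "\<phi> (x + y) = \<phi> x + \<phi> y" if "x \<in> U" "y \<in> U" for x y
    using that assms(3) qf_add[OF assms(1), of x y] by (simp add: totally_isotropic_def)
  then show ?thesis
    using assms(2) qf_0[OF assms(1)] unfolding subspace_bit_iff Sing_def by simp
qed

text \<open>On an isotropic \<open>U\<close> the form is additive, so its zeros are all of
  \<open>U\<close> or half of it. Hence only the dimensions \<open>d\<close> and
  \<open>d - 1\<close> occur, and the two kinds of codeword are complementary.\<close>

lemma dim_Sing_Int:
  assumes \<phi>: "qf \<phi>" and U: "vec.subspace U" "totally_isotropic B U"
  shows "vec.dim (Sing \<phi> \<inter> U) = (if \<forall>u\<in>U. \<phi> u = 0 then vec.dim U else vec.dim U - 1)"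
proof (cases "\<forall>u\<in>U. \<phi> u = 0")
  case True
  then have "Sing \<phi> \<inter> U = U" by (auto simp: Sing_def)
  with True show ?thesis by simp
next
  case False
  have "(\<Sum>u\<in>U. chi (\<phi> u)) = 0"
    using sum_chi_additive[OF U(1), of \<phi>] U False by (auto simp: qf_add[OF \<phi>] totally_isotropic_def)
  moreover have "(\<Sum>u\<in>U. chi (\<phi> u)) = int (card (Sing \<phi> \<inter> U)) - int (card (U - Sing \<phi>))"
    by (simp add: chi_def sum.If_cases Sing_def Diff_eq Int_commute)
  ultimately have "card (Sing \<phi> \<inter> U) = card (U - Sing \<phi>)" by simp
  then have "card U = 2 * card (Sing \<phi> \<inter> U)"
    using card_Int_Diff[of U "Sing \<phi>"] by (simp add: Int_commute)
  then have "2 ^ vec.dim U = (2::nat) ^ Suc (vec.dim (Sing \<phi> \<inter> U))"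
    using card_subspace_bit[OF U(1)] card_subspace_bit[OF subspace_Sing_Int[OF assms]] by simp
  then have "vec.dim U = Suc (vec.dim (Sing \<phi> \<inter> U))"
    by (metis power_inject_exp one_less_numeral_iff semiring_norm(76))
  with False show ?thesis by simp
qed

lemma codeword_eq:
  assumes U: "vec.subspace U" "totally_isotropic B U" "vec.dim U = d" "1 \<le> d"
  shows "codeword B n d \<epsilon> 0 U = vanishing U" "codeword B n d \<epsilon> 1 U = Q - vanishing U"
  using dim_Sing_Int[OF qf_Q U(1,2)] U(3,4)
  by (auto simp: codeword_def vanishing_def split: if_splits)

text \<open>For \<open>c\<close> in \<open>U'\<close> but not in \<open>U\<close>, translating a
  common member \<open>\<phi>\<close> by a singular \<open>y\<close> in \<open>perp U\<close> with
  \<open>B c y = 1\<close> keeps it zero on \<open>U\<close> but not at \<open>c\<close>. If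
  \<open>c\<close> is not orthogonal to \<open>U\<close>, such a \<open>y\<close> exists in
  \<open>U\<close>; otherwise \<open>c\<close> itself plays the part of \<open>w\<close> in
  \<open>exists_singular_in_perp\<close>.\<close>

lemma vanishing_inject:
  assumes U: "vec.subspace U" "totally_isotropic B U" and U': "vec.subspace U'"
    and card: "card U = card U'" and eq: "vanishing U = vanishing U'" and ne: "vanishing U \<noteq> {}"
  shows "U = U'"
proof (rule ccontr)
  assume "U \<noteq> U'"
  then have "\<not> U' \<subseteq> U"
    using card card_subset_eq[of U U'] by auto
  then obtain c where c: "c \<in> U'" "c \<notin> U" by blast
  obtain \<phi> where \<phi>: "\<phi> \<in> Q" "\<forall>u\<in>U. \<phi> u = 0" "\<forall>u\<in>U'. \<phi> u = 0"
    using ne eq by (auto simp: vanishing_def)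
  have "\<exists>y\<in>perp U. \<phi> y = 0 \<and> B c y = 1"
  proof (cases "\<exists>u\<in>U. B c u = 1")
    case True
    then show ?thesis
      using \<phi> U by (auto simp: totally_isotropic_iff_perp)
  next
    case False
    then have "c \<in> perp U"
      using B_commute by (auto simp: perp_def)
    then show ?thesis
      using exists_singular_in_perp[OF qf_Q[OF \<phi>(1)] U(1)] c \<phi> by blast
  qed
  then obtain y where y: "y \<in> perp U" "\<phi> y = 0" "B c y = 1" by blast
  have "translate \<phi> y \<in> vanishing U"
    using \<phi> y perpD(2)[OF y(1)] by (auto simp: vanishing_def translate_mem_Q_iff) (simp add: translate_def)
  moreover have "translate \<phi> y \<notin> vanishing U'"
    using c \<phi> y B_commute[of c y] by (auto simp: vanishing_def translate_def)
  ultimately show False using eq by blast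
qed

end

section \<open>Transitivity properties of the symplectic group\<close>

text \<open>The standard notation for inverse functions is shadowed by the group inverse of HOL-Algebra.\<close>

abbreviation finv :: "('a \<Rightarrow> 'b) \<Rightarrow> 'b \<Rightarrow> 'a" where
  "finv \<equiv> inv_into UNIV"

context sp_space
begin

lemma Sp_iff:
  "g \<in> Sp B \<longleftrightarrow> (\<forall>x y. g (x + y) = g x + g y) \<and> bij g \<and> (\<forall>x y. B (g x) (g y) = B x y)"
  by (simp add: Sp_def linear_vec_bit_iff)

lemma Sp_add: "g \<in> Sp B \<Longrightarrow> g (x + y) = g x + g y"
  and Sp_bij: "g \<in> Sp B \<Longrightarrow> bij g"
  and Sp_B: "g \<in> Sp B \<Longrightarrow> B (g x) (g y) = B x y"
  by (auto simp: Sp_iff)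

lemma Sp_inv_apply: "g \<in> Sp B \<Longrightarrow> g (finv g x) = x" "g \<in> Sp B \<Longrightarrow> finv g (g x) = x"
  using Sp_bij by (auto simp: bij_is_surj surj_f_inv_f bij_is_inj inv_f_f)

lemma Sp_id: "id \<in> Sp B"
  by (simp add: Sp_iff)

lemma Sp_comp: "g \<in> Sp B \<Longrightarrow> h \<in> Sp B \<Longrightarrow> g \<circ> h \<in> Sp B"
  by (auto simp: Sp_iff intro: bij_comp)

lemma Sp_inv:
  assumes g: "g \<in> Sp B"
  shows "finv g \<in> Sp B"
  unfolding Sp_iff
proof (intro conjI allI)
  fix x y
  have "g (finv g x + finv g y) = x + y"
    using g by (simp add: Sp_add Sp_inv_apply)
  then show "finv g (x + y) = finv g x + finv g y"
    using Sp_inv_apply(2)[OF g] by metis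
  show "B (finv g x) (finv g y) = B x y"
    using Sp_B[OF g, of "finv g x" "finv g y"] Sp_inv_apply(1)[OF g] by simp
qed (simp add: Sp_bij[OF g] bij_imp_bij_inv)

lemma Sp_subspace: "g \<in> Sp B \<Longrightarrow> vec.subspace U \<Longrightarrow> vec.subspace (g ` U)"
  using Sp_add[of g 0 0] by (auto simp: subspace_bit_iff image_iff) (metis Sp_add)

lemma Sp_totally_isotropic: "g \<in> Sp B \<Longrightarrow> totally_isotropic B U \<Longrightarrow> totally_isotropic B (g ` U)"
  by (auto simp: totally_isotropic_def Sp_B)

lemma Sp_card_image: "g \<in> Sp B \<Longrightarrow> card (g ` U) = card U"
  by (metis Sp_bij bij_is_inj card_image inj_on_subset subset_UNIV)

lemma Sp_image_inv: "g \<in> Sp B \<Longrightarrow> finv g ` g ` U = U" "g \<in> Sp B \<Longrightarrow> g ` finv g ` U = U"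
  using Sp_inv_apply[of g] by (auto simp: image_image)

lemma Sp_stable:
  assumes "g \<in> Sp B" "\<And>u. u \<in> U \<Longrightarrow> g u \<in> U"
  shows "g ` U = U"
  using assms Sp_card_image[of g U] by (intro card_subset_eq) auto

definition transvection :: "bit ^ 'm \<Rightarrow> bit ^ 'm \<Rightarrow> bit ^ 'm" where
  "transvection v x = (if B x v = 0 then x else x + v)"

lemma transvection_transvection: "transvection v (transvection v x) = x"
  by (auto simp: transvection_def B_add_left add.assoc)

lemma transvection_Sp: "transvection v \<in> Sp B"
  unfolding Sp_iff
proof (intro conjI allI)
  show "bij (transvection v)"
    by (rule o_bij[of "transvection v"]) (auto simp: transvection_transvection)
  fix x y
  show "transvection v (x + y) = transvection v x + transvection v y"
    by (auto simp: transvection_def B_add_left algebra_simps)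
  show "B (transvection v x) (transvection v y) = B x y"
    using B_commute[of v y] by (auto simp: transvection_def B_add_left B_add_right add.assoc)
qed

lemma inv_transvection: "finv (transvection v) = transvection v"
  by (rule inv_unique_comp) (auto simp: transvection_transvection)

section \<open>Action of isometries on quadratic forms\<close>

lemma form_action_comp:
  "g \<in> Sp B \<Longrightarrow> h \<in> Sp B \<Longrightarrow> form_action (g \<circ> h) \<phi> = form_action g (form_action h \<phi>)"
  by (simp add: form_action_def o_inv_distrib Sp_bij)

lemma form_action_id [simp]: "form_action id \<phi> = \<phi>"
  by (simp add: form_action_def)

lemma form_action_inv:
  assumes "g \<in> Sp B"
  shows "form_action (finv g) (form_action g \<phi>) = \<phi>" "form_action g (form_action (finv g) \<phi>) = \<phi>"
  using Sp_inv_apply[OF assms] Sp_bij[OF assms] by (auto simp: form_action_def inv_inv_eq)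

lemma qf_form_action:
  assumes "g \<in> Sp B" "qf \<phi>"
  shows "qf (form_action g \<phi>)"
  using Sp_inv[OF assms(1)] qf_add[OF assms(2)] by (simp add: qf_iff form_action_def Sp_add Sp_B)

lemma gauss_sum_form_action:
  assumes "g \<in> Sp B"
  shows "gauss_sum (form_action g \<phi>) = gauss_sum \<phi>"
  unfolding gauss_sum_def form_action_def
  by (rule sum.reindex_bij_witness[of _ g "finv g"]) (auto simp: Sp_inv_apply[OF assms])

lemma form_action_translate:
  assumes g: "g \<in> Sp B"
  shows "form_action g (translate \<phi> a) = translate (form_action g \<phi>) (g a)"
proof
  fix x
  have "B a (finv g x) = B (g a) x"
    using Sp_B[OF g, of a "finv g x"] Sp_inv_apply(1)[OF g] by simp
  then show "form_action g (translate \<phi> a) x = translate (form_action g \<phi>) (g a) x"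
    by (simp add: form_action_def translate_def)
qed

text \<open>When \<open>B x v = 1\<close>, \<open>\<phi> (x + v) = \<phi> x + \<phi> v + 1\<close>.
  Singular \<open>v\<close> therefore move the form, and nonsingular \<open>v\<close> give its
  reflections.\<close>

lemma form_action_transvection:
  assumes \<phi>: "qf \<phi>"
  shows "form_action (transvection v) \<phi> = (if \<phi> v = 0 then translate \<phi> v else \<phi>)"
proof
  fix x
  show "form_action (transvection v) \<phi> x = (if \<phi> v = 0 then translate \<phi> v else \<phi>) x"
    using B_commute[of x v]
    by (auto simp: form_action_def inv_transvection transvection_def translate_def qf_add[OF \<phi>] add.assoc)
qed

text \<open>Two transvections pass from \<open>u\<close> to \<open>z\<close> and from
  \<open>z\<close> to \<open>u'\<close>, where \<open>z\<close> is orthogonal to neither. Their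
  vectors \<open>u + z\<close> and \<open>z + u'\<close> lie in \<open>perp I\<close>, so
  \<open>I\<close> is fixed pointwise.\<close>

lemma Sp_transitive_fixing:
  assumes I: "vec.subspace I" "u \<notin> I" "u' \<notin> I" "u \<in> perp I" "u' \<in> perp I"
  shows "\<exists>g\<in>Sp B. g u = u' \<and> (\<forall>x\<in>I. g x = x)"
proof -
  obtain z where z: "z \<in> perp I" "B u z = 1" "B u' z = 1"
    using exists_perp2[OF I(1-3)] by blast
  let ?g = "transvection (z + u') \<circ> transvection (u + z)"
  have "?g u = u'"
    using z B_commute[of z u'] by (simp add: transvection_def B_add_right algebra_simps)
  moreover have "?g x = x" if "x \<in> I" for x
    using that I z perpD(1) by (simp add: transvection_def B_add_right)
  ultimately show ?thesis
    using transvection_Sp Sp_comp by blast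
qed

text \<open>Each step enlarges the intersection with \<open>U'\<close>: a vector of \<open>U\<close>
  outside \<open>U'\<close> is sent to one of \<open>U'\<close> outside \<open>U\<close>, with
  \<open>U \<inter> U'\<close> fixed pointwise, which is possible since both vectors are orthogonal
  to it.\<close>

lemma Sp_transitive_isotropic:
  assumes "vec.subspace U" "totally_isotropic B U"
    and U': "vec.subspace U'" "totally_isotropic B U'" and "card U = card U'"
  shows "\<exists>g\<in>Sp B. g ` U = U'"
  using assms(1,2,5)
proof (induction "card U' - card (U \<inter> U')" arbitrary: U rule: less_induct)
  case less
  show ?case
  proof (cases "U = U'")
    case True
    then show ?thesis using Sp_id by (intro bexI[of _ id]) auto
  next
    case False
    have nsub: "\<not> U \<subseteq> U'" "\<not> U' \<subseteq> U"
      using False less.prems(3) card_subset_eq[of U U'] card_subset_eq[of U' U] by auto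
    then obtain u u' where u: "u \<in> U" "u \<notin> U'" and u': "u' \<in> U'" "u' \<notin> U" by blast
    have I: "vec.subspace (U \<inter> U')"
      using less.prems(1) U'(1) by (auto simp: subspace_bit_iff)
    moreover have "u \<in> perp (U \<inter> U')" "u' \<in> perp (U \<inter> U')"
      using less.prems(2) U'(2) u u' by (auto simp: totally_isotropic_def perp_def)
    ultimately obtain g where g: "g \<in> Sp B" "g u = u'" "\<forall>x\<in>U \<inter> U'. g x = x"
      using Sp_transitive_fixing[of "U \<inter> U'" u u'] u u' by blast
    have "insert u' (U \<inter> U') \<subseteq> g ` U \<inter> U'"
      using g u u' by (auto intro: rev_image_eqI)
    then have "card (insert u' (U \<inter> U')) \<le> card (g ` U \<inter> U')"
      by (simp add: card_mono)
    then have "card (U \<inter> U') < card (g ` U \<inter> U')"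
      using u' by simp
    moreover have "card (g ` U \<inter> U') \<le> card U'"
      by (simp add: card_mono)
    ultimately have "card U' - card (g ` U \<inter> U') < card U' - card (U \<inter> U')"
      by simp
    then obtain h where "h \<in> Sp B" "h ` g ` U = U'"
      using less.hyps[of "g ` U"] Sp_subspace[OF g(1)] Sp_totally_isotropic[OF g(1)] Sp_card_image[OF g(1)]
        less.prems by metis
    then show ?thesis
      using g(1) Sp_comp by (intro bexI[of _ "h \<circ> g"]) (auto simp: image_comp)
  qed
qed

end

context sp_type
begin

section \<open>Forms of one sign and stabilisers of codewords\<close>

lemma form_action_mem_Q: "g \<in> Sp B \<Longrightarrow> \<phi> \<in> Q \<Longrightarrow> form_action g \<phi> \<in> Q"
  by (simp add: mem_Q_iff qf_form_action gauss_sum_form_action)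

lemma form_action_Q:
  assumes "g \<in> Sp B"
  shows "form_action g ` Q = Q"
proof (intro equalityI subsetI)
  fix \<phi> assume "\<phi> \<in> Q"
  then show "\<phi> \<in> form_action g ` Q"
    using form_action_mem_Q[OF Sp_inv[OF assms]] form_action_inv(2)[OF assms, of \<phi>]
    by (intro image_eqI[of _ _ "form_action (finv g) \<phi>"]) auto
qed (use form_action_mem_Q[OF assms] in auto)

lemma form_action_vanishing:
  assumes g: "g \<in> Sp B"
  shows "form_action g ` vanishing U = vanishing (g ` U)"
proof -
  have sub: "form_action g ` vanishing U \<subseteq> vanishing (g ` U)" if g: "g \<in> Sp B" for g U
    using form_action_mem_Q[OF g] by (auto simp: vanishing_def form_action_def Sp_inv_apply[OF g])
  have "vanishing (g ` U) = form_action g ` form_action (finv g) ` vanishing (g ` U)"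
    using form_action_inv(2)[OF g] by (simp add: image_image)
  also have "\<dots> \<subseteq> form_action g ` vanishing (finv g ` g ` U)"
    using sub[OF Sp_inv[OF g]] by blast
  finally show ?thesis
    using sub[OF g] Sp_image_inv(1)[OF g] by (metis subset_antisym)
qed

lemma form_action_inj_on_Q: "g \<in> Sp B \<Longrightarrow> inj_on (form_action g) Q"
  by (metis form_action_inv(1) inj_onI)

lemma form_action_Q_diff:
  assumes g: "g \<in> Sp B"
  shows "form_action g ` (Q - vanishing U) = Q - vanishing (g ` U)"
  using form_action_vanishing[OF g, of U] form_action_Q[OF g] form_action_inj_on_Q[OF g]
    inj_on_image_set_diff[of "form_action g" Q Q "vanishing U"]
  by (auto simp: vanishing_def)

text \<open>Since \<open>a + a'\<close> is singular, its transvection alone would move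
  \<open>\<phi>\<close>. Three transvections with mutually orthogonal singular vectors
  \<open>u + w\<close>, \<open>w\<close>, \<open>u\<close> translate \<open>\<phi>\<close> by these
  vectors in turn, and they add up to 0.\<close>

lemma stabiliser_transitive_orthogonal:
  assumes U: "vec.subspace U" "totally_isotropic B U" and \<phi>: "qf \<phi>" "\<forall>u\<in>U. \<phi> u = 0"
    and a: "\<phi> a = 0" "a \<notin> perp U" and a': "\<phi> a' = 0" "a' \<notin> perp U" and orth: "B a a' = 0"
  shows "\<exists>g\<in>Sp B. g ` U = U \<and> form_action g \<phi> = \<phi> \<and> g a = a'"
proof -
  obtain s t where "s \<in> U" "B a s = 1" "t \<in> U" "B a' t = 1"
    using a(2) a'(2) B_commute by (auto simp: perp_def)
  then obtain u where u: "u \<in> U" "B a u = 1" "B a' u = 1"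
    using exists_outside_two_subgroups[OF U(1), of "B a" "B a'" s t] by (auto simp: B_add_right)
  define w where "w = a + a'"
  have w: "\<phi> w = 0" "B u w = 0" "B w u = 0" "B a w = 0"
    using a a' orth u B_commute[of u a] B_commute[of u a']
    by (auto simp: w_def qf_add[OF \<phi>(1)] B_add_left B_add_right)
  have uU: "B x u = 0" if "x \<in> U" for x
    using U u that by (simp add: totally_isotropic_def)
  \<comment> \<open>This is the Siegel transformation sending \<open>x\<close> to
    \<open>x + B x w *s u + B x u *s w\<close>. It preserves \<open>U\<close> because
    \<open>u\<close> lies in \<open>U\<close> and is orthogonal to \<open>U\<close>; it sends
    \<open>a\<close> to \<open>a + w = a'\<close> because \<open>B a w = 0\<close> and
    \<open>B a u = 1\<close>.\<close>
  let ?g = "transvection u \<circ> (transvection w \<circ> transvection (u + w))"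
  have g: "?g \<in> Sp B"
    using transvection_Sp Sp_comp by blast
  have "?g x \<in> U" if x: "x \<in> U" for x
  proof (cases "B x w = 0")
    case True
    then show ?thesis
      using x uU[OF x] by (simp add: transvection_def B_add_right)
  next
    case False
    then have "?g x = x + u"
      using uU[OF x] w by (simp add: transvection_def B_add_right B_add_left add.assoc)
    then show ?thesis
      using x u U by (simp add: subspace_bit_iff)
  qed
  then have "?g ` U = U"
    by (rule Sp_stable[OF g])
  moreover have "?g a = a'"
  proof -
    have "?g a = a + (u + (w + u))"
      using u w by (simp add: transvection_def B_add_right B_add_left add.assoc)
    also have "\<dots> = a'"
      by (simp add: w_def add_ac)
    finally show ?thesis .
  qed
  moreover have "form_action ?g \<phi> = \<phi>"
  proof -
    have u0: "\<phi> u = 0" using \<phi> u by blast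
    have "form_action (transvection (u + w)) \<phi> = translate \<phi> (u + w)"
      using u0 w by (simp add: form_action_transvection[OF \<phi>(1)] qf_add[OF \<phi>(1)])
    moreover have "form_action (transvection w) (translate \<phi> (u + w)) = translate \<phi> u"
    proof -
      have "translate \<phi> (u + w) w = 0"
        using w by (simp add: translate_def B_add_left)
      then show ?thesis
        using form_action_transvection[OF qf_translate[OF \<phi>(1)], of w "u + w"]
        by (simp add: translate_translate add.assoc)
    qed
    moreover have "form_action (transvection u) (translate \<phi> u) = \<phi>"
    proof -
      have "translate \<phi> u u = 0"
        using u0 by (simp add: translate_def)
      then show ?thesis
        using form_action_transvection[OF qf_translate[OF \<phi>(1)], of u u]
        by (simp add: translate_translate)
    qed
    ultimately show ?thesis
      using transvection_Sp Sp_comp by (simp add: form_action_comp)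
  qed
  ultimately show ?thesis using g by blast
qed

text \<open>If \<open>B a a' = 1\<close>, then \<open>a + a'\<close> is nonsingular and its
  reflection fixes \<open>\<phi>\<close> and swaps \<open>a\<close> with \<open>a'\<close>; it
  suffices when \<open>a + a'\<close> is orthogonal to \<open>U\<close>. Otherwise some
  \<open>v\<close> in \<open>U\<close> is orthogonal to exactly one of \<open>a\<close> and
  \<open>a'\<close>, which yields an intermediate vector orthogonal to both.\<close>

lemma stabiliser_transitive_singular:
  assumes U: "vec.subspace U" "totally_isotropic B U" and \<phi>: "qf \<phi>" "\<forall>u\<in>U. \<phi> u = 0"
    and a: "\<phi> a = 0" "a \<notin> perp U" and a': "\<phi> a' = 0" "a' \<notin> perp U"
  shows "\<exists>g\<in>Sp B. g ` U = U \<and> form_action g \<phi> = \<phi> \<and> g a = a'"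
proof -
  \<comment> \<open>The intermediate vector is \<open>x + v\<close>: it is singular, orthogonal to
    \<open>x\<close> and \<open>z\<close>, and outside \<open>perp U\<close> because
    \<open>v\<close> lies in \<open>perp U\<close>.\<close>
  have two_steps: "\<exists>g\<in>Sp B. g ` U = U \<and> form_action g \<phi> = \<phi> \<and> g x = z"
    if xz: "\<phi> x = 0" "x \<notin> perp U" "\<phi> z = 0" "z \<notin> perp U" "B x z = 1" "v \<in> U" "B x v = 0" "B z v = 1"
    for x z v
  proof -
    have y: "\<phi> (x + v) = 0" "x + v \<notin> perp U" "B x (x + v) = 0" "B (x + v) z = 0"
    proof -
      show "\<phi> (x + v) = 0" using xz \<phi> by (simp add: qf_add[OF \<phi>(1)])
      have "v \<in> perp U"
        using U xz by (auto simp: totally_isotropic_iff_perp)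
      show "x + v \<notin> perp U"
      proof
        assume "x + v \<in> perp U"
        then have "(x + v) + v \<in> perp U"
          using subspace_perp \<open>v \<in> perp U\<close> unfolding subspace_bit_iff by blast
        then show False using xz by (simp add: add.assoc)
      qed
      show "B x (x + v) = 0" "B (x + v) z = 0"
        using xz B_commute[of v z] by (auto simp: B_add_left B_add_right)
    qed
    obtain g where g: "g \<in> Sp B" "g ` U = U" "form_action g \<phi> = \<phi>" "g x = x + v"
      using stabiliser_transitive_orthogonal[OF U \<phi> xz(1,2) y(1,2,3)] by blast
    obtain h where h: "h \<in> Sp B" "h ` U = U" "form_action h \<phi> = \<phi>" "h (x + v) = z"
      using stabiliser_transitive_orthogonal[OF U \<phi> y(1,2) xz(3,4) y(4)] by blast
    have "(h \<circ> g) ` U = U" "(h \<circ> g) x = z"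
      using g h by (simp_all only: image_comp[symmetric] o_apply)
    then show ?thesis
      using g h Sp_comp by (intro bexI[of _ "h \<circ> g"]) (auto simp: form_action_comp)
  qed
  have "(\<exists>v\<in>U. B v (a + a') = 1) \<or> a + a' \<in> perp U"
    by (auto simp: perp_def)
  moreover have "B a a' = 0 \<or> B a a' = 1"
    by (cases "B a a'") simp_all
  ultimately consider "B a a' = 0" | "B a a' = 1" "a + a' \<in> perp U"
    | v where "B a a' = 1" "v \<in> U" "B v (a + a') = 1"
    by blast
  then show ?thesis
  proof cases
    case 1
    then show ?thesis using stabiliser_transitive_orthogonal assms by blast
  next
    case 2
    let ?g = "transvection (a + a')"
    have "?g u = u" if "u \<in> U" for u
      using perpD(1)[OF 2(2) that] by (simp add: transvection_def)
    then have "?g ` U = U"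
      by simp
    moreover have "form_action ?g \<phi> = \<phi>"
      using a a' 2 by (simp add: form_action_transvection[OF \<phi>(1)] qf_add[OF \<phi>(1)])
    moreover have "?g a = a'"
      using 2 by (simp add: transvection_def B_add_right)
    ultimately show ?thesis using transvection_Sp by blast
  next
    case (3 v)
    show ?thesis
    proof (cases "B a v = 0")
      case True
      then have "B a' v = 1"
        using 3 B_commute[of v] by (simp add: B_add_right)
      then show ?thesis
        using two_steps[of a a' v] a a' 3 True by blast
    next
      \<comment> \<open>Now \<open>a'\<close> is the one orthogonal to \<open>v\<close>, so the two
        steps run from \<open>a'\<close> to \<open>a\<close> and the result is inverted.\<close>
      case False
      then have "B a' v = 0"
        using 3 B_commute[of v] by (simp add: B_add_right)
      then obtain g where g: "g \<in> Sp B" "g ` U = U" "form_action g \<phi> = \<phi>" "g a' = a"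
        using two_steps[of a' a v] a a' 3 False B_commute[of a a'] by auto
      have "finv g ` U = U" "form_action (finv g) \<phi> = \<phi>" "finv g a = a'"
        using g Sp_image_inv(1)[OF g(1), of U] form_action_inv(1)[OF g(1), of \<phi>] Sp_inv_apply(2)[OF g(1), of a']
        by auto
      then show ?thesis using Sp_inv[OF g(1)] by blast
    qed
  qed
qed

text \<open>The first forms differ by a singular \<open>y\<close> orthogonal to \<open>U\<close>,
  whose transvection matches them and fixes \<open>U\<close> pointwise. It remains to move the
  second forms within the stabiliser of \<open>\<phi>'\<close>; as translates of
  \<open>\<phi>'\<close> they correspond to singular vectors outside \<open>perp U\<close>.\<close>

lemma stabiliser_transitive_pairs:
  assumes U: "vec.subspace U" "totally_isotropic B U"
    and \<phi>: "\<phi> \<in> vanishing U" "\<phi>' \<in> vanishing U" and \<psi>: "\<psi> \<in> Q - vanishing U" "\<psi>' \<in> Q - vanishing U"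
  shows "\<exists>g\<in>Sp B. g ` U = U \<and> form_action g \<phi> = \<phi>' \<and> form_action g \<psi> = \<psi>'"
proof -
  have Q: "\<phi> \<in> Q" "\<phi>' \<in> Q" "\<forall>u\<in>U. \<phi> u = 0" "\<forall>u\<in>U. \<phi>' u = 0"
    using \<phi> by (auto simp: vanishing_def)
  obtain y where y: "\<phi>' = translate \<phi> y" "\<phi> y = 0"
    using Q_eq_translate Q by metis
  let ?t = "transvection y"
  have t: "form_action ?t \<phi> = \<phi>'"
    using y by (simp add: form_action_transvection[OF qf_Q[OF Q(1)]])
  have "B u y = 0" if "u \<in> U" for u
    using Q that B_commute[of u y] unfolding y by (simp add: translate_def)
  then have "?t u = u" if "u \<in> U" for u
    using that by (simp add: transvection_def)
  then have tU: "?t ` U = U" by simp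
  let ?\<psi> = "form_action ?t \<psi>"
  have \<psi>1: "?\<psi> \<in> Q - vanishing U"
    using form_action_Q_diff[OF transvection_Sp, of y U] \<psi>(1) tU by auto
  have *: "\<exists>a. \<theta> = translate \<phi>' a \<and> \<phi>' a = 0 \<and> a \<notin> perp U" if \<theta>: "\<theta> \<in> Q - vanishing U" for \<theta>
  proof -
    obtain a where a: "\<theta> = translate \<phi>' a" "\<phi>' a = 0"
      using Q_eq_translate Q \<theta> by (metis DiffD1)
    obtain u where "u \<in> U" "\<theta> u = 1"
      using \<theta> by (auto simp: vanishing_def)
    then have "B u a = 1"
      using Q B_commute[of u a] by (simp add: a translate_def)
    then have "a \<notin> perp U"
      using \<open>u \<in> U\<close> by (auto simp: perp_def)
    then show ?thesis using a by blast
  qed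
  obtain a where a: "?\<psi> = translate \<phi>' a" "\<phi>' a = 0" "a \<notin> perp U"
    using *[OF \<psi>1] by blast
  obtain a' where a': "\<psi>' = translate \<phi>' a'" "\<phi>' a' = 0" "a' \<notin> perp U"
    using *[OF \<psi>(2)] by blast
  obtain g where g: "g \<in> Sp B" "g ` U = U" "form_action g \<phi>' = \<phi>'" "g a = a'"
    using stabiliser_transitive_singular[OF U qf_Q[OF Q(2)] Q(4) a(2,3) a'(2,3)] by blast
  have "form_action g ?\<psi> = \<psi>'"
    using form_action_translate[OF g(1), of \<phi>' a] g a(1) a'(1) by simp
  moreover have "(g \<circ> ?t) ` U = U"
    using g tU by (simp only: image_comp[symmetric])
  ultimately show ?thesis
    using t g transvection_Sp Sp_comp
    by (intro bexI[of _ "g \<circ> ?t"]) (auto simp: form_action_comp)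
qed

lemma subgroup_Sp_on_forms: "subgroup (Sp_on_forms B n \<epsilon>) (BijGroup Q)"
proof
  have Bij: "restrict (form_action g) Q \<in> Bij Q" if "g \<in> Sp B" for g
    using form_action_Q[OF that] form_action_inj_on_Q[OF that] by (simp add: Bij_def bij_betw_def)
  then show "Sp_on_forms B n \<epsilon> \<subseteq> carrier (BijGroup Q)"
    by (auto simp: Sp_on_forms_def BijGroup_def)
  show "x \<otimes>\<^bsub>BijGroup Q\<^esub> y \<in> Sp_on_forms B n \<epsilon>"
    if "x \<in> Sp_on_forms B n \<epsilon>" "y \<in> Sp_on_forms B n \<epsilon>" for x y
  proof -
    obtain g h where gh: "g \<in> Sp B" "h \<in> Sp B" "x = restrict (form_action g) Q" "y = restrict (form_action h) Q"
      using \<open>x \<in> _\<close> \<open>y \<in> _\<close> by (auto simp: Sp_on_forms_def)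
    have "x \<otimes>\<^bsub>BijGroup Q\<^esub> y = compose Q x y"
      using gh Bij by (simp add: BijGroup_def)
    also have "\<dots> = restrict (form_action (g \<circ> h)) Q"
      using gh form_action_mem_Q[OF gh(2)] by (auto simp: compose_def form_action_comp)
    finally show ?thesis
      using Sp_comp gh by (auto simp: Sp_on_forms_def)
  qed
  have "(\<lambda>x\<in>Q. x) = restrict (form_action id) Q"
    by auto
  then have "(\<lambda>x\<in>Q. x) \<in> Sp_on_forms B n \<epsilon>"
    using Sp_id unfolding Sp_on_forms_def by (rule image_eqI)
  then show "\<one>\<^bsub>BijGroup Q\<^esub> \<in> Sp_on_forms B n \<epsilon>"
    by (simp add: BijGroup_def)
  show "inv\<^bsub>BijGroup Q\<^esub> x \<in> Sp_on_forms B n \<epsilon>" if "x \<in> Sp_on_forms B n \<epsilon>" for x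
  proof -
    obtain g where g: "g \<in> Sp B" "x = restrict (form_action g) Q"
      using \<open>x \<in> _\<close> by (auto simp: Sp_on_forms_def)
    have "inv_into Q x \<phi> = form_action (finv g) \<phi>" if "\<phi> \<in> Q" for \<phi>
    proof -
      have "form_action (finv g) \<phi> \<in> Q" "x (form_action (finv g) \<phi>) = \<phi>"
        using form_action_mem_Q[OF Sp_inv[OF g(1)] that] form_action_inv(2)[OF g(1)] g by auto
      then show ?thesis
        using Bij[OF g(1)] by (metis Bij_def IntD2 bij_betw_def g(2) inv_into_f_eq mem_Collect_eq)
    qed
    then have "inv\<^bsub>BijGroup Q\<^esub> x = restrict (form_action (finv g)) Q"
      using inv_BijGroup[OF Bij[OF g(1)]] g(2) by auto
    then show ?thesis
      using Sp_inv[OF g(1)] by (auto simp: Sp_on_forms_def)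
  qed
qed

end

section \<open>Zero-sum quadruples of forms\<close>

lemma subspace_four: "vec.subspace {0, a, b, a + b :: bit ^ 'm}"
  by (auto simp: subspace_bit_iff add_ac)

context sp_type
begin

lemma Q_nonempty: "Q \<noteq> {}"
proof
  assume "Q = {}"
  then have "(2::int) ^ (n - 1) * (2 ^ n + \<epsilon>) = 0"
    using card_Q by simp
  moreover have "(2::int) ^ n \<ge> 2 ^ 2"
    using n2 by (intro power_increasing) auto
  ultimately show False
    using sign by auto
qed

text \<open>Forms in \<open>Q\<close> correspond to singular vectors of \<open>\<phi>\<close>, so
  otherwise \<open>Q\<close> would be a singleton. This uses \<open>2 \<le> n\<close>: for
  \<open>n = 1\<close> and sign \<open>-1\<close> the size formula does give 1.\<close>

lemma exists_nonzero_singular: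
  assumes \<phi>: "\<phi> \<in> Q"
  shows "\<exists>w. w \<noteq> 0 \<and> \<phi> w = 0"
proof (rule ccontr)
  assume no: "\<not> ?thesis"
  have "Q = {\<phi>}"
  proof -
    have "\<psi> = \<phi>" if "\<psi> \<in> Q" for \<psi>
      using Q_eq_translate[OF \<phi> that] no by (metis translate_0)
    then show ?thesis using \<phi> by blast
  qed
  then have "(2::int) ^ (n - 1) * (2 ^ n + \<epsilon>) = 1"
    using card_Q by simp
  moreover have "(2::int) ^ n \<ge> 2 ^ 2"
    using n2 by (intro power_increasing) auto
  moreover have "(1::int) \<le> 2 ^ (n - 1)" by simp
  ultimately show False
    using sign mult_mono[of 1 "(2::int) ^ (n - 1)" 3 "2 ^ n + \<epsilon>"] by auto
qed

lemma singular_nondegenerate: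
  assumes \<phi>: "\<phi> \<in> Q" and x: "\<And>b. \<phi> b = 0 \<Longrightarrow> B x b = 0"
  shows "x = 0"
proof (rule ccontr)
  assume "x \<noteq> 0"
  obtain w where "w \<noteq> 0" "\<phi> w = 0"
    using exists_nonzero_singular[OF \<phi>] by blast
  then have "\<exists>y\<in>perp {0}. \<phi> y = 0 \<and> B x y = 1"
    using \<open>x \<noteq> 0\<close> by (intro exists_singular_in_perp[OF qf_Q[OF \<phi>]]) (auto simp: perp_def)
  then show False
    using x by auto
qed

text \<open>Serves as an induction principle: a property of vectors closed under addition and true
  at 0 need only be checked on singular vectors.\<close>

lemma singular_spans:
  assumes \<phi>: "\<phi> \<in> Q" and S: "vec.subspace S" "\<And>b. \<phi> b = 0 \<Longrightarrow> b \<in> S"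
  shows "x \<in> S"
proof (rule ccontr)
  assume "x \<notin> S"
  then obtain y where y: "y \<in> perp S" "B x y = 1"
    using exists_perp S by blast
  have "y = 0"
    using singular_nondegenerate[OF \<phi>] perpD(2)[OF y(1)] S(2) by blast
  with y show False by simp
qed

text \<open>Comparing the images of \<open>\<phi>\<close> and of its translate by a singular
  \<open>b\<close> recovers the image of \<open>b\<close>, and singular vectors span.\<close>

lemma Sp_eqI:
  assumes g: "g \<in> Sp B" "h \<in> Sp B" and eq: "\<And>\<phi>. \<phi> \<in> Q \<Longrightarrow> form_action g \<phi> = form_action h \<phi>"
  shows "g = h"
proof
  fix x
  obtain \<phi> where \<phi>: "\<phi> \<in> Q" using Q_nonempty by blast
  have "g 0 = 0" "h 0 = 0"
    using Sp_add[OF g(1), of 0 0] Sp_add[OF g(2), of 0 0] by simp_all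
  then have "vec.subspace {x. g x = h x}"
    using Sp_add[OF g(1)] Sp_add[OF g(2)] by (simp add: subspace_bit_iff)
  moreover have "b \<in> {x. g x = h x}" if "\<phi> b = 0" for b
  proof -
    have "form_action g (translate \<phi> b) = form_action h (translate \<phi> b)"
      using eq \<phi> that by (simp add: translate_mem_Q_iff)
    then show ?thesis
      using eq[OF \<phi>] by (simp add: form_action_translate g translate_inject)
  qed
  ultimately have "x \<in> {x. g x = h x}"
    using singular_spans[OF \<phi>] by blast
  then show "g x = h x" by simp
qed

definition zero_sum ::
    "(bit ^ 'm \<Rightarrow> bit) \<Rightarrow> (bit ^ 'm \<Rightarrow> bit) \<Rightarrow> (bit ^ 'm \<Rightarrow> bit) \<Rightarrow> (bit ^ 'm \<Rightarrow> bit) \<Rightarrow> bool" where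
  "zero_sum \<phi> \<phi>' \<psi> \<psi>' \<longleftrightarrow> (\<forall>x. \<phi> x + \<phi>' x + \<psi> x + \<psi>' x = 0)"

lemma zero_sum_translate:
  "zero_sum \<phi> (translate \<phi> a) (translate \<phi> b) \<psi> \<longleftrightarrow> \<psi> = translate \<phi> (a + b)"
proof -
  have "\<phi> x + translate \<phi> a x + translate \<phi> b x + \<psi> x = 0 \<longleftrightarrow> \<psi> x = translate \<phi> (a + b) x" for x
    by (cases "\<phi> x"; cases "\<psi> x"; cases "B a x"; cases "B b x") (simp_all add: translate_def B_add_left)
  then show ?thesis by (auto simp: zero_sum_def)
qed

lemma zero_sum_vanishing:
  assumes "zero_sum \<phi> \<phi>' \<psi> \<psi>'" "\<phi> \<in> vanishing U" "\<phi>' \<in> vanishing U" "\<psi> \<in> vanishing U" "\<psi>' \<in> Q"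
  shows "\<psi>' \<in> vanishing U"
proof -
  have "\<psi>' u = 0" if "u \<in> U" for u
  proof -
    have "\<phi> u + \<phi>' u + \<psi> u + \<psi>' u = 0"
      using assms(1) by (simp add: zero_sum_def)
    then show ?thesis
      using assms(2-4) that by (simp add: vanishing_def)
  qed
  then show ?thesis
    using assms(5) by (simp add: vanishing_def)
qed

text \<open>The only candidate for the fourth form is the translate by \<open>a + b\<close>, which
  has the right sign iff \<open>\<phi> (a + b) = B a b\<close> vanishes.\<close>

lemma orthogonal_iff_zero_sum:
  assumes \<phi>: "\<phi> \<in> Q" and a: "\<phi> a = 0" "\<phi> b = 0" "a \<noteq> 0" "b \<noteq> 0" "a \<noteq> b"
  shows "B a b = 0 \<longleftrightarrow>
    (\<exists>\<psi>\<in>Q. distinct [\<phi>, translate \<phi> a, translate \<phi> b, \<psi>] \<and> zero_sum \<phi> (translate \<phi> a) (translate \<phi> b) \<psi>)"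
proof -
  have "translate \<phi> (a + b) \<in> Q \<longleftrightarrow> B a b = 0"
    using a by (simp add: translate_mem_Q_iff[OF \<phi>] qf_add[OF qf_Q[OF \<phi>]])
  moreover have "distinct [\<phi>, translate \<phi> a, translate \<phi> b, translate \<phi> (a + b)]"
    using a translate_inject[of \<phi> 0] vec_add_eq_0_iff[of a b]
    by (auto simp: translate_inject)
  ultimately show ?thesis
    by (auto simp: zero_sum_translate)
qed

end

locale sp_code = sp_type B n \<epsilon> for B :: "bit ^ 'm \<Rightarrow> bit ^ 'm \<Rightarrow> bit" and n :: nat and \<epsilon> :: int +
  fixes d :: nat
  assumes d: "1 \<le> d" "d \<le> n" "(d, \<epsilon>) \<noteq> (n, -1)"
begin

definition isotropic_d :: "(bit ^ 'm) set set" where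
  "isotropic_d = {U. vec.subspace U \<and> totally_isotropic B U \<and> vec.dim U = d}"

definition base_code :: "(bit ^ 'm \<Rightarrow> bit) set set" where
  "base_code = vanishing ` isotropic_d"

lemma isotropic_dI:
  assumes "qf \<phi>" "vec.subspace U" "\<forall>u\<in>U. \<phi> u = 0" "card U = 2 ^ d"
  shows "U \<in> isotropic_d"
  using assms isotropic_if_singular[OF assms(1-3)] dim_eq_iff_card_bit[OF assms(2)]
  by (simp add: isotropic_d_def totally_isotropic_iff_perp)

text \<open>The Witt index is \<open>n\<close> for sign \<open>1\<close> and \<open>n - 1\<close>
  for sign \<open>-1\<close>; the excluded pair is exactly what would let \<open>d\<close> exceed
  it.\<close>

lemma exists_isotropic_vanishing:
  assumes \<phi>: "\<phi> \<in> Q"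
  shows "\<exists>U\<in>isotropic_d. \<phi> \<in> vanishing U"
proof -
  obtain W where W: "vec.subspace W" "W \<subseteq> Sing \<phi>" "vec.dim W = witt_index \<phi>"
    using witt_index_attained(1)[OF qf_Q[OF \<phi>]] by blast
  have "d \<le> witt_index \<phi>"
    using \<phi> d sign by (auto simp: quadratic_forms_def)
  then obtain U where U: "vec.subspace U" "U \<subseteq> W" "vec.dim U = d"
    using vec.choose_subspace_of_subspace[of d W] W(3) vec.span_eq_iff[of W] W(1) by metis
  have "\<forall>u\<in>U. \<phi> u = 0"
    using U W by (auto simp: Sing_def)
  moreover from this have "U \<in> isotropic_d"
    using isotropic_dI[OF qf_Q[OF \<phi>] U(1)] card_subspace_bit[OF U(1)] U(3) by simp
  ultimately show ?thesis
    using \<phi> by (auto simp: vanishing_def)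
qed

text \<open>What is sought is a \<open>d\<close>-dimensional totally singular \<open>U\<close>
  orthogonal to \<open>a\<close> and \<open>b\<close>. The totally singular space
  \<open>{0, a, b, a + b}\<close> extends to one if it has at most \<open>2 ^ d\<close> elements;
  otherwise \<open>d = 1\<close>, and \<open>{0, a}\<close> serves.\<close>

lemma zero_sum_in_codeword:
  assumes \<phi>: "\<phi> \<in> Q" and a: "\<phi> a = 0" "\<phi> b = 0" "a \<noteq> 0" and ab: "B a b = 0"
  shows "\<exists>S\<in>base_code. {\<phi>, translate \<phi> a, translate \<phi> b, translate \<phi> (a + b)} \<subseteq> S"
proof -
  let ?T = "{0, a, b, a + b}"
  have T0: "\<forall>x\<in>?T. \<phi> x = 0"
    using a ab qf_0[OF qf_Q[OF \<phi>]] by (simp add: qf_add[OF qf_Q[OF \<phi>]])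
  obtain M where M: "M \<in> isotropic_d" "\<phi> \<in> vanishing M"
    using exists_isotropic_vanishing[OF \<phi>] by blast
  then have M': "vec.subspace M" "\<forall>x\<in>M. \<phi> x = 0" "card M = 2 ^ d"
    using card_subspace_bit by (auto simp: isotropic_d_def vanishing_def)
  have "\<exists>U\<in>isotropic_d. (\<forall>u\<in>U. \<phi> u = 0) \<and> U \<subseteq> perp ?T"
  proof (cases "card ?T \<le> card M")
    case True
    then obtain U where U: "vec.subspace U" "?T \<subseteq> U" "\<forall>x\<in>U. \<phi> x = 0" "card U = card M"
      using extend_singular_subspace[OF qf_Q[OF \<phi>] vec.subspace_UNIV M'(1) _ M'(2) subspace_four _ T0]
      by blast
    then have "U \<subseteq> perp U"
      using isotropic_if_singular[OF qf_Q[OF \<phi>]] by blast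
    then have "U \<subseteq> perp ?T"
      using U(2) unfolding perp_def by blast
    then show ?thesis
      using U M' isotropic_dI[OF qf_Q[OF \<phi>]] by auto
  next
    case False
    have "card ?T \<le> 4"
      by (rule order.trans[OF card_insert_le_m1]) (auto intro!: card_insert_le_m1)
    then have "(2::nat) ^ d < 2 ^ 2"
      using False M' by simp
    then have "d = 1"
      using d power_less_imp_less_exp[of "2::nat" d 2] by simp
    then have "{0, a} \<in> isotropic_d"
      using a qf_0[OF qf_Q[OF \<phi>]]
      by (intro isotropic_dI[OF qf_Q[OF \<phi>]]) (auto simp: subspace_bit_iff)
    moreover have "{0, a} \<subseteq> perp ?T"
      using ab B_commute[of b a] by (auto simp: perp_def B_add_left)
    ultimately show ?thesis
      using a qf_0[OF qf_Q[OF \<phi>]] by (intro bexI[of _ "{0, a}"]) auto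
  qed
  then obtain U where U: "U \<in> isotropic_d" "\<forall>u\<in>U. \<phi> u = 0" "U \<subseteq> perp ?T"
    by blast
  have "B a u = 0" "B b u = 0" if "u \<in> U" for u
    using U(3) that by (auto simp: perp_def)
  then have "{\<phi>, translate \<phi> a, translate \<phi> b, translate \<phi> (a + b)} \<subseteq> vanishing U"
    using \<phi> U(2) T0 translate_mem_Q_iff[OF \<phi>]
    by (auto simp: vanishing_def) (auto simp: translate_def B_add_left)
  then show ?thesis
    using U(1) by (auto simp: base_code_def)
qed

text \<open>The vector \<open>w\<close> yields a singular \<open>y\<close> orthogonal to
  \<open>a\<close> and \<open>b\<close> with \<open>B c y = 1\<close>. Extending
  \<open>{0, y}\<close> inside the complement of \<open>a\<close> and \<open>b\<close> gives a
  codeword whose subspace detects \<open>c\<close> at \<open>y\<close>.\<close>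

lemma codeword_separates:
  assumes U: "U \<in> isotropic_d" "\<phi> \<in> vanishing U" "translate \<phi> a \<in> vanishing U" "translate \<phi> b \<in> vanishing U"
    and w: "w \<in> U" "w \<notin> {0, a, b, a + b}" and c: "c \<notin> {0, a, b, a + b}"
  shows "\<exists>S\<in>base_code. \<phi> \<in> S \<and> translate \<phi> a \<in> S \<and> translate \<phi> b \<in> S \<and> translate \<phi> c \<notin> S"
proof -
  let ?T = "{0, a, b, a + b}"
  have \<phi>: "\<phi> \<in> Q" and U0: "\<forall>u\<in>U. \<phi> u = 0" and sub: "vec.subspace U" and cU: "card U = 2 ^ d"
    using U card_subspace_bit by (auto simp: vanishing_def isotropic_d_def)
  have ab: "\<phi> a = 0" "\<phi> b = 0"
    using U translate_mem_Q_iff[OF \<phi>] by (auto simp: vanishing_def)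
  have "B a u = 0" "B b u = 0" if "u \<in> U" for u
    using U(3,4) U0 that by (auto simp: vanishing_def translate_def)
  then have UT: "U \<subseteq> perp ?T"
    by (auto simp: perp_def B_add_left)
  obtain y where y: "y \<in> perp ?T" "\<phi> y = 0" "B c y = 1"
    using exists_singular_in_perp[OF qf_Q[OF \<phi>] subspace_four c w(2)] UT w(1) U0 by blast
  have y0: "y \<noteq> 0" using y by auto
  have "vec.subspace {0, y}"
    by (auto simp: subspace_bit_iff)
  moreover have "{0, y} \<subseteq> perp ?T"
    using y subspace_perp by (auto simp: subspace_bit_iff)
  moreover have "\<forall>x\<in>{0, y}. \<phi> x = 0"
    using y qf_0[OF qf_Q[OF \<phi>]] by simp
  moreover have "card {0, y} \<le> card U"
    using cU d y0 power_increasing[of 1 d "2::nat"] by simp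
  ultimately obtain U' where U': "vec.subspace U'" "{0, y} \<subseteq> U'" "U' \<subseteq> perp ?T" "\<forall>x\<in>U'. \<phi> x = 0" "card U' = card U"
    using extend_singular_subspace[OF qf_Q[OF \<phi>] subspace_perp sub UT U0] by meson
  have "U' \<in> isotropic_d"
    using isotropic_dI[OF qf_Q[OF \<phi>]] U' cU by simp
  moreover have "B a u = 0" "B b u = 0" if "u \<in> U'" for u
    using U'(3) that by (auto simp: perp_def)
  then have "\<phi> \<in> vanishing U'" "translate \<phi> a \<in> vanishing U'" "translate \<phi> b \<in> vanishing U'"
    using \<phi> U'(4) ab translate_mem_Q_iff[OF \<phi>]
    by (auto simp: vanishing_def) (auto simp: translate_def)
  moreover have "translate \<phi> c \<notin> vanishing U'"
    using U' y by (auto simp: vanishing_def translate_def)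
  ultimately show ?thesis
    by (auto simp: base_code_def)
qed

definition unsplit :: "(bit ^ 'm \<Rightarrow> bit) set \<Rightarrow> bool" where
  "unsplit F \<longleftrightarrow> (\<exists>S\<in>base_code. F \<subseteq> S) \<and> \<not> (\<exists>S\<in>base_code. card (F \<inter> S) = 3)"

text \<open>The right-hand side mentions only incidence of forms with codewords, so every
  permutation preserving the code respects it.\<close>

lemma zero_sum_iff_unsplit:
  assumes Q: "\<phi> \<in> Q" "\<phi>' \<in> Q" "\<psi> \<in> Q" "\<psi>' \<in> Q" and dist: "distinct [\<phi>, \<phi>', \<psi>, \<psi>']"
  shows "zero_sum \<phi> \<phi>' \<psi> \<psi>' \<longleftrightarrow> unsplit {\<phi>, \<phi>', \<psi>, \<psi>'}"
proof -
  obtain a where a: "\<phi>' = translate \<phi> a" "\<phi> a = 0" using Q_eq_translate Q by metis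
  obtain b where b: "\<psi> = translate \<phi> b" "\<phi> b = 0" using Q_eq_translate Q by metis
  obtain c where c: "\<psi>' = translate \<phi> c" "\<phi> c = 0" using Q_eq_translate Q by metis
  have ne: "a \<noteq> 0" "b \<noteq> 0" "c \<noteq> 0" "a \<noteq> b" "a \<noteq> c" "b \<noteq> c"
    using dist a b c by auto
  let ?F = "{\<phi>, \<phi>', \<psi>, \<psi>'}"
  have card3: "card (?F \<inter> S) = 3 \<longleftrightarrow>
      (\<phi> \<notin> S \<and> \<phi>' \<in> S \<and> \<psi> \<in> S \<and> \<psi>' \<in> S) \<or> (\<phi> \<in> S \<and> \<phi>' \<notin> S \<and> \<psi> \<in> S \<and> \<psi>' \<in> S) \<or>
      (\<phi> \<in> S \<and> \<phi>' \<in> S \<and> \<psi> \<notin> S \<and> \<psi>' \<in> S) \<or> (\<phi> \<in> S \<and> \<phi>' \<in> S \<and> \<psi> \<in> S \<and> \<psi>' \<notin> S)" for S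
    using dist by (cases "\<phi> \<in> S"; cases "\<phi>' \<in> S"; cases "\<psi> \<in> S"; cases "\<psi>' \<in> S") simp_all
  show ?thesis
  proof
    assume zs: "zero_sum \<phi> \<phi>' \<psi> \<psi>'"
    then have cab: "c = a + b"
      by (simp add: a b c zero_sum_translate translate_inject)
    have "B a b = 0"
      using c a b by (simp add: cab qf_add[OF qf_Q[OF Q(1)]])
    then have "\<exists>S\<in>base_code. ?F \<subseteq> S"
      using zero_sum_in_codeword[OF Q(1) a(2) b(2) ne(1)] by (simp add: a b c cab)
    moreover have "card (?F \<inter> vanishing U) \<noteq> 3" for U
    proof -
      have "zero_sum \<phi>' \<psi> \<psi>' \<phi>" "zero_sum \<phi> \<psi> \<psi>' \<phi>'" "zero_sum \<phi> \<phi>' \<psi>' \<psi>"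
        using zs by (simp_all add: zero_sum_def add_ac)
      then show ?thesis
        unfolding card3 using zs Q zero_sum_vanishing by blast
    qed
    ultimately show "unsplit ?F"
      by (auto simp: unsplit_def base_code_def)
  next
    assume sep: "unsplit ?F"
    then obtain U where U: "U \<in> isotropic_d" "?F \<subseteq> vanishing U"
      by (auto simp: unsplit_def base_code_def)
    show "zero_sum \<phi> \<phi>' \<psi> \<psi>'"
    proof (rule ccontr)
      assume "\<not> ?thesis"
      then have nc: "c \<noteq> a + b"
        by (simp add: a b c zero_sum_translate translate_inject)
      then have nb: "b \<noteq> a + c" "a \<noteq> b + c"
        by auto
      have "card U = 2 ^ d"
        using U(1) card_subspace_bit by (auto simp: isotropic_d_def)
      then have "card U \<noteq> 1"
        using d by simp
      then have "U \<noteq> {0}"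
        by auto
      moreover have "0 \<in> U"
        using U(1) by (auto simp: isotropic_d_def subspace_bit_iff)
      ultimately obtain w where w: "w \<in> U" "w \<noteq> 0"
        by blast
      have eqs: "a + b \<noteq> b" "a + b \<noteq> a" "a + c \<noteq> a" "a + c \<noteq> c" "a + b \<noteq> a + c" "b + c \<noteq> a + b" "b + c \<noteq> a + c"
        using ne by auto
      \<comment> \<open>As \<open>c\<close> is not in \<open>{0, a, b, a + b}\<close>, the vectors
        \<open>a\<close>, \<open>b\<close>, \<open>c\<close> are independent. The three planes
        spanned by pairs of them meet only in 0, so one of them misses \<open>w\<close>.\<close>
      have wout: "w \<notin> {0, a, b, a + b} \<or> w \<notin> {0, a, c, a + c} \<or> w \<notin> {0, b, c, b + c}"
        using w ne nc nb eqs by auto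
      have mem: "\<phi> \<in> vanishing U" "translate \<phi> a \<in> vanishing U" "translate \<phi> b \<in> vanishing U"
          "translate \<phi> c \<in> vanishing U"
        using U(2) a(1) b(1) c(1) by simp_all
      have out: "c \<notin> {0, a, b, a + b}" "b \<notin> {0, a, c, a + c}" "a \<notin> {0, b, c, b + c}"
        using ne nc nb by simp_all
      have "\<exists>S\<in>base_code. card (?F \<inter> S) = 3"
        using wout
      proof (elim disjE)
        assume "w \<notin> {0, a, b, a + b}"
        then obtain S where "S \<in> base_code" "\<phi> \<in> S" "translate \<phi> a \<in> S" "translate \<phi> b \<in> S"
            "translate \<phi> c \<notin> S"
          using codeword_separates[OF U(1) mem(1) mem(2) mem(3) w(1) _ out(1)] by blast
        then show ?thesis
          unfolding card3 by (intro bexI[of _ S]) (simp_all add: a(1) b(1) c(1))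
      next
        assume "w \<notin> {0, a, c, a + c}"
        then obtain S where "S \<in> base_code" "\<phi> \<in> S" "translate \<phi> a \<in> S" "translate \<phi> c \<in> S"
            "translate \<phi> b \<notin> S"
          using codeword_separates[OF U(1) mem(1) mem(2) mem(4) w(1) _ out(2)] by blast
        then show ?thesis
          unfolding card3 by (intro bexI[of _ S]) (simp_all add: a(1) b(1) c(1))
      next
        assume "w \<notin> {0, b, c, b + c}"
        then obtain S where "S \<in> base_code" "\<phi> \<in> S" "translate \<phi> b \<in> S" "translate \<phi> c \<in> S"
            "translate \<phi> a \<notin> S"
          using codeword_separates[OF U(1) mem(1) mem(3) mem(4) w(1) _ out(3)] by blast
        then show ?thesis
          unfolding card3 by (intro bexI[of _ S]) (simp_all add: a(1) b(1) c(1))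
      qed
      then show False
        using sep by (simp add: unsplit_def)
    qed
  qed
qed

lemma base_code_subset: "S \<in> base_code \<Longrightarrow> S \<subseteq> Q"
  by (auto simp: base_code_def vanishing_def)

section \<open>Recovering an isometry from a permutation preserving the code\<close>

lemma unsplit_image:
  assumes \<sigma>: "bij_betw \<sigma> Q Q" "(`) \<sigma> ` base_code = base_code" and F: "F \<subseteq> Q"
  shows "unsplit (\<sigma> ` F) \<longleftrightarrow> unsplit F"
proof -
  have inj: "inj_on \<sigma> Q"
    using \<sigma>(1) by (simp add: bij_betw_def)
  have bex: "(\<exists>S\<in>base_code. P S) \<longleftrightarrow> (\<exists>S\<in>base_code. P (\<sigma> ` S))" for P
  proof -
    have "(\<exists>S\<in>base_code. P S) \<longleftrightarrow> (\<exists>S\<in>(`) \<sigma> ` base_code. P S)"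
      by (simp only: \<sigma>(2))
    then show ?thesis by blast
  qed
  have "\<sigma> ` F \<subseteq> \<sigma> ` S \<longleftrightarrow> F \<subseteq> S" if "S \<in> base_code" for S
    using inj F base_code_subset[OF that] by (simp add: inj_on_image_subset_iff)
  moreover have "card (\<sigma> ` F \<inter> \<sigma> ` S) = card (F \<inter> S)" if "S \<in> base_code" for S
  proof -
    have "\<sigma> ` F \<inter> \<sigma> ` S = \<sigma> ` (F \<inter> S)"
      using inj F base_code_subset[OF that] by (simp add: inj_on_image_Int)
    moreover have "inj_on \<sigma> (F \<inter> S)"
      using inj F by (meson inj_on_subset Int_lower1 subset_trans)
    ultimately show ?thesis by (simp add: card_image)
  qed
  ultimately show ?thesis
    unfolding unsplit_def bex[of "\<lambda>S. \<sigma> ` F \<subseteq> S"] bex[of "\<lambda>S. card (\<sigma> ` F \<inter> S) = 3"] by simp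
qed

lemma zero_sum_image:
  assumes \<sigma>: "bij_betw \<sigma> Q Q" "(`) \<sigma> ` base_code = base_code"
    and Q: "\<phi> \<in> Q" "\<phi>' \<in> Q" "\<psi> \<in> Q" "\<psi>' \<in> Q" and dist: "distinct [\<phi>, \<phi>', \<psi>, \<psi>']"
  shows "zero_sum (\<sigma> \<phi>) (\<sigma> \<phi>') (\<sigma> \<psi>) (\<sigma> \<psi>') \<longleftrightarrow> zero_sum \<phi> \<phi>' \<psi> \<psi>'"
proof -
  have mem: "\<sigma> \<phi> \<in> Q" "\<sigma> \<phi>' \<in> Q" "\<sigma> \<psi> \<in> Q" "\<sigma> \<psi>' \<in> Q"
    using \<sigma>(1) Q by (auto simp: bij_betw_def)
  have "distinct [\<sigma> \<phi>, \<sigma> \<phi>', \<sigma> \<psi>, \<sigma> \<psi>']"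
    using \<sigma>(1) Q dist by (auto simp: bij_betw_def dest: inj_onD)
  then show ?thesis
    using zero_sum_iff_unsplit[OF mem] zero_sum_iff_unsplit[OF Q dist]
      unsplit_image[OF \<sigma>, of "{\<phi>, \<phi>', \<psi>, \<psi>'}"] Q by simp
qed

lemma preserves_base_code_imp_Sp:
  assumes \<sigma>: "bij_betw \<sigma> Q Q" "(`) \<sigma> ` base_code = base_code"
  shows "\<exists>g\<in>Sp B. \<forall>\<phi>\<in>Q. \<sigma> \<phi> = form_action g \<phi>"
proof -
  obtain \<phi> where \<phi>: "\<phi> \<in> Q" using Q_nonempty by blast
  have \<sigma>Q: "\<sigma> \<psi> \<in> Q" if "\<psi> \<in> Q" for \<psi>
    using \<sigma>(1) that by (auto simp: bij_betw_def)
  have \<sigma>inj: "\<sigma> \<psi> = \<sigma> \<psi>' \<longleftrightarrow> \<psi> = \<psi>'" if "\<psi> \<in> Q" "\<psi>' \<in> Q" for \<psi> \<psi>'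
    using \<sigma>(1) that by (auto simp: bij_betw_def dest: inj_onD)
  define \<phi>' where "\<phi>' = \<sigma> \<phi>"
  have \<phi>': "\<phi>' \<in> Q" using \<sigma>Q \<phi> by (simp add: \<phi>'_def)
  have trQ: "translate \<phi> a \<in> Q" if "\<phi> a = 0" for a
    using that by (simp add: translate_mem_Q_iff[OF \<phi>])
  \<comment> \<open>\<open>\<tau>\<close> is \<open>\<sigma>\<close> read on singular vectors, with
    \<open>\<phi>\<close> as origin in the source and \<open>\<sigma> \<phi>\<close> in the target.
    Its values at nonsingular vectors are arbitrary.\<close>
  have "\<exists>c. \<phi> a = 0 \<longrightarrow> \<sigma> (translate \<phi> a) = translate \<phi>' c \<and> \<phi>' c = 0" for a
    using Q_eq_translate[OF \<phi>' \<sigma>Q[OF trQ[of a]]] by metis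
  then obtain \<tau> where \<tau>: "\<And>a. \<phi> a = 0 \<Longrightarrow> \<sigma> (translate \<phi> a) = translate \<phi>' (\<tau> a)"
    and \<tau>0: "\<And>a. \<phi> a = 0 \<Longrightarrow> \<phi>' (\<tau> a) = 0"
    by metis
  have \<phi>0: "\<phi> 0 = 0"
    using qf_0[OF qf_Q[OF \<phi>]] .
  have \<tau>_eq: "\<tau> a = \<tau> b \<longleftrightarrow> a = b" if "\<phi> a = 0" "\<phi> b = 0" for a b
    using \<tau>[OF that(1)] \<tau>[OF that(2)] \<sigma>inj[OF trQ[OF that(1)] trQ[OF that(2)]]
    by (auto simp: translate_inject)
  have "translate \<phi>' (\<tau> 0) = translate \<phi>' 0"
    using \<tau>[OF \<phi>0] by (simp add: \<phi>'_def)
  then have \<tau>_0: "\<tau> 0 = 0"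
    by (simp only: translate_inject)
  \<comment> \<open>Because every singular vector of \<open>\<phi>'\<close> is some
    \<open>\<tau> b\<close>, a vector is determined by its products with all
    \<open>\<tau> b\<close>; this underlies \<open>uniq\<close>.\<close>
  have onto: "\<exists>a. \<phi> a = 0 \<and> \<tau> a = c" if c: "\<phi>' c = 0" for c
  proof -
    have "translate \<phi>' c \<in> \<sigma> ` Q"
      using \<sigma>(1) translate_mem_Q_iff[OF \<phi>'] c by (simp add: bij_betw_def)
    then obtain \<psi> where \<psi>: "\<psi> \<in> Q" "translate \<phi>' c = \<sigma> \<psi>" by blast
    then obtain a where a: "\<psi> = translate \<phi> a" "\<phi> a = 0"
      using Q_eq_translate[OF \<phi>] by blast
    then show ?thesis
      using \<psi>(2) \<tau>[OF a(2)] by (auto simp: translate_inject)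
  qed
  have pres: "B (\<tau> a) (\<tau> b) = B a b" if a: "\<phi> a = 0" and b: "\<phi> b = 0" for a b
  proof (cases "a = 0 \<or> b = 0 \<or> a = b")
    case True
    then show ?thesis by (auto simp: \<tau>_0)
  next
    case False
    then have ne: "a \<noteq> 0" "b \<noteq> 0" "a \<noteq> b" by auto
    then have ne': "\<tau> a \<noteq> 0" "\<tau> b \<noteq> 0" "\<tau> a \<noteq> \<tau> b"
      using \<tau>_eq[OF a \<phi>0] \<tau>_eq[OF b \<phi>0] \<tau>_eq[OF a b] by (auto simp: \<tau>_0)
    have "B (\<tau> a) (\<tau> b) = 0 \<longleftrightarrow> (\<exists>\<psi>\<in>Q. distinct [\<phi>', translate \<phi>' (\<tau> a), translate \<phi>' (\<tau> b), \<psi>] \<and>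
        zero_sum \<phi>' (translate \<phi>' (\<tau> a)) (translate \<phi>' (\<tau> b)) \<psi>)"
      by (rule orthogonal_iff_zero_sum[OF \<phi>' \<tau>0[OF a] \<tau>0[OF b] ne'])
    also have "\<dots> \<longleftrightarrow> (\<exists>\<psi>\<in>\<sigma> ` Q. distinct [\<sigma> \<phi>, \<sigma> (translate \<phi> a), \<sigma> (translate \<phi> b), \<psi>] \<and>
        zero_sum (\<sigma> \<phi>) (\<sigma> (translate \<phi> a)) (\<sigma> (translate \<phi> b)) \<psi>)"
      using \<sigma>(1) \<tau>[OF a] \<tau>[OF b] by (simp add: bij_betw_def \<phi>'_def)
    also have "\<dots> \<longleftrightarrow> (\<exists>\<psi>\<in>Q. distinct [\<phi>, translate \<phi> a, translate \<phi> b, \<psi>] \<and>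
        zero_sum (\<sigma> \<phi>) (\<sigma> (translate \<phi> a)) (\<sigma> (translate \<phi> b)) (\<sigma> \<psi>))"
      using \<phi> trQ[OF a] trQ[OF b] by (simp add: \<sigma>inj)
    also have "\<dots> \<longleftrightarrow> (\<exists>\<psi>\<in>Q. distinct [\<phi>, translate \<phi> a, translate \<phi> b, \<psi>] \<and>
        zero_sum \<phi> (translate \<phi> a) (translate \<phi> b) \<psi>)"
      using zero_sum_image[OF \<sigma> \<phi> trQ[OF a] trQ[OF b]] by blast
    also have "\<dots> \<longleftrightarrow> B a b = 0"
      by (rule orthogonal_iff_zero_sum[OF \<phi> a b ne, symmetric])
    finally show ?thesis
      by (cases "B a b"; cases "B (\<tau> a) (\<tau> b)") auto
  qed
  have uniq: "y = z" if "\<And>b. \<phi> b = 0 \<Longrightarrow> B y (\<tau> b) = B z (\<tau> b)" for y z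
  proof -
    have "y + z = 0"
    proof (rule singular_nondegenerate[OF \<phi>'])
      fix c assume "\<phi>' c = 0"
      then obtain b where "\<phi> b = 0" "c = \<tau> b" using onto by blast
      then show "B (y + z) c = 0"
        using that by (simp add: B_add_left)
    qed
    then show ?thesis by (simp add: vec_add_eq_0_iff)
  qed
  \<comment> \<open>The linear extension is defined by duality rather than on a basis: the image of
    \<open>x\<close> is to be the vector whose products with \<open>\<tau> b\<close> equal
    \<open>B x b\<close>. The \<open>x\<close> for which it exists form a subspace, which by
    \<open>pres\<close> contains the singular vectors.\<close>
  define S where "S = {x. \<exists>y. \<forall>b. \<phi> b = 0 \<longrightarrow> B y (\<tau> b) = B x b}"
  have "vec.subspace S"
    unfolding subspace_bit_iff
  proof (intro conjI ballI)
    show "0 \<in> S"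
      by (auto simp: S_def intro!: exI[of _ 0])
    fix x y assume "x \<in> S" "y \<in> S"
    then obtain x' y' where "\<And>b. \<phi> b = 0 \<Longrightarrow> B x' (\<tau> b) = B x b" "\<And>b. \<phi> b = 0 \<Longrightarrow> B y' (\<tau> b) = B y b"
      unfolding S_def by blast
    then show "x + y \<in> S"
      by (auto simp: S_def B_add_left intro!: exI[of _ "x' + y'"])
  qed
  moreover have "a \<in> S" if "\<phi> a = 0" for a
    using pres[OF that] by (auto simp: S_def)
  ultimately have "x \<in> S" for x
    using singular_spans[OF \<phi>] by blast
  then have "\<exists>y. \<forall>b. \<phi> b = 0 \<longrightarrow> B y (\<tau> b) = B x b" for x
    by (simp add: S_def)
  then obtain g where g: "\<And>x b. \<phi> b = 0 \<Longrightarrow> B (g x) (\<tau> b) = B x b"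
    by metis
  have g\<tau>: "g a = \<tau> a" if "\<phi> a = 0" for a
    using g pres[OF that] by (intro uniq) simp
  have g_add: "g (x + y) = g x + g y" for x y
    using g by (intro uniq) (simp add: B_add_left)
  have g0: "g 0 = 0"
    using g_add[of 0 0] by simp
  have g_zero: "x = 0" if "g x = 0" for x
    using g[of _ x] that by (intro singular_nondegenerate[OF \<phi>]) simp
  have "inj g"
  proof
    fix x y assume "g x = g y"
    then have "g (x + y) = 0" by (simp add: g_add)
    then show "x = y"
      using g_zero[of "x + y"] by (simp add: vec_add_eq_0_iff)
  qed
  then have "bij g"
    by (simp add: bij_def finite_UNIV_inj_surj)
  moreover have "B (g x) (g y) = B x y" for x y
  proof -
    have "vec.subspace {y. \<forall>x. B (g x) (g y) = B x y}"
      by (simp add: subspace_bit_iff g0 g_add B_add_right)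
    moreover have "a \<in> {y. \<forall>x. B (g x) (g y) = B x y}" if "\<phi> a = 0" for a
      using g that g\<tau>[OF that] by simp
    ultimately have "y \<in> {y. \<forall>x. B (g x) (g y) = B x y}"
      by (rule singular_spans[OF \<phi>])
    then show ?thesis by simp
  qed
  ultimately have gSp: "g \<in> Sp B"
    using g_add by (simp add: Sp_iff)
  \<comment> \<open>Both sides have polarisation \<open>B\<close>, as \<open>g\<close> is an
    isometry, so they agree on a subspace; on singular vectors both are 0.\<close>
  have eq: "\<phi>' (g x) = \<phi> x" for x
  proof -
    have "vec.subspace {x. \<phi>' (g x) = \<phi> x}"
      using \<phi>0 qf_0[OF qf_Q[OF \<phi>']] Sp_B[OF gSp]
      by (simp add: subspace_bit_iff g0 g_add qf_add[OF qf_Q[OF \<phi>]] qf_add[OF qf_Q[OF \<phi>']])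
    moreover have "a \<in> {x. \<phi>' (g x) = \<phi> x}" if "\<phi> a = 0" for a
      using that g\<tau>[OF that] \<tau>0[OF that] by simp
    ultimately have "x \<in> {x. \<phi>' (g x) = \<phi> x}"
      by (rule singular_spans[OF \<phi>])
    then show ?thesis by simp
  qed
  have \<phi>g: "form_action g \<phi> = \<phi>'"
  proof
    fix x
    show "form_action g \<phi> x = \<phi>' x"
      using eq[of "finv g x"] Sp_inv_apply(1)[OF gSp, of x] by (simp add: form_action_def)
  qed
  have "\<sigma> \<psi> = form_action g \<psi>" if \<psi>: "\<psi> \<in> Q" for \<psi>
  proof -
    obtain a where a: "\<psi> = translate \<phi> a" "\<phi> a = 0"
      using Q_eq_translate[OF \<phi> \<psi>] by blast
    then show ?thesis
      using \<tau>[OF a(2)] g\<tau>[OF a(2)] by (simp add: form_action_translate[OF gSp] \<phi>g)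
  qed
  with gSp show ?thesis by blast
qed

section \<open>The codes\<close>

lemma card_base_code:
  assumes "S \<in> base_code"
  shows "int (card S) = 2 ^ (n - 1) * (2 ^ (n - d) + \<epsilon>)"
proof -
  obtain U where "vec.subspace U" "totally_isotropic B U" "vec.dim U = d" "S = vanishing U"
    using assms by (auto simp: base_code_def isotropic_d_def)
  then show ?thesis
    using card_vanishing_dim[of U d] d(2) by simp
qed

lemma card_Q_split: "int (card Q) = 2 ^ (n - 1) * (2 ^ (n - d) + \<epsilon>) + 2 ^ (2 * n - d - 1) * (2 ^ d - 1)"
proof -
  have "(2::int) ^ (n - 1) * 2 ^ n = 2 ^ (2 * n - d - 1) * 2 ^ d"
    using d n2 by (simp flip: power_add)
  moreover have "(2::int) ^ (n - 1) * 2 ^ (n - d) = 2 ^ (2 * n - d - 1)"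
    using d n2 by (simp flip: power_add)
  ultimately show ?thesis
    unfolding card_Q by (simp add: algebra_simps)
qed

lemma card_base_code_complement:
  assumes "S \<in> base_code"
  shows "int (card (Q - S)) = 2 ^ (2 * n - d - 1) * (2 ^ d - 1)"
proof -
  have "card (Q - S) = card Q - card S" "card S \<le> card Q"
    using base_code_subset[OF assms] finite_Q by (auto intro: card_Diff_subset card_mono finite_subset)
  then show ?thesis
    using card_Q_split card_base_code[OF assms] by simp
qed

text \<open>The exception is sharp: for \<open>(2, 1, -1)\<close> the value is
  \<open>2 * (2 - 1) = 2\<close>.\<close>

lemma vanishing_size_bounds:
  "2 \<le> (2::int) ^ (n - 1) * (2 ^ (n - d) + \<epsilon>)"
  "(n, d, \<epsilon>) \<noteq> (2, 1, -1) \<Longrightarrow> 3 \<le> (2::int) ^ (n - 1) * (2 ^ (n - d) + \<epsilon>)"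
proof -
  have p: "(2::int) \<le> 2 ^ (n - 1)"
    using n2 power_increasing[of 1 "n - 1" "2::int"] by simp
  have q: "1 \<le> (2::int) ^ (n - d) + \<epsilon>" "\<epsilon> = 1 \<Longrightarrow> 2 \<le> (2::int) ^ (n - d) + \<epsilon>"
  proof -
    show "\<epsilon> = 1 \<Longrightarrow> 2 \<le> (2::int) ^ (n - d) + \<epsilon>" by simp
    show "1 \<le> (2::int) ^ (n - d) + \<epsilon>"
    proof (cases "\<epsilon> = 1")
      case False
      then have "\<epsilon> = -1" "d < n" using sign d by auto
      then show ?thesis
        using power_increasing[of 1 "n - d" "2::int"] by simp
    qed simp
  qed
  show "2 \<le> (2::int) ^ (n - 1) * (2 ^ (n - d) + \<epsilon>)"
    using mult_mono[OF p q(1)] by simp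
  show "3 \<le> (2::int) ^ (n - 1) * (2 ^ (n - d) + \<epsilon>)" if "(n, d, \<epsilon>) \<noteq> (2, 1, -1)"
  proof (cases "\<epsilon> = 1")
    case True
    then show ?thesis using mult_mono[OF p q(2)] by simp
  next
    case False
    then have e: "\<epsilon> = -1" "d < n" using sign d by auto
    show ?thesis
    proof (cases "n = 2")
      case True
      then show ?thesis using that e d by auto
    next
      case False
      then have "(2::int) ^ 2 \<le> 2 ^ (n - 1)"
        using n2 by (intro power_increasing) auto
      then have "(4::int) \<le> 2 ^ (n - 1)" by simp
      from mult_mono[OF this q(1)] show ?thesis by simp
    qed
  qed
qed

lemma complement_size_bound: "3 \<le> (2::int) ^ (2 * n - d - 1) * (2 ^ d - 1)"
proof (cases "d = 1")
  case True
  have "(2::int) ^ 2 \<le> 2 ^ (2 * n - d - 1)"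
    using n2 True by (intro power_increasing) auto
  then show ?thesis using True by simp
next
  case False
  then have "(2::int) ^ 2 \<le> 2 ^ d"
    using d by (intro power_increasing) auto
  then have "3 \<le> (2::int) ^ d - 1" by simp
  moreover have "1 \<le> (2::int) ^ (2 * n - d - 1)" by simp
  ultimately show ?thesis
    using mult_mono[of 1 "(2::int) ^ (2 * n - d - 1)" 3 "2 ^ d - 1"] by simp
qed

text \<open>After cancelling \<open>2 ^ (n - 1)\<close> the left side is even and
  \<open>2 ^ n + \<epsilon>\<close> is odd. Since the two codeword sizes add up to
  \<open>card Q\<close>, this settles both values of \<open>\<delta>\<close>.\<close>

lemma half_size_ne: "2 * ((2::int) ^ (n - 1) * (2 ^ (n - d) + \<epsilon>)) \<noteq> int (card Q)"
proof
  assume "2 * ((2::int) ^ (n - 1) * (2 ^ (n - d) + \<epsilon>)) = int (card Q)"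
  then have "(2::int) ^ (n - 1) * (2 * (2 ^ (n - d) + \<epsilon>)) = 2 ^ (n - 1) * (2 ^ n + \<epsilon>)"
    unfolding card_Q by (simp add: algebra_simps)
  then have "2 * (2 ^ (n - d) + \<epsilon>) = 2 ^ n + \<epsilon>"
    by simp
  then have "even (2 ^ n + \<epsilon>)"
    by (metis dvd_triv_left)
  then show False
    using n2 sign by auto
qed

lemma base_code_nonempty: "base_code \<noteq> {}"
proof -
  obtain \<phi> where "\<phi> \<in> Q" using Q_nonempty by blast
  then show ?thesis
    using exists_isotropic_vanishing[of \<phi>] by (auto simp: base_code_def)
qed

lemma code_eq:
  "code B n d \<epsilon> 0 = base_code"
  "code B n d \<epsilon> 1 = (\<lambda>S. Q - S) ` base_code"
proof -
  have 0: "codeword B n d \<epsilon> 0 U = vanishing U" and 1: "codeword B n d \<epsilon> 1 U = Q - vanishing U"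
    if "U \<in> isotropic_d" for U
    using that codeword_eq d(1) by (auto simp: isotropic_d_def)
  have "code B n d \<epsilon> \<delta> = codeword B n d \<epsilon> \<delta> ` isotropic_d" for \<delta>
    by (auto simp: code_def isotropic_d_def)
  then show "code B n d \<epsilon> 0 = base_code" "code B n d \<epsilon> 1 = (\<lambda>S. Q - S) ` base_code"
    using 0 1 by (auto simp: base_code_def image_image)
qed

section \<open>Stabilisers and strong incidence-transitivity\<close>

lemma vanishing_stabiliser:
  assumes g: "g \<in> Sp B" and U: "U \<in> isotropic_d"
  shows "form_action g ` vanishing U = vanishing U \<longleftrightarrow> g ` U = U"
proof
  assume eq: "form_action g ` vanishing U = vanishing U"
  have U': "vec.subspace U" "totally_isotropic B U"
    using U by (auto simp: isotropic_d_def)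
  have "vanishing U \<noteq> {}"
    using card_base_code[of "vanishing U"] vanishing_size_bounds(1) U by (auto simp: base_code_def)
  then have "U = g ` U"
    using vanishing_inject[OF U' Sp_subspace[OF g U'(1)]] Sp_card_image[OF g] form_action_vanishing[OF g] eq
    by simp
  then show "g ` U = U" by simp
qed (simp add: form_action_vanishing[OF g])

lemma base_code_strongly_incidence_transitive:
  "strongly_incidence_transitive Q (Sp_on_forms B n \<epsilon>) base_code"
  unfolding strongly_incidence_transitive_def
proof (intro conjI ballI)
  have im: "restrict (form_action g) Q ` vanishing U = vanishing (g ` U)" if "g \<in> Sp B" for g U
  proof -
    have "restrict (form_action g) Q ` vanishing U = form_action g ` vanishing U"
      by (intro image_cong) (auto simp: vanishing_def)
    then show ?thesis using form_action_vanishing[OF that] by simp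
  qed
  have iso: "g ` U \<in> isotropic_d" if "g \<in> Sp B" "U \<in> isotropic_d" for g U
  proof -
    have U: "vec.subspace U" "totally_isotropic B U" "vec.dim U = d"
      using that(2) by (auto simp: isotropic_d_def)
    have "card (g ` U) = 2 ^ d"
      using Sp_card_image[OF that(1), of U] card_subspace_bit[OF U(1)] U(3) by simp
    then show ?thesis
      using Sp_subspace[OF that(1) U(1)] Sp_totally_isotropic[OF that(1) U(2)] dim_eq_iff_card_bit
      unfolding isotropic_d_def by blast
  qed
  show "subgroup (Sp_on_forms B n \<epsilon>) (BijGroup Q)"
    by (rule subgroup_Sp_on_forms)
  show "s ` \<Delta> \<in> base_code" if "s \<in> Sp_on_forms B n \<epsilon>" "\<Delta> \<in> base_code" for s \<Delta>
    using that im iso by (auto simp: Sp_on_forms_def base_code_def)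
  show "\<exists>s\<in>Sp_on_forms B n \<epsilon>. s ` \<Delta> = \<Delta>'" if \<Delta>: "\<Delta> \<in> base_code" "\<Delta>' \<in> base_code" for \<Delta> \<Delta>'
  proof -
    obtain U U' where U: "U \<in> isotropic_d" "U' \<in> isotropic_d" "\<Delta> = vanishing U" "\<Delta>' = vanishing U'"
      using \<Delta> by (auto simp: base_code_def)
    have "card U = card U'"
      using U(1,2) by (simp add: isotropic_d_def card_subspace_bit)
    then obtain g where "g \<in> Sp B" "g ` U = U'"
      using Sp_transitive_isotropic U(1,2) unfolding isotropic_d_def by blast
    then show ?thesis
      using im[of g U] U by (auto simp: Sp_on_forms_def)
  qed
  fix \<Delta> p assume \<Delta>: "\<Delta> \<in> base_code" and p: "p \<in> \<Delta> \<times> (Q - \<Delta>)"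
  obtain U where U: "U \<in> isotropic_d" "\<Delta> = vanishing U"
    using \<Delta> by (auto simp: base_code_def)
  have key: "\<exists>s\<in>setwise_stabiliser (Sp_on_forms B n \<epsilon>) (\<lambda>g. g) \<Delta>. s a = a' \<and> s b = b'"
    if ab: "a \<in> \<Delta>" "b \<in> Q - \<Delta>" "a' \<in> \<Delta>" "b' \<in> Q - \<Delta>" for a b a' b'
  proof -
    obtain g where g: "g \<in> Sp B" "g ` U = U" "form_action g a = a'" "form_action g b = b'"
      using stabiliser_transitive_pairs[of U a a' b b'] U ab by (auto simp: isotropic_d_def)
    have "restrict (form_action g) Q \<in> setwise_stabiliser (Sp_on_forms B n \<epsilon>) (\<lambda>g. g) \<Delta>"
      using im[OF g(1), of U] g(1,2) U(2) unfolding setwise_stabiliser_def Sp_on_forms_def by simp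
    moreover have "restrict (form_action g) Q a = a'" "restrict (form_action g) Q b = b'"
      using g(3,4) ab U(2) by (simp_all add: vanishing_def)
    ultimately show ?thesis by blast
  qed
  show "case p of (a, b) \<Rightarrow> \<forall>(a', b')\<in>\<Delta> \<times> (Q - \<Delta>).
      \<exists>s\<in>setwise_stabiliser (Sp_on_forms B n \<epsilon>) (\<lambda>g. g) \<Delta>. s a = a' \<and> s b = b'"
  proof (cases p)
    case (Pair a b)
    show ?thesis
      unfolding Pair prod.case
    proof
      fix q assume "q \<in> \<Delta> \<times> (Q - \<Delta>)"
      then obtain a' b' where q: "q = (a', b')" "a' \<in> \<Delta>" "b' \<in> Q - \<Delta>" by blast
      show "case q of (a', b') \<Rightarrow> \<exists>s\<in>setwise_stabiliser (Sp_on_forms B n \<epsilon>) (\<lambda>g. g) \<Delta>. s a = a' \<and> s b = b'"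
        unfolding q(1) prod.case using p Pair q(2,3) by (intro key) auto
    qed
  qed
qed

end

text \<open>Passing to complements exchanges the two coordinates of the pairs and leaves the setwise
  stabilisers unchanged.\<close>

lemma strongly_incidence_transitive_complement:
  assumes T: "strongly_incidence_transitive \<V> G \<Gamma>" and \<Gamma>: "\<And>\<Delta>. \<Delta> \<in> \<Gamma> \<Longrightarrow> \<Delta> \<subseteq> \<V>"
  shows "strongly_incidence_transitive \<V> G ((\<lambda>\<Delta>. \<V> - \<Delta>) ` \<Gamma>)"
proof -
  note T' = T[unfolded strongly_incidence_transitive_def]
  note G = T'[THEN conjunct1] and closed = T'[THEN conjunct2, THEN conjunct1, rule_format]
    and trans = T'[THEN conjunct2, THEN conjunct2, THEN conjunct1, rule_format]
  have pairs: "\<exists>g\<in>G. g ` \<Delta> = \<Delta> \<and> g a = a' \<and> g b = b'"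
    if "\<Delta> \<in> \<Gamma>" "a \<in> \<Delta>" "b \<in> \<V> - \<Delta>" "a' \<in> \<Delta>" "b' \<in> \<V> - \<Delta>" for \<Delta> a b a' b'
  proof -
    have "\<forall>(a, b)\<in>\<Delta> \<times> (\<V> - \<Delta>). \<forall>(a', b')\<in>\<Delta> \<times> (\<V> - \<Delta>).
        \<exists>g\<in>setwise_stabiliser G (\<lambda>g. g) \<Delta>. g a = a' \<and> g b = b'"
      using T'[THEN conjunct2, THEN conjunct2, THEN conjunct2] that(1) by (rule bspec)
    from bspec[OF this, of "(a, b)"] have "\<forall>(a', b')\<in>\<Delta> \<times> (\<V> - \<Delta>).
        \<exists>g\<in>setwise_stabiliser G (\<lambda>g. g) \<Delta>. g a = a' \<and> g b = b'"
      using that by simp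
    from bspec[OF this, of "(a', b')"] show ?thesis
      using that by (auto simp: setwise_stabiliser_def)
  qed
  have compl: "g ` (\<V> - \<Delta>) = \<V> - g ` \<Delta>" if "g \<in> G" "\<Delta> \<in> \<Gamma>" for g \<Delta>
  proof -
    have "g \<in> Bij \<V>"
      using subgroup.subset[OF G] that(1) by (auto simp: BijGroup_def)
    then show ?thesis
      using \<Gamma>[OF that(2)] inj_on_image_set_diff[of g \<V> \<V> \<Delta>] by (auto simp: Bij_def bij_betw_def)
  qed
  have dd: "\<V> - (\<V> - \<Delta>) = \<Delta>" if "\<Delta> \<in> \<Gamma>" for \<Delta>
    using \<Gamma>[OF that] by blast
  show ?thesis
    unfolding strongly_incidence_transitive_def
  proof (intro conjI ballI)
    show "g ` \<Delta> \<in> (\<lambda>\<Delta>. \<V> - \<Delta>) ` \<Gamma>" if "g \<in> G" "\<Delta> \<in> (\<lambda>\<Delta>. \<V> - \<Delta>) ` \<Gamma>" for g \<Delta>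
      using that closed compl by auto
    show "\<exists>g\<in>G. g ` \<Delta> = \<Delta>'" if \<Delta>: "\<Delta> \<in> (\<lambda>\<Delta>. \<V> - \<Delta>) ` \<Gamma>" "\<Delta>' \<in> (\<lambda>\<Delta>. \<V> - \<Delta>) ` \<Gamma>" for \<Delta> \<Delta>'
    proof -
      obtain E E' where E: "E \<in> \<Gamma>" "E' \<in> \<Gamma>" "\<Delta> = \<V> - E" "\<Delta>' = \<V> - E'"
        using \<Delta> by blast
      obtain g where "g \<in> G" "g ` E = E'"
        using trans E by blast
      then show ?thesis
        using compl[of g E] E by auto
    qed
    fix \<Delta> p assume \<Delta>: "\<Delta> \<in> (\<lambda>\<Delta>. \<V> - \<Delta>) ` \<Gamma>" and p: "p \<in> \<Delta> \<times> (\<V> - \<Delta>)"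
    obtain E where E: "E \<in> \<Gamma>" "\<Delta> = \<V> - E"
      using \<Delta> by blast
    obtain a b where ab: "p = (a, b)" "a \<in> \<V> - E" "b \<in> E"
      using p dd[OF E(1)] E by auto
    show "case p of (a, b) \<Rightarrow> \<forall>(a', b')\<in>\<Delta> \<times> (\<V> - \<Delta>).
        \<exists>g\<in>setwise_stabiliser G (\<lambda>g. g) \<Delta>. g a = a' \<and> g b = b'"
      unfolding ab(1) prod.case
    proof
      fix q assume "q \<in> \<Delta> \<times> (\<V> - \<Delta>)"
      then obtain a' b' where q: "q = (a', b')" "a' \<in> \<V> - E" "b' \<in> E"
        using dd[OF E(1)] E by auto
      obtain g where g: "g \<in> G" "g ` E = E" "g b = b'" "g a = a'"
        using pairs[OF E(1) ab(3,2) q(3,2)] by blast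
      then have "g \<in> setwise_stabiliser G (\<lambda>g. g) \<Delta>"
        using compl[OF g(1) E(1)] E by (simp add: setwise_stabiliser_def)
      with g show "case q of (a', b') \<Rightarrow> \<exists>g\<in>setwise_stabiliser G (\<lambda>g. g) \<Delta>. g a = a' \<and> g b = b'"
        unfolding q(1) prod.case by blast
    qed
  qed (rule G)
qed

section \<open>Permutations acting on subsets, and the automorphism group of the code\<close>

lemma on_subsets_in_johnson_aut:
  assumes V: "finite \<V>" and \<sigma>: "bij_betw \<sigma> \<V> \<V>"
  shows "on_subsets \<V> k \<sigma> \<in> johnson_aut \<V> k"
proof -
  let ?J = "johnson_vertices \<V> k"
  have inj: "inj_on \<sigma> \<V>" and im: "\<sigma> ` \<V> = \<V>"
    using \<sigma> by (auto simp: bij_betw_def)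
  have card_im: "card (\<sigma> ` S) = card S" if "S \<subseteq> \<V>" for S
    using inj that by (metis card_image inj_on_subset)
  have mem: "\<sigma> ` S \<in> ?J" if "S \<in> ?J" for S
    using that im card_im by (auto simp: johnson_vertices_def)
  have "inj_on ((`) \<sigma>) ?J"
    using inj by (intro inj_onI) (auto simp: johnson_vertices_def inj_on_image_eq_iff)
  then have "bij_betw ((`) \<sigma>) ?J ?J"
    using mem finite_johnson_vertices[OF V] by (simp add: bij_betw_def endo_inj_surj image_subsetI)
  then have "on_subsets \<V> k \<sigma> \<in> Bij ?J"
    by (simp add: Bij_def on_subsets_def)
  moreover have "johnson_adj k (\<sigma> ` S) (\<sigma> ` T) \<longleftrightarrow> johnson_adj k S T" if "S \<in> ?J" "T \<in> ?J" for S T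
  proof -
    have "S \<subseteq> \<V>" "T \<subseteq> \<V>" using that by (auto simp: johnson_vertices_def)
    then have "card (\<sigma> ` S \<inter> \<sigma> ` T) = card (S \<inter> T)"
      using card_im[of "S \<inter> T"] inj_on_image_Int[OF inj, of S T] by (simp add: le_infI1)
    then show ?thesis by (simp add: johnson_adj_def)
  qed
  ultimately show ?thesis
    by (simp add: johnson_aut_def on_subsets_def)
qed

text \<open>If \<open>\<sigma> x = \<tau> z\<close> with \<open>z \<noteq> x\<close>, a
  \<open>k\<close>-subset containing \<open>x\<close> but not \<open>z\<close> has different images.
  The bounds on \<open>k\<close> provide one.\<close>

lemma on_subsets_inject:
  assumes V: "finite \<V>" and k: "1 \<le> k" "k < card \<V>" and \<sigma>: "bij_betw \<sigma> \<V> \<V>" and \<tau>: "bij_betw \<tau> \<V> \<V>"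
    and eq: "on_subsets \<V> k \<sigma> = on_subsets \<V> k \<tau>" and x: "x \<in> \<V>"
  shows "\<sigma> x = \<tau> x"
proof (rule ccontr)
  assume ne: "\<sigma> x \<noteq> \<tau> x"
  have "\<sigma> x \<in> \<tau> ` \<V>"
    using \<sigma> \<tau> x by (auto simp: bij_betw_def)
  then obtain z where z: "z \<in> \<V>" "\<sigma> x = \<tau> z" by blast
  have zx: "z \<noteq> x" using ne z by auto
  have "k - 1 \<le> card (\<V> - {x, z})"
    using V x z(1) zx k by (simp add: card_Diff_subset)
  then obtain R where R: "R \<subseteq> \<V> - {x, z}" "card R = k - 1" "finite R"
    by (metis obtain_subset_with_card_n)
  define S where "S = insert x R"
  have "x \<notin> R" using R by auto
  then have S: "S \<in> johnson_vertices \<V> k" "x \<in> S" "z \<notin> S" "S \<subseteq> \<V>"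
    using R x k zx by (auto simp: S_def johnson_vertices_def)
  have "\<sigma> ` S = \<tau> ` S"
    using fun_cong[OF eq, of S] S(1) by (simp add: on_subsets_def)
  then have "\<tau> z \<in> \<tau> ` S"
    using S(2) z(2) by (metis imageI)
  then show False
    using \<tau> z(1) S(3,4) by (auto simp: bij_betw_def dest: inj_onD)
qed

context sp_code
begin

lemma Sp_bij_betw_Q: "g \<in> Sp B \<Longrightarrow> bij_betw (restrict (form_action g) Q) Q Q"
  using form_action_Q form_action_inj_on_Q by (simp add: bij_betw_def)

text \<open>The inducing permutation commutes with complements, so for \<open>\<delta> = 1\<close>
  it also preserves \<open>base_code\<close>. Conversely, on a finite code closure under an
  injective map already gives equality.\<close>

lemma code_aut_eq:
  assumes k: "1 \<le> k" "k < card Q" "2 * k \<noteq> card Q" and \<Gamma>: "\<Gamma> \<subseteq> johnson_vertices Q k"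
    and cases: "\<Gamma> = base_code \<or> \<Gamma> = (\<lambda>S. Q - S) ` base_code"
    and closed: "\<And>s S. s \<in> Sp_on_forms B n \<epsilon> \<Longrightarrow> S \<in> \<Gamma> \<Longrightarrow> s ` S \<in> \<Gamma>"
  shows "code_aut Q k \<Gamma> = on_subsets Q k ` Sp_on_forms B n \<epsilon>"
proof (intro equalityI subsetI)
  fix f assume "f \<in> code_aut Q k \<Gamma>"
  then have f: "f \<in> johnson_aut Q k" "f ` \<Gamma> = \<Gamma>"
    by (auto simp: code_aut_def)
  obtain \<sigma> where \<sigma>: "bij_betw \<sigma> Q Q" "\<forall>S\<in>johnson_vertices Q k. f S = \<sigma> ` S"
    using johnson_aut_induced[OF finite_Q k f(1)] by blast
  have \<sigma>\<Gamma>: "(`) \<sigma> ` \<Gamma> = \<Gamma>"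
    using f(2) \<sigma>(2) \<Gamma> by (metis (no_types, lifting) image_cong subsetD)
  have "(`) \<sigma> ` base_code = base_code"
    using cases
  proof
    assume eq: "\<Gamma> = (\<lambda>S. Q - S) ` base_code"
    have dd: "Q - (Q - S) = S" if "S \<in> base_code" for S
      using base_code_subset[OF that] by blast
    then have bc: "base_code = (\<lambda>S. Q - S) ` \<Gamma>"
      unfolding eq by (simp add: image_image)
    have "\<sigma> ` (Q - S) = Q - \<sigma> ` S" if "S \<in> \<Gamma>" for S
      using \<sigma>(1) \<Gamma> that inj_on_image_set_diff[of \<sigma> Q Q S]
      by (auto simp: bij_betw_def johnson_vertices_def)
    then have "(`) \<sigma> ` base_code = (\<lambda>S. Q - S) ` (`) \<sigma> ` \<Gamma>"
      unfolding bc by (auto simp: image_image)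
    then show ?thesis
      using \<sigma>\<Gamma> bc by simp
  qed (use \<sigma>\<Gamma> in simp)
  then obtain g where g: "g \<in> Sp B" "\<forall>\<phi>\<in>Q. \<sigma> \<phi> = form_action g \<phi>"
    using preserves_base_code_imp_Sp[OF \<sigma>(1)] by blast
  have "f = on_subsets Q k (restrict (form_action g) Q)"
  proof
    fix S
    show "f S = on_subsets Q k (restrict (form_action g) Q) S"
    proof (cases "S \<in> johnson_vertices Q k")
      case True
      then have "\<sigma> ` S = restrict (form_action g) Q ` S"
        using g(2) by (intro image_cong) (auto simp: johnson_vertices_def)
      then show ?thesis
        using \<sigma>(2) True by (simp add: on_subsets_def)
    next
      case False
      then show ?thesis
        using f(1) by (auto simp: johnson_aut_def Bij_def extensional_def on_subsets_def)
    qed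
  qed
  then show "f \<in> on_subsets Q k ` Sp_on_forms B n \<epsilon>"
    using g(1) by (auto simp: Sp_on_forms_def)
next
  fix f assume "f \<in> on_subsets Q k ` Sp_on_forms B n \<epsilon>"
  then obtain s where s: "s \<in> Sp_on_forms B n \<epsilon>" "f = on_subsets Q k s" by blast
  then have "bij_betw s Q Q"
    using Sp_bij_betw_Q by (auto simp: Sp_on_forms_def)
  then have f: "f \<in> johnson_aut Q k"
    using on_subsets_in_johnson_aut[OF finite_Q] s(2) by simp
  have "f ` \<Gamma> \<subseteq> \<Gamma>"
    using closed[OF s(1)] \<Gamma> by (auto simp: s(2) on_subsets_def)
  moreover have "inj_on f \<Gamma>"
    using f \<Gamma> by (auto simp: johnson_aut_def Bij_def bij_betw_def intro: inj_on_subset)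
  moreover have "finite \<Gamma>"
    using \<Gamma> finite_johnson_vertices[OF finite_Q] by (rule finite_subset)
  ultimately have "f ` \<Gamma> = \<Gamma>"
    using endo_inj_surj by metis
  with f show "f \<in> code_aut Q k \<Gamma>"
    by (simp add: code_aut_def)
qed

lemma Sp_acts_faithfully:
  assumes k: "1 \<le> k" "k < card Q"
  shows "inj_on (\<lambda>g. on_subsets Q k (restrict (form_action g) Q)) (Sp B)"
proof
  fix g h
  assume gh: "g \<in> Sp B" "h \<in> Sp B"
    "on_subsets Q k (restrict (form_action g) Q) = on_subsets Q k (restrict (form_action h) Q)"
  show "g = h"
  proof (rule Sp_eqI[OF gh(1,2)])
    fix \<phi> assume "\<phi> \<in> Q"
    then show "form_action g \<phi> = form_action h \<phi>"
      using on_subsets_inject[OF finite_Q k Sp_bij_betw_Q[OF gh(1)] Sp_bij_betw_Q[OF gh(2)] gh(3)] by simp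
  qed
qed

lemma codeword_stabiliser:
  assumes U: "U \<in> isotropic_d" and \<delta>: "\<delta> \<in> {0, 1}"
  shows "setwise_stabiliser (Sp B) (\<lambda>g. g) U =
    setwise_stabiliser (Sp B) form_action (codeword B n d \<epsilon> \<delta> U)"
proof -
  have U': "vec.subspace U" "totally_isotropic B U" "vec.dim U = d"
    using U by (auto simp: isotropic_d_def)
  have "form_action g ` codeword B n d \<epsilon> \<delta> U = codeword B n d \<epsilon> \<delta> U \<longleftrightarrow> g ` U = U" if g: "g \<in> Sp B" for g
  proof (cases "\<delta> = 0")
    case True
    then show ?thesis
      using codeword_eq(1)[OF U' d(1)] vanishing_stabiliser[OF g U] by simp
  next
    case False
    then have \<delta>1: "\<delta> = 1" using \<delta> by simp
    have "Q - vanishing (g ` U) = Q - vanishing U \<longleftrightarrow> vanishing (g ` U) = vanishing U"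
      by (auto simp: vanishing_def)
    then show ?thesis
      using codeword_eq(2)[OF U' d(1)] vanishing_stabiliser[OF g U] form_action_Q_diff[OF g, of U]
        form_action_vanishing[OF g, of U] \<delta>1 by simp
  qed
  then show ?thesis
    unfolding setwise_stabiliser_def by (intro Collect_cong conj_cong) simp_all
qed

end

theorem theorem5p21:
  fixes B :: "bit ^ 'm \<Rightarrow> bit ^ 'm \<Rightarrow> bit"
    and n d \<delta> k :: nat
    and \<epsilon> :: int
    and \<Q> :: "(bit ^ 'm \<Rightarrow> bit) set"
    and \<Gamma> :: "(bit ^ 'm \<Rightarrow> bit) set set"
  assumes "CARD('m) = 2 * n"
    and "symplectic_form B"
    and "2 \<le> n"
    and "1 \<le> d" and "d \<le> n"
    and "\<epsilon> \<in> {1, -1}"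
    and "(d, \<epsilon>) \<noteq> (n, -1)"
    and "\<delta> \<in> {0, 1}"
    and "int k = (if \<delta> = 0 then 2 ^ (n - 1) * (2 ^ (n - d) + \<epsilon>)
                  else 2 ^ (2 * n - d - 1) * (2 ^ d - 1))"
  defines "\<Q> \<equiv> quadratic_forms B n \<epsilon>"
    and "\<Gamma> \<equiv> code B n d \<epsilon> \<delta>"
  shows
    "johnson_code \<Q> k \<Gamma> \<and>
     (\<comment> \<open>(a)\<close>
      \<forall>U. vec.subspace U \<and> totally_isotropic B U \<and> vec.dim U = d \<longrightarrow>
         setwise_stabiliser (Sp B) (\<lambda>g. g) U =
         setwise_stabiliser (Sp B) form_action (codeword B n d \<epsilon> \<delta> U)) \<and>
     (\<comment> \<open>(b)\<close>
      strongly_incidence_transitive \<Q> (Sp_on_forms B n \<epsilon>) \<Gamma> \<and>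
      \<not> self_complementary \<Q> \<Gamma>) \<and>
     (\<comment> \<open>(c)\<close>
      (n, d, \<epsilon>) \<noteq> (2, 1, -1) \<longrightarrow> 3 \<le> k \<and> int k \<le> int (card \<Q>) - 3) \<and>
     (\<comment> \<open>(d), where \<open>X\<close> acts faithfully\<close>
      inj_on (\<lambda>g. on_subsets \<Q> k (restrict (form_action g) \<Q>)) (Sp B) \<and>
      code_aut \<Q> k \<Gamma> = on_subsets \<Q> k ` Sp_on_forms B n \<epsilon>)"
proof -
  interpret sp_code B n \<epsilon> d
    using assms(1-7) by unfold_locales auto
  let ?k0 = "(2::int) ^ (n - 1) * (2 ^ (n - d) + \<epsilon>)"
  let ?k1 = "(2::int) ^ (2 * n - d - 1) * (2 ^ d - 1)"
  have \<delta>_cases: "\<delta> = 0 \<and> \<Gamma> = base_code \<and> int k = ?k0 \<or>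
      \<delta> = 1 \<and> \<Gamma> = (\<lambda>S. Q - S) ` base_code \<and> int k = ?k1"
    using \<open>\<delta> \<in> {0, 1}\<close> assms(9) code_eq by (auto simp: \<Gamma>_def)
  have sub: "\<Gamma> \<subseteq> johnson_vertices Q k"
  proof
    fix S assume S: "S \<in> \<Gamma>"
    have "S \<subseteq> Q"
      using \<delta>_cases S base_code_subset by auto
    moreover have "int (card S) = int k"
      using \<delta>_cases
    proof (elim disjE conjE)
      assume "\<Gamma> = (\<lambda>S. Q - S) ` base_code" "int k = ?k1"
      then show ?thesis
        using S card_base_code_complement by (metis imageE)
    qed (use S card_base_code in metis)
    ultimately show "S \<in> johnson_vertices Q k"
      using finite_Q by (auto simp: johnson_vertices_def intro: finite_subset)
  qed
  have ne: "\<Gamma> \<noteq> {}"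
    using \<delta>_cases base_code_nonempty by auto
  \<comment> \<open>The two possible sizes are positive and add up to \<open>card Q\<close>, so each
    is smaller than it, and one is half of it iff the other is.\<close>
  have k_bounds: "1 \<le> k" "k < card Q" "2 * k \<noteq> card Q"
    using \<delta>_cases vanishing_size_bounds(1) complement_size_bound card_Q_split half_size_ne by auto
  have transitive: "strongly_incidence_transitive Q (Sp_on_forms B n \<epsilon>) \<Gamma>"
    using \<delta>_cases base_code_strongly_incidence_transitive
      strongly_incidence_transitive_complement[OF base_code_strongly_incidence_transitive base_code_subset]
    by auto
  have "johnson_code Q k \<Gamma>"
    using sub ne by (simp add: johnson_code_def)
  moreover have "\<forall>U. vec.subspace U \<and> totally_isotropic B U \<and> vec.dim U = d \<longrightarrow>
      setwise_stabiliser (Sp B) (\<lambda>g. g) U =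
      setwise_stabiliser (Sp B) form_action (codeword B n d \<epsilon> \<delta> U)"
    using codeword_stabiliser[OF _ \<open>\<delta> \<in> {0, 1}\<close>] by (simp add: isotropic_d_def)
  moreover have "\<not> self_complementary Q \<Gamma>"
  proof
    assume "self_complementary Q \<Gamma>"
    moreover obtain S where S: "S \<in> \<Gamma>" using ne by blast
    ultimately have "Q - S \<in> \<Gamma>"
      unfolding self_complementary_def by blast
    then have "card (Q - S) = k" "card S = k" "S \<subseteq> Q"
      using S sub by (auto simp: johnson_vertices_def)
    then have "card Q - k = k"
      using finite_Q card_Diff_subset[of S Q] finite_subset[of S Q] by simp
    then show False
      using k_bounds by simp
  qed
  moreover have "(n, d, \<epsilon>) \<noteq> (2, 1, -1) \<longrightarrow> 3 \<le> k \<and> int k \<le> int (card Q) - 3"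
    using \<delta>_cases vanishing_size_bounds(2) complement_size_bound card_Q_split by auto
  moreover have "code_aut Q k \<Gamma> = on_subsets Q k ` Sp_on_forms B n \<epsilon>"
  proof (rule code_aut_eq[OF k_bounds sub])
    show "\<Gamma> = base_code \<or> \<Gamma> = (\<lambda>S. Q - S) ` base_code"
      using \<delta>_cases by blast
    show "s ` S \<in> \<Gamma>" if "s \<in> Sp_on_forms B n \<epsilon>" "S \<in> \<Gamma>" for s S
      using transitive[unfolded strongly_incidence_transitive_def, THEN conjunct2, THEN conjunct1] that
      by blast
  qed
  ultimately show ?thesis
    using transitive Sp_acts_faithfully[OF k_bounds(1,2)] unfolding \<Q>_def by (intro conjI)
qed

end
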